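(* Both of the following diagrams of functors are commuting state-and-effect triangles. In both, the top consists of the functors $$\mathbf{EMod}(-,[0,1])\colon\mathbf{EMod}^{\mathrm{op}}\to\mathcal{EM}(\mathcal{R}),\qquad \mathcal{A}(-,[0,1])\colon\mathcal{EM}(\mathcal{R})\to\mathbf{EMod}^{\mathrm{op}},$$ with $\mathcal{A}(-,[0,1])$ left adjoint to $\mathbf{EMod}(-,[0,1])$. 1. The triangle with base $\mathcal{K}\ell(\mathcal{R})$, with predicate functor $\mathrm{Cont}(-,[0,1])\colon\mathcal{K}\ell(\mathcal{R})\to\mathbf{EMod}^{\mathrm{op}}$ and state functor the comparison functor $K\colon\mathcal{K}\ell(\mathcal{R})\to\mathcal{EM}(\mathcal{R})$: there are natural isomorphisms $$\mathbf{EMod}(\mathrm{Cont}(-,[0,1]),[0,1])\cong K,\qquad \mathcal{A}(K(-),[0,1])\cong\mathrm{Cont}(-,[0,1]).$$ 2. The triangle with base $(\mathbf{Cstar}_{\mathrm{PU}})^{\mathrm{op}}$, with predicate functor $[0,1]_{(-)}\colon(\mathbf{Cstar}_{\mathrm{PU}})^{\mathrm{op}}\to\mathbf{EMod}^{\mathrm{op}}$ and state functor $\mathrm{Stat}\colon(\mathbf{Cstar}_{\mathrm{PU}})^{\mathrm{op}}\to\mathcal{EM}(\mathcal{R})$: there are natural isomorphisms $$\mathbf{EMod}([0,1]_{(-)},[0,1])\cong\mathrm{Stat},\qquad \mathcal{A}(\mathrm{Stat}(-),[0,1])\cong[0,1]_{(-)}.$$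
   Context: $C^*$-algebras are unital over $\mathbb{C}$ (the zero algebra is allowed). An element is positive if it is of the form $y^*y$; $x\le y$ means $y-x$ is positive. A PU-map is a linear map preserving positive elements and the unit; $\mathbf{Cstar}_{\mathrm{PU}}$ is the category of $C^*$-algebras with PU-maps. Effect modules. An effect algebra is a partial commutative monoid $(M,0,\oplus)$ with an orthocomplement $(-)^\perp$ such that $x^\perp$ is the unique element with $x\oplus x^\perp=1$, where $1=0^\perp$, and such that $x\oplus1$ defined implies $x=0$. Morphisms preserve $1$ and $\oplus$ (where defined). An effect module is an effect algebra with a scalar multiplication by $[0,1]$ that is a homomorphism of partial monoids in each variable separately, with $1\bullet x=x$ and $(rs)\bullet x=r\bullet(s\bullet x)$; morphisms of the category $\mathbf{EMod}$ are effect algebra maps commuting with scalars. $[0,1]$ is an effect module with $\oplus$ being addition when the sum is at most $1$. For a $C^*$-algebra $A$, $[0,1]_A=\{a\in A\mid 0\le a\le 1\}$ is an effect module ($x\oplus y=x+y$ defined iff $x+y\le1$, $x^\perp=1-x$), and PU-maps restrict to effect module maps, giving the functor $[0,1]_{(-)}$. Radon monad. $\mathbf{CH}$ is the category of compact Hausdorff spaces and continuous maps; $C(X)$ is the $C^*$-algebra of continuous functions $X\to\mathbb{C}$. $\mathcal{R}(X)$ is the set of PU-maps $C(X)\to\mathbb{C}$ with the weak-* topology; $\mathcal{R}(f)(h)(v)=h(v\circ f)$; $\eta(x)(v)=v(x)$; $\mu(g)(v)=g(\lambda h.\,h(v))$. $\mathcal{EM}(\mathcal{R})$ and $\mathcal{K}\ell(\mathcal{R})$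 are its Eilenberg-Moore and Kleisli categories. Morphisms $X\to Y$ in $\mathcal{K}\ell(\mathcal{R})$ are continuous maps $X\to\mathcal{R}(Y)$. The comparison functor $K$ sends $X$ to the free algebra $(\mathcal{R}(X),\mu_X)$ and $f\colon X\to\mathcal{R}(Y)$ to $\mu_Y\circ\mathcal{R}(f)$. Functors. $[0,1]$ carries the $\mathcal{R}$-algebra structure $\mathcal{R}([0,1])\to[0,1]$ sending a measure to its mean, $\phi\mapsto\phi(\iota)$ with $\iota\colon[0,1]\hookrightarrow\mathbb{C}$ the inclusion. For an $\mathcal{R}$-algebra $X$, $\mathcal{A}(X,[0,1])=\mathcal{EM}(\mathcal{R})(X,[0,1])$ is the set of algebra maps (equivalently, continuous affine maps) with pointwise effect module structure; it acts on morphisms by precomposition. For an effect module $M$, $\mathbf{EMod}(M,[0,1])$ is a compact Hausdorff space with the topology of pointwise convergence (subspace of $[0,1]^M$), and an $\mathcal{R}$-algebra via $\alpha_M(h)(x)=h(\mathrm{ev}_x)$, where $\mathrm{ev}_x(v)=v(x)$; it acts on morphisms by precomposition. $\mathrm{Cont}(X,[0,1])$ is the effect module of continuous functions $X\to[0,1]$ with pointwise operations; a Kleisli map $f\colon X\to\mathcal{R}(Y)$ is sent to $\mathrm{Cont}(Y,[0,1])\to\mathrm{Cont}(X,[0,1])$, $p\mapsto(x\mapsto f(x)(p))$. $\mathrm{Stat}(A)$ is the set of PU-maps $A\to\mathbb{C}$ with the weak-* topology, a compact convex subset of the dual of $A$, with $\mathcal{R}$-algebra structure sending $\omega\in\mathcal{R}(\mathrm{Stat}(A))$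 to its barycentre, i.e. to the state $a\mapsto\omega(\phi\mapsto\phi(a))$; $\mathrm{Stat}$ acts on PU-maps by precomposition. State-and-effect triangle: an adjunction between $\mathbf{EMod}^{\mathrm{op}}$ and a category of states, together with a predicate functor and a state functor from a base category; it commutes if, up to natural isomorphism, composing the predicate functor with one adjoint gives the state functor and composing the state functor with the other adjoint gives the predicate functor. *)

theory Defs
  imports "HOL-Analysis.Analysis" "HOL-Algebra.Module"
begin

text \<open>
  Every structure lives on a carrier inside an arbitrary type, and a morphism is a function that is
  extensional on the carrier of its source, so that equality of morphisms is equality in HOL.
  The composite of \<open>f\<close> and \<open>g\<close> is \<open>compose S g f\<close> and the identity is \<open>\<lambda>x\<in>S. x\<close>,
  with \<open>S\<close> the carrier of the source of \<open>f\<close>.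
\<close>


section \<open>Unital C*-algebras and PU-maps\<close>

record 'a cstar = "(complex, 'a) module" +
  star :: "'a \<Rightarrow> 'a"
  cnorm :: "'a \<Rightarrow> real"

definition complex_cstar :: "complex cstar" where
  "complex_cstar = \<lparr>carrier = UNIV, mult = (*), one = 1, zero = 0, add = (+),
     smult = (*), star = cnj, cnorm = cmod\<rparr>"

text \<open>A \<open>ring\<close> of HOL-Algebra is unital and may be trivial, so the zero algebra is included.\<close>

locale cstar_algebra = module complex_cstar A + ring A for A :: "'a cstar" (structure) +
  assumes smult_mult_left:
      "\<lbrakk>x \<in> carrier A; y \<in> carrier A\<rbrakk> \<Longrightarrow> (c \<odot>\<^bsub>A\<^esub> x) \<otimes>\<^bsub>A\<^esub> y = c \<odot>\<^bsub>A\<^esub> (x \<otimes>\<^bsub>A\<^esub> y)"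
    and smult_mult_right:
      "\<lbrakk>x \<in> carrier A; y \<in> carrier A\<rbrakk> \<Longrightarrow> x \<otimes>\<^bsub>A\<^esub> (c \<odot>\<^bsub>A\<^esub> y) = c \<odot>\<^bsub>A\<^esub> (x \<otimes>\<^bsub>A\<^esub> y)"
    and star_closed: "x \<in> carrier A \<Longrightarrow> star A x \<in> carrier A"
    and star_star: "x \<in> carrier A \<Longrightarrow> star A (star A x) = x"
    and star_add:
      "\<lbrakk>x \<in> carrier A; y \<in> carrier A\<rbrakk> \<Longrightarrow> star A (x \<oplus>\<^bsub>A\<^esub> y) = star A x \<oplus>\<^bsub>A\<^esub> star A y"
    and star_smult: "x \<in> carrier A \<Longrightarrow> star A (c \<odot>\<^bsub>A\<^esub> x) = cnj c \<odot>\<^bsub>A\<^esub> star A x"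
    and star_mult:
      "\<lbrakk>x \<in> carrier A; y \<in> carrier A\<rbrakk> \<Longrightarrow> star A (x \<otimes>\<^bsub>A\<^esub> y) = star A y \<otimes>\<^bsub>A\<^esub> star A x"
    and cnorm_nonneg: "x \<in> carrier A \<Longrightarrow> 0 \<le> cnorm A x"
    and cnorm_eq_0: "x \<in> carrier A \<Longrightarrow> cnorm A x = 0 \<longleftrightarrow> x = \<zero>\<^bsub>A\<^esub>"
    and cnorm_add:
      "\<lbrakk>x \<in> carrier A; y \<in> carrier A\<rbrakk> \<Longrightarrow> cnorm A (x \<oplus>\<^bsub>A\<^esub> y) \<le> cnorm A x + cnorm A y"
    and cnorm_smult: "x \<in> carrier A \<Longrightarrow> cnorm A (c \<odot>\<^bsub>A\<^esub> x) = cmod c * cnorm A x"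
    and cnorm_mult:
      "\<lbrakk>x \<in> carrier A; y \<in> carrier A\<rbrakk> \<Longrightarrow> cnorm A (x \<otimes>\<^bsub>A\<^esub> y) \<le> cnorm A x * cnorm A y"
    and cstar_identity: "x \<in> carrier A \<Longrightarrow> cnorm A (star A x \<otimes>\<^bsub>A\<^esub> x) = (cnorm A x)\<^sup>2"
    and complete:
      "\<lbrakk>\<And>n. s n \<in> carrier A;
        \<And>e. 0 < e \<Longrightarrow> \<exists>N. \<forall>m\<ge>N. \<forall>n\<ge>N. cnorm A (s m \<ominus>\<^bsub>A\<^esub> s n) < e\<rbrakk>
       \<Longrightarrow> \<exists>l\<in>carrier A. (\<lambda>n :: nat. cnorm A (s n \<ominus>\<^bsub>A\<^esub> l)) \<longlonglongrightarrow> 0"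

definition positive :: "'a cstar \<Rightarrow> 'a \<Rightarrow> bool" where
  "positive A x \<longleftrightarrow> (\<exists>y\<in>carrier A. x = star A y \<otimes>\<^bsub>A\<^esub> y)"

definition cle :: "'a cstar \<Rightarrow> 'a \<Rightarrow> 'a \<Rightarrow> bool" where
  "cle A x y \<longleftrightarrow> positive A (y \<ominus>\<^bsub>A\<^esub> x)"

definition pu_maps :: "'a cstar \<Rightarrow> 'b cstar \<Rightarrow> ('a \<Rightarrow> 'b) set" where
  "pu_maps A B = {f \<in> carrier A \<rightarrow>\<^sub>E carrier B.
     (\<forall>x\<in>carrier A. \<forall>y\<in>carrier A. f (x \<oplus>\<^bsub>A\<^esub> y) = f x \<oplus>\<^bsub>B\<^esub> f y) \<and>
     (\<forall>c. \<forall>x\<in>carrier A. f (c \<odot>\<^bsub>A\<^esub> x) = c \<odot>\<^bsub>B\<^esub> f x) \<and>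
     (\<forall>x\<in>carrier A. positive A x \<longrightarrow> positive B (f x)) \<and>
     f \<one>\<^bsub>A\<^esub> = \<one>\<^bsub>B\<^esub>}"

text \<open>The state space; the weak-* topology is the topology of pointwise convergence.\<close>

definition stat :: "'a cstar \<Rightarrow> ('a \<Rightarrow> complex) topology" where
  "stat A = subtopology (product_topology (\<lambda>_. euclidean) (carrier A)) (pu_maps A complex_cstar)"


section \<open>Compact Hausdorff spaces and the Radon monad\<close>

definition ch_space :: "'x topology \<Rightarrow> bool" where
  "ch_space X \<longleftrightarrow> compact_space X \<and> Hausdorff_space X"

definition ch_maps :: "'x topology \<Rightarrow> 'y topology \<Rightarrow> ('x \<Rightarrow> 'y) set" where
  "ch_maps X Y = {f \<in> topspace X \<rightarrow>\<^sub>E topspace Y. continuous_map X Y f}"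

text \<open>\<open>C(X)\<close> with the supremum norm; the inserted \<open>0\<close> only matters for the empty space.\<close>

definition cfun :: "'x topology \<Rightarrow> ('x \<Rightarrow> complex) cstar" where
  "cfun X = \<lparr>carrier = ch_maps X euclidean,
     mult = (\<lambda>v w. \<lambda>x\<in>topspace X. v x * w x),
     one = (\<lambda>x\<in>topspace X. 1),
     zero = (\<lambda>x\<in>topspace X. 0),
     add = (\<lambda>v w. \<lambda>x\<in>topspace X. v x + w x),
     smult = (\<lambda>c v. \<lambda>x\<in>topspace X. c * v x),
     star = (\<lambda>v. \<lambda>x\<in>topspace X. cnj (v x)),
     cnorm = (\<lambda>v. Sup (insert 0 ((\<lambda>x. cmod (v x)) ` topspace X)))\<rparr>"

definition radon :: "'x topology \<Rightarrow> (('x \<Rightarrow> complex) \<Rightarrow> complex) topology" where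
  "radon X = stat (cfun X)"

definition radon_map ::
    "'x topology \<Rightarrow> 'y topology \<Rightarrow> ('x \<Rightarrow> 'y) \<Rightarrow>
     (('x \<Rightarrow> complex) \<Rightarrow> complex) \<Rightarrow> ('y \<Rightarrow> complex) \<Rightarrow> complex" where
  "radon_map X Y f =
     (\<lambda>h\<in>topspace (radon X). \<lambda>v\<in>carrier (cfun Y). h (compose (topspace X) v f))"

definition radon_eta :: "'x topology \<Rightarrow> 'x \<Rightarrow> ('x \<Rightarrow> complex) \<Rightarrow> complex" where
  "radon_eta X = (\<lambda>x\<in>topspace X. \<lambda>v\<in>carrier (cfun X). v x)"

definition radon_mu ::
    "'x topology \<Rightarrow> (((('x \<Rightarrow> complex) \<Rightarrow> complex) \<Rightarrow> complex) \<Rightarrow> complex) \<Rightarrow>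
     ('x \<Rightarrow> complex) \<Rightarrow> complex" where
  "radon_mu X =
     (\<lambda>g\<in>topspace (radon (radon X)). \<lambda>v\<in>carrier (cfun X). g (\<lambda>h\<in>topspace (radon X). h v))"


section \<open>The Kleisli category\<close>

definition kl_maps :: "'x topology \<Rightarrow> 'y topology \<Rightarrow> ('x \<Rightarrow> ('y \<Rightarrow> complex) \<Rightarrow> complex) set" where
  "kl_maps X Y = ch_maps X (radon Y)"

definition kl_comp ::
    "'x topology \<Rightarrow> 'y topology \<Rightarrow> 'z topology \<Rightarrow> ('y \<Rightarrow> ('z \<Rightarrow> complex) \<Rightarrow> complex) \<Rightarrow>
     ('x \<Rightarrow> ('y \<Rightarrow> complex) \<Rightarrow> complex) \<Rightarrow> 'x \<Rightarrow> ('z \<Rightarrow> complex) \<Rightarrow> complex" where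
  "kl_comp X Y Z g f = (\<lambda>x\<in>topspace X. radon_mu Z (radon_map Y (radon Z) g (f x)))"


section \<open>The Eilenberg-Moore category\<close>

record 'x radon_alg =
  alg_space :: "'x topology"
  act :: "(('x \<Rightarrow> complex) \<Rightarrow> complex) \<Rightarrow> 'x"

abbreviation points :: "'x radon_alg \<Rightarrow> 'x set" where
  "points P \<equiv> topspace (alg_space P)"

locale radon_algebra =
  fixes P :: "'x radon_alg"
  assumes ch_space: "ch_space (alg_space P)"
    and act_map: "act P \<in> ch_maps (radon (alg_space P)) (alg_space P)"
    and act_eta: "x \<in> points P \<Longrightarrow> act P (radon_eta (alg_space P) x) = x"
    and act_mu: "g \<in> topspace (radon (radon (alg_space P))) \<Longrightarrow>
      act P (radon_mu (alg_space P) g) = act P (radon_map (radon (alg_space P)) (alg_space P) (act P) g)"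

definition em_maps :: "'x radon_alg \<Rightarrow> 'y radon_alg \<Rightarrow> ('x \<Rightarrow> 'y) set" where
  "em_maps P Q = {f \<in> ch_maps (alg_space P) (alg_space Q).
     \<forall>h\<in>topspace (radon (alg_space P)). f (act P h) = act Q (radon_map (alg_space P) (alg_space Q) f h)}"

definition em_iso :: "'x radon_alg \<Rightarrow> 'y radon_alg \<Rightarrow> ('x \<Rightarrow> 'y) \<Rightarrow> bool" where
  "em_iso P Q f \<longleftrightarrow> f \<in> em_maps P Q \<and>
     (\<exists>g\<in>em_maps Q P. compose (points P) g f = (\<lambda>x\<in>points P. x) \<and>
                     compose (points Q) f g = (\<lambda>y\<in>points Q. y))"

text \<open>
  A real-valued function as an element of \<open>C(X)\<close>. Conversely, the value of a state on such
  a function is a complex number that happens to be real, and is converted back by \<open>Re\<close>.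
\<close>

definition cplx :: "'x set \<Rightarrow> ('x \<Rightarrow> real) \<Rightarrow> 'x \<Rightarrow> complex" where
  "cplx S p = (\<lambda>x\<in>S. complex_of_real (p x))"

definition unit_alg :: "real radon_alg" where
  "unit_alg = \<lparr>alg_space = top_of_set {0..1},
     act = (\<lambda>h\<in>topspace (radon (top_of_set {0..1})). Re (h (cplx {0..1} (\<lambda>t. t))))\<rparr>"


section \<open>Effect modules\<close>

text \<open>The partial sum \<open>eplus M x y\<close> is \<open>None\<close> where it is undefined.\<close>

record 'm effect_mod = "'m partial_object" +
  ezero :: 'm
  eplus :: "'m \<Rightarrow> 'm \<Rightarrow> 'm option"
  eorth :: "'m \<Rightarrow> 'm"
  escale :: "real \<Rightarrow> 'm \<Rightarrow> 'm"

definition eone :: "('m, 'b) effect_mod_scheme \<Rightarrow> 'm" where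
  "eone M = eorth M (ezero M)"

locale effect_algebra =
  fixes M :: "'m effect_mod"
  assumes ezero_closed: "ezero M \<in> carrier M"
    and eplus_closed:
      "\<lbrakk>x \<in> carrier M; y \<in> carrier M; eplus M x y = Some z\<rbrakk> \<Longrightarrow> z \<in> carrier M"
    and eorth_closed: "x \<in> carrier M \<Longrightarrow> eorth M x \<in> carrier M"
    and eplus_comm: "\<lbrakk>x \<in> carrier M; y \<in> carrier M\<rbrakk> \<Longrightarrow> eplus M x y = eplus M y x"
    and eplus_assoc: "\<lbrakk>x \<in> carrier M; y \<in> carrier M; z \<in> carrier M\<rbrakk> \<Longrightarrow>
      Option.bind (eplus M x y) (\<lambda>s. eplus M s z) = Option.bind (eplus M y z) (\<lambda>t. eplus M x t)"
    and eplus_zero: "x \<in> carrier M \<Longrightarrow> eplus M (ezero M) x = Some x"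
    and eorth_iff:
      "\<lbrakk>x \<in> carrier M; y \<in> carrier M\<rbrakk> \<Longrightarrow> eplus M x y = Some (eone M) \<longleftrightarrow> y = eorth M x"
    and eplus_one: "\<lbrakk>x \<in> carrier M; eplus M x (eone M) \<noteq> None\<rbrakk> \<Longrightarrow> x = ezero M"

locale effect_module = effect_algebra +
  assumes escale_closed: "\<lbrakk>r \<in> {0..1}; x \<in> carrier M\<rbrakk> \<Longrightarrow> escale M r x \<in> carrier M"
    and escale_zero_right: "r \<in> {0..1} \<Longrightarrow> escale M r (ezero M) = ezero M"
    and escale_plus_right:
      "\<lbrakk>r \<in> {0..1}; x \<in> carrier M; y \<in> carrier M; eplus M x y = Some z\<rbrakk> \<Longrightarrow>
       eplus M (escale M r x) (escale M r y) = Some (escale M r z)"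
    and escale_zero_left: "x \<in> carrier M \<Longrightarrow> escale M 0 x = ezero M"
    and escale_plus_left:
      "\<lbrakk>r \<in> {0..1}; s \<in> {0..1}; r + s \<le> 1; x \<in> carrier M\<rbrakk> \<Longrightarrow>
       eplus M (escale M r x) (escale M s x) = Some (escale M (r + s) x)"
    and escale_one: "x \<in> carrier M \<Longrightarrow> escale M 1 x = x"
    and escale_mult:
      "\<lbrakk>r \<in> {0..1}; s \<in> {0..1}; x \<in> carrier M\<rbrakk> \<Longrightarrow>
       escale M (r * s) x = escale M r (escale M s x)"

definition emod_maps :: "'m effect_mod \<Rightarrow> 'n effect_mod \<Rightarrow> ('m \<Rightarrow> 'n) set" where
  "emod_maps M N = {f \<in> carrier M \<rightarrow>\<^sub>E carrier N.
     f (eone M) = eone N \<and>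
     (\<forall>x\<in>carrier M. \<forall>y\<in>carrier M. \<forall>z. eplus M x y = Some z \<longrightarrow> eplus N (f x) (f y) = Some (f z)) \<and>
     (\<forall>r\<in>{0..1}. \<forall>x\<in>carrier M. f (escale M r x) = escale N r (f x))}"

definition emod_iso :: "'m effect_mod \<Rightarrow> 'n effect_mod \<Rightarrow> ('m \<Rightarrow> 'n) \<Rightarrow> bool" where
  "emod_iso M N f \<longleftrightarrow> f \<in> emod_maps M N \<and>
     (\<exists>g\<in>emod_maps N M. compose (carrier M) g f = (\<lambda>x\<in>carrier M. x) \<and>
                       compose (carrier N) f g = (\<lambda>y\<in>carrier N. y))"

definition unit_emod :: "real effect_mod" where
  "unit_emod = \<lparr>carrier = {0..1}, ezero = 0,
     eplus = (\<lambda>r s. if r + s \<le> 1 then Some (r + s) else None),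
     eorth = (\<lambda>r. 1 - r), escale = (*)\<rparr>"

text \<open>A set \<open>H\<close> of functions \<open>S \<rightarrow> [0,1]\<close> with the pointwise operations.\<close>

definition pointwise_emod :: "'x set \<Rightarrow> ('x \<Rightarrow> real) set \<Rightarrow> ('x \<Rightarrow> real) effect_mod" where
  "pointwise_emod S H = \<lparr>carrier = H, ezero = (\<lambda>x\<in>S. 0),
     eplus = (\<lambda>p q. if \<forall>x\<in>S. p x + q x \<le> 1 then Some (\<lambda>x\<in>S. p x + q x) else None),
     eorth = (\<lambda>p. \<lambda>x\<in>S. 1 - p x),
     escale = (\<lambda>r p. \<lambda>x\<in>S. r * p x)\<rparr>"


section \<open>The functors\<close>

text \<open>The functor \<open>EMod(-,[0,1])\<close> from effect modules (contravariantly) to Radon algebras.\<close>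

definition emod_dual :: "'m effect_mod \<Rightarrow> ('m \<Rightarrow> real) radon_alg" where
  "emod_dual M = (let H = emod_maps M unit_emod;
       T = subtopology (product_topology (\<lambda>_. top_of_set {0..1}) (carrier M)) H
     in \<lparr>alg_space = T,
         act = (\<lambda>h\<in>topspace (radon T). \<lambda>x\<in>carrier M. Re (h (cplx H (\<lambda>v. v x))))\<rparr>)"

definition emod_dual_map ::
    "'m effect_mod \<Rightarrow> 'n effect_mod \<Rightarrow> ('m \<Rightarrow> 'n) \<Rightarrow> ('n \<Rightarrow> real) \<Rightarrow> 'm \<Rightarrow> real" where
  "emod_dual_map M N f = (\<lambda>v\<in>points (emod_dual N). compose (carrier M) v f)"

text \<open>The functor \<open>\<A>(-,[0,1])\<close> from Radon algebras (contravariantly) to effect modules.\<close>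

definition alg_dual :: "'x radon_alg \<Rightarrow> ('x \<Rightarrow> real) effect_mod" where
  "alg_dual P = pointwise_emod (points P) (em_maps P unit_alg)"

definition alg_dual_map ::
    "'x radon_alg \<Rightarrow> 'y radon_alg \<Rightarrow> ('x \<Rightarrow> 'y) \<Rightarrow> ('y \<Rightarrow> real) \<Rightarrow> 'x \<Rightarrow> real" where
  "alg_dual_map P Q f = (\<lambda>q\<in>carrier (alg_dual Q). compose (points P) q f)"

text \<open>The functor \<open>Cont(-,[0,1])\<close> on the Kleisli category.\<close>

definition cont_pred :: "'x topology \<Rightarrow> ('x \<Rightarrow> real) effect_mod" where
  "cont_pred X = pointwise_emod (topspace X) (ch_maps X (top_of_set {0..1}))"

definition cont_pred_map ::
    "'x topology \<Rightarrow> 'y topology \<Rightarrow> ('x \<Rightarrow> ('y \<Rightarrow> complex) \<Rightarrow> complex) \<Rightarrow>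
     ('y \<Rightarrow> real) \<Rightarrow> 'x \<Rightarrow> real" where
  "cont_pred_map X Y f =
     (\<lambda>p\<in>carrier (cont_pred Y). \<lambda>x\<in>topspace X. Re (f x (cplx (topspace Y) p)))"

text \<open>The comparison functor \<open>K\<close>.\<close>

definition comparison :: "'x topology \<Rightarrow> (('x \<Rightarrow> complex) \<Rightarrow> complex) radon_alg" where
  "comparison X = \<lparr>alg_space = radon X, act = radon_mu X\<rparr>"

definition comparison_map ::
    "'x topology \<Rightarrow> 'y topology \<Rightarrow> ('x \<Rightarrow> ('y \<Rightarrow> complex) \<Rightarrow> complex) \<Rightarrow>
     (('x \<Rightarrow> complex) \<Rightarrow> complex) \<Rightarrow> ('y \<Rightarrow> complex) \<Rightarrow> complex" where
  "comparison_map X Y f =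
     compose (topspace (radon X)) (radon_mu Y) (radon_map X (radon Y) f)"

text \<open>The functor \<open>[0,1]\<^bsub>(-)\<^esub>\<close> of effects of a C*-algebra.\<close>

definition effects :: "'a cstar \<Rightarrow> 'a effect_mod" where
  "effects A = \<lparr>carrier = {a \<in> carrier A. cle A \<zero>\<^bsub>A\<^esub> a \<and> cle A a \<one>\<^bsub>A\<^esub>},
     ezero = \<zero>\<^bsub>A\<^esub>,
     eplus = (\<lambda>x y. if cle A (x \<oplus>\<^bsub>A\<^esub> y) \<one>\<^bsub>A\<^esub> then Some (x \<oplus>\<^bsub>A\<^esub> y) else None),
     eorth = (\<lambda>x. \<one>\<^bsub>A\<^esub> \<ominus>\<^bsub>A\<^esub> x),
     escale = (\<lambda>r x. complex_of_real r \<odot>\<^bsub>A\<^esub> x)\<rparr>"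

definition effects_map :: "'a cstar \<Rightarrow> ('a \<Rightarrow> 'b) \<Rightarrow> 'a \<Rightarrow> 'b" where
  "effects_map A f = restrict f (carrier (effects A))"

text \<open>The functor \<open>Stat\<close>; the algebra structure sends a measure on states to its barycentre.\<close>

definition stat_alg :: "'a cstar \<Rightarrow> ('a \<Rightarrow> complex) radon_alg" where
  "stat_alg A = \<lparr>alg_space = stat A,
     act = (\<lambda>\<omega>\<in>topspace (radon (stat A)). \<lambda>a\<in>carrier A. \<omega> (\<lambda>\<phi>\<in>topspace (stat A). \<phi> a))\<rparr>"

definition stat_map ::
    "'a cstar \<Rightarrow> 'b cstar \<Rightarrow> ('a \<Rightarrow> 'b) \<Rightarrow> ('b \<Rightarrow> complex) \<Rightarrow> 'a \<Rightarrow> complex" where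
  "stat_map A B f = (\<lambda>\<phi>\<in>topspace (stat B). compose (carrier A) \<phi> f)"


section \<open>The adjunction and the natural isomorphisms\<close>

text \<open>
  A family of morphisms indexed by the objects of all types cannot be bound by a quantifier in
  HOL, so the components are given as polymorphic constants.
\<close>

definition transpose_map ::
    "'x radon_alg \<Rightarrow> 'm effect_mod \<Rightarrow> ('x \<Rightarrow> 'm \<Rightarrow> real) \<Rightarrow> 'm \<Rightarrow> 'x \<Rightarrow> real" where
  "transpose_map P M f = (\<lambda>m\<in>carrier M. \<lambda>x\<in>points P. f x m)"

definition kl_state_iso ::
    "'x topology \<Rightarrow> (('x \<Rightarrow> complex) \<Rightarrow> complex) \<Rightarrow> ('x \<Rightarrow> real) \<Rightarrow> real" where
  "kl_state_iso X =
     (\<lambda>h\<in>topspace (radon X). \<lambda>p\<in>carrier (cont_pred X). Re (h (cplx (topspace X) p)))"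

definition kl_pred_iso ::
    "'x topology \<Rightarrow> ('x \<Rightarrow> real) \<Rightarrow> (('x \<Rightarrow> complex) \<Rightarrow> complex) \<Rightarrow> real" where
  "kl_pred_iso X =
     (\<lambda>p\<in>carrier (cont_pred X). \<lambda>h\<in>topspace (radon X). Re (h (cplx (topspace X) p)))"

definition cstar_state_iso :: "'a cstar \<Rightarrow> ('a \<Rightarrow> complex) \<Rightarrow> 'a \<Rightarrow> real" where
  "cstar_state_iso A = (\<lambda>\<phi>\<in>topspace (stat A). \<lambda>a\<in>carrier (effects A). Re (\<phi> a))"

definition cstar_pred_iso :: "'a cstar \<Rightarrow> 'a \<Rightarrow> ('a \<Rightarrow> complex) \<Rightarrow> real" where
  "cstar_pred_iso A = (\<lambda>a\<in>carrier (effects A). \<lambda>\<phi>\<in>topspace (stat A). Re (\<phi> a))"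

end

theory Submission
  imports Defs
begin

text \<open>
  Positivity in a C*-algebra is obtained without spectral theory. Square roots of \<open>a\<close> with
  \<open>\<parallel>1 - a\<parallel> \<le> 1\<close> come from an iteration, and the elements \<open>a\<close> with \<open>\<parallel>t - a\<parallel> \<le> t\<close> for some \<open>t\<close> form a closed
  proper cone that turns out to be the cone of all \<open>y\<^sup>* y\<close>. Hahn-Banach then shows that states determine
  the order and the norm of self-adjoint elements, so that states are the same as effect module maps
  \<open>[0,1]\<^sub>A \<rightarrow> [0,1]\<close>. An algebra map \<open>f : Stat(A) \<rightarrow> [0,1]\<close> takes equal values on two measures with the same
  barycentre. A second application of Hahn-Banach therefore approximates \<open>f\<close> uniformly by elements of \<open>A\<close>,
  and completeness makes \<open>f\<close> itself an effect. The Kleisli triangle is the C*-triangle at \<open>C(X)\<close>: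
  a Kleisli map \<open>X \<rightarrow> \<R>(Y)\<close> is a PU-map \<open>C(Y) \<rightarrow> C(X)\<close>, and \<open>K(X) = Stat(C(X))\<close>.
\<close>


section \<open>Square roots and the positive cone of a C*-algebra\<close>

text \<open>The delicate point about the cone is that it contains every \<open>y^* y\<close>. The
  usual argument compares the spectra of \<open>y^* y\<close> and \<open>y y^*\<close>; here a
  relation \<open>z a = b z\<close> is passed on to the square roots of \<open>a\<close> and
  \<open>b\<close>. Measures are avoided as well: a point of \<open>\<R>(X)\<close> is handled only
  as a functional, and an algebra map \<open>p\<close> into \<open>[0,1]\<close> is affine in the
  sense that \<open>p (act P h)\<close> is the mean of \<open>p\<close> under \<open>h\<close>. The
  approximation step must therefore produce two functionals with equal barycentres that disagree on
  \<open>f\<close>, which is why the space \<open>C(X) \<times> C(X)\<close> appears. Completeness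
  can be used afterwards because states control the norm of a self-adjoint element, so that uniform
  closeness on states is closeness in \<open>A\<close>. In both triangles the predicate isomorphism
  is the transpose of the state isomorphism, hence a morphism without further computation. What
  remains is bijectivity and, since sums are partial, that the map reflects which sums are
  defined.\<close>

lemma complex_cstar_simps [simp]:
  "carrier complex_cstar = UNIV"
  "x \<oplus>\<^bsub>complex_cstar\<^esub> y = x + y" "x \<otimes>\<^bsub>complex_cstar\<^esub> y = x * y"
  "\<zero>\<^bsub>complex_cstar\<^esub> = 0" "\<one>\<^bsub>complex_cstar\<^esub> = 1"
  "c \<odot>\<^bsub>complex_cstar\<^esub> x = c * x" "star complex_cstar = cnj" "cnorm complex_cstar = cmod"
  by (simp_all add: complex_cstar_def)

context cstar_algebra
begin

section \<open>Linear arithmetic with complex scalars\<close>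

lemma smult_add: "x \<in> carrier A \<Longrightarrow> (c + d) \<odot> x = c \<odot> x \<oplus> d \<odot> x"
  using smult_l_distr by simp

lemma smult_smult [simp]: "x \<in> carrier A \<Longrightarrow> c \<odot> (d \<odot> x) = (c * d) \<odot> x"
  using smult_assoc1 by simp

lemma smult_1 [simp]: "x \<in> carrier A \<Longrightarrow> 1 \<odot> x = x"
  using smult_one by simp

lemma smult_0 [simp]: "x \<in> carrier A \<Longrightarrow> 0 \<odot> x = \<zero>"
  using smult_l_null by simp

lemma smult_zero [simp]: "c \<odot> \<zero> = \<zero>"
  using smult_r_null by simp

lemma neg_eq_smult: "x \<in> carrier A \<Longrightarrow> \<ominus> x = (-1) \<odot> x"
  by (metis (no_types, lifting) ab_left_minus add.right_neutral l_neg minus_equality smult_0 smult_1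
      smult_add smult_closed UNIV_I complex_cstar_simps(1))

lemma minus_eq_smult: "x \<in> carrier A \<Longrightarrow> y \<in> carrier A \<Longrightarrow> x \<ominus> y = x \<oplus> (-1) \<odot> y"
  by (simp add: minus_eq neg_eq_smult)

lemmas smult_dist = smult_r_distr[simplified]

text \<open>Additive AC rewriting can leave multiples of one element separated by other summands.
  The \<open>collect\<close> rules merge them across up to two intervening terms; the primed
  versions allow for a remaining tail.\<close>

lemma collect_adjacent:
  assumes "x \<in> carrier A"
  shows "c \<odot> x \<oplus> d \<odot> x = (c + d) \<odot> x" "x \<oplus> d \<odot> x = (1 + d) \<odot> x" "x \<oplus> x = 2 \<odot> x"
  using smult_add[of x c d] smult_add[of x 1 d] smult_add[of x 1 1] assms by simp_all

lemma collect_adjacent':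
  assumes "x \<in> carrier A" "y \<in> carrier A"
  shows "c \<odot> x \<oplus> (d \<odot> x \<oplus> y) = (c + d) \<odot> x \<oplus> y" "x \<oplus> (d \<odot> x \<oplus> y) = (1 + d) \<odot> x \<oplus> y"
    "x \<oplus> (x \<oplus> y) = 2 \<odot> x \<oplus> y"
  using assms by (simp_all add: a_assoc[symmetric] collect_adjacent)

lemma collect_1:
  assumes "x \<in> carrier A" "y \<in> carrier A"
  shows "c \<odot> x \<oplus> (y \<oplus> d \<odot> x) = (c + d) \<odot> x \<oplus> y" "x \<oplus> (y \<oplus> d \<odot> x) = (1 + d) \<odot> x \<oplus> y"
  using assms collect_adjacent'[of x y] by (simp_all add: a_comm)

lemma collect_1':
  assumes "x \<in> carrier A" "y \<in> carrier A" "z \<in> carrier A"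
  shows "c \<odot> x \<oplus> (y \<oplus> (d \<odot> x \<oplus> z)) = (c + d) \<odot> x \<oplus> (y \<oplus> z)"
    "x \<oplus> (y \<oplus> (d \<odot> x \<oplus> z)) = (1 + d) \<odot> x \<oplus> (y \<oplus> z)"
  using assms collect_1[of x y] by (simp_all add: a_assoc[symmetric])

lemma collect_2:
  assumes "x \<in> carrier A" "y \<in> carrier A" "z \<in> carrier A"
  shows "c \<odot> x \<oplus> (y \<oplus> (z \<oplus> d \<odot> x)) = (c + d) \<odot> x \<oplus> (y \<oplus> z)"
    "x \<oplus> (y \<oplus> (z \<oplus> d \<odot> x)) = (1 + d) \<odot> x \<oplus> (y \<oplus> z)"
  using assms collect_1[of x "y \<oplus> z"] by (simp_all add: a_assoc)

lemma collect_2':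
  assumes "x \<in> carrier A" "y \<in> carrier A" "z \<in> carrier A" "w \<in> carrier A"
  shows "c \<odot> x \<oplus> (y \<oplus> (z \<oplus> (d \<odot> x \<oplus> w))) = (c + d) \<odot> x \<oplus> (y \<oplus> (z \<oplus> w))"
    "x \<oplus> (y \<oplus> (z \<oplus> (d \<odot> x \<oplus> w))) = (1 + d) \<odot> x \<oplus> (y \<oplus> (z \<oplus> w))"
  using assms collect_1'[of x "y \<oplus> z" w] by (simp_all add: a_assoc)

lemmas collect = collect_adjacent collect_adjacent' collect_1 collect_1' collect_2 collect_2'

text \<open>Normal form for noncommutative polynomial identities: subtraction becomes scaling by -1,
  products are expanded, scalars are pulled out, the involution is pushed inwards and like terms are
  merged.\<close>

lemmas calg = neg_eq_smult minus_eq_smult smult_dist l_distr r_distr smult_mult_left smult_mult_right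
  m_assoc a_ac collect star_add star_smult star_mult star_closed star_star

section \<open>Norm and involution\<close>

lemma star_zero [simp]: "star A \<zero> = \<zero>"
  using star_smult[of "\<zero>" 0] star_closed by simp

lemma star_one [simp]: "star A \<one> = \<one>"
  by (metis l_one one_closed star_closed star_mult star_star)

lemma star_neg: "x \<in> carrier A \<Longrightarrow> star A (\<ominus> x) = \<ominus> (star A x)"
  by (simp add: neg_eq_smult star_smult star_closed)

lemma star_minus: "x \<in> carrier A \<Longrightarrow> y \<in> carrier A \<Longrightarrow> star A (x \<ominus> y) = star A x \<ominus> star A y"
  by (simp add: minus_eq star_add star_neg star_closed)

declare star_closed [simp] star_star [simp] star_one [simp] cnorm_nonneg [simp]

lemma cnorm_zero [simp]: "cnorm A \<zero> = 0"
  using cnorm_eq_0 by simp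

lemma cnorm_neg [simp]: "x \<in> carrier A \<Longrightarrow> cnorm A (\<ominus> x) = cnorm A x"
  by (simp add: neg_eq_smult cnorm_smult)

lemma minus_self [simp]: "x \<in> carrier A \<Longrightarrow> x \<ominus> x = \<zero>"
  by (simp add: minus_eq r_neg)

lemma minus_zero_imp_eq: "x \<in> carrier A \<Longrightarrow> y \<in> carrier A \<Longrightarrow> x \<ominus> y = \<zero> \<Longrightarrow> x = y"
  by (simp add: minus_eq minus_equality minus_minus a_comm) (metis a_inv_closed minus_equality minus_minus)

lemma minus_minus_cancel [simp]: "x \<in> carrier A \<Longrightarrow> y \<in> carrier A \<Longrightarrow> y \<ominus> (y \<ominus> x) = x"
  by algebra

lemma cnorm_minus: "x \<in> carrier A \<Longrightarrow> y \<in> carrier A \<Longrightarrow> cnorm A (x \<ominus> y) \<le> cnorm A x + cnorm A y"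
  using cnorm_add[of x "\<ominus> y"] by (simp add: minus_eq)

lemma cnorm_minus_commute:
  "x \<in> carrier A \<Longrightarrow> y \<in> carrier A \<Longrightarrow> cnorm A (x \<ominus> y) = cnorm A (y \<ominus> x)"
  using cnorm_neg[of "x \<ominus> y"] by (simp add: calg)

lemma cnorm_triangle:
  assumes "x \<in> carrier A" "y \<in> carrier A" "z \<in> carrier A"
  shows "cnorm A (x \<ominus> z) \<le> cnorm A (x \<ominus> y) + cnorm A (y \<ominus> z)"
proof -
  have "x \<ominus> z = (x \<ominus> y) \<oplus> (y \<ominus> z)" using assms by algebra
  then show ?thesis using cnorm_add assms by simp
qed

text \<open>Submultiplicativity in the C*-identity bounds the square of \<open>cnorm A x\<close>,
  and one factor \<open>cnorm A x\<close> cancels. The converse inequality is this one at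
  \<open>star A x\<close>.\<close>

lemma cnorm_star_le: "x \<in> carrier A \<Longrightarrow> cnorm A x \<le> cnorm A (star A x)"
proof -
  assume x: "x \<in> carrier A"
  have "(cnorm A x)\<^sup>2 \<le> cnorm A (star A x) * cnorm A x"
    using cstar_identity[OF x] cnorm_mult[of "star A x" x] x by simp
  then show ?thesis
    using x by (cases "cnorm A x = 0") (simp_all add: power2_eq_square mult_le_cancel_right order_less_le)
qed

lemma cnorm_star [simp]: "x \<in> carrier A \<Longrightarrow> cnorm A (star A x) = cnorm A x"
  by (metis cnorm_star_le order_antisym star_closed star_star)

lemma cnorm_one_le: "cnorm A \<one> \<le> 1"
  using cstar_identity[of \<one>] by (auto simp: power2_eq_square)

lemma cnorm_sa_sq: "x \<in> carrier A \<Longrightarrow> star A x = x \<Longrightarrow> cnorm A (x \<otimes> x) = (cnorm A x)\<^sup>2"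
  using cstar_identity[of x] by simp

lemma smult_eq_0: "x \<in> carrier A \<Longrightarrow> c \<odot> x = \<zero> \<Longrightarrow> c = 0 \<or> x = \<zero>"
  using cnorm_smult[of x c] cnorm_eq_0[of x] by auto

lemma cnorm_mono_mult: "x \<in> carrier A \<Longrightarrow> y \<in> carrier A \<Longrightarrow> cnorm A x \<le> r \<Longrightarrow> cnorm A y \<le> s \<Longrightarrow>
   cnorm A (x \<otimes> y) \<le> r * s"
  by (meson cnorm_mult cnorm_nonneg mult_mono order_trans)


subsection \<open>Square roots\<close>

text \<open>Membership in the carrier is part of convergence, which spares later lemmas all side
  conditions on the sequence and its limit.\<close>

definition conv :: "(nat \<Rightarrow> 'a) \<Rightarrow> 'a \<Rightarrow> bool" where
  "conv s l \<longleftrightarrow> (\<forall>n. s n \<in> carrier A) \<and> l \<in> carrier A \<and> (\<lambda>n. cnorm A (s n \<ominus> l)) \<longlonglongrightarrow> 0"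

lemma conv_unique:
  assumes "conv s l" "conv s m" shows "l = m"
proof -
  have c: "l \<in> carrier A" "m \<in> carrier A" "\<And>n. s n \<in> carrier A" using assms by (auto simp: conv_def)
  have lim: "(\<lambda>n. cnorm A (s n \<ominus> l) + cnorm A (s n \<ominus> m)) \<longlonglongrightarrow> 0 + 0"
    using assms unfolding conv_def by (intro tendsto_add) auto
  have *: "cnorm A (l \<ominus> m) \<le> cnorm A (s n \<ominus> l) + cnorm A (s n \<ominus> m)" for n
    using cnorm_triangle[of l "s n" m] c cnorm_minus_commute[of l "s n"] by simp
  from lim have "cnorm A (l \<ominus> m) \<le> 0 + 0"
    by (rule LIMSEQ_le_const) (use * in auto)
  then have "l \<ominus> m = \<zero>" using cnorm_eq_0[of "l \<ominus> m"] cnorm_nonneg[of "l \<ominus> m"] c by (simp add: order_antisym)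
  then show ?thesis using c minus_zero_imp_eq by simp
qed

lemma convI_bound:
  assumes "\<And>n. s n \<in> carrier A" "l \<in> carrier A" "\<And>n. cnorm A (s n \<ominus> l) \<le> r n" "r \<longlonglongrightarrow> 0"
  shows "conv s l"
  unfolding conv_def using assms
  by (auto intro!: tendsto_sandwich[OF _ _ tendsto_const assms(4)])

lemma conv_mult_left:
  assumes "conv s l" "z \<in> carrier A" shows "conv (\<lambda>n. z \<otimes> s n) (z \<otimes> l)"
proof (rule convI_bound)
  show "cnorm A (z \<otimes> s n \<ominus> z \<otimes> l) \<le> cnorm A z * cnorm A (s n \<ominus> l)" for n
    using assms cnorm_mult[of z "s n \<ominus> l"] by (simp add: conv_def r_distr r_minus minus_eq)
  show "(\<lambda>n. cnorm A z * cnorm A (s n \<ominus> l)) \<longlonglongrightarrow> 0"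
    using assms unfolding conv_def by (auto intro: tendsto_mult_right_zero)
qed (use assms conv_def in auto)

lemma conv_mult_right:
  assumes "conv s l" "z \<in> carrier A" shows "conv (\<lambda>n. s n \<otimes> z) (l \<otimes> z)"
proof (rule convI_bound)
  show "cnorm A (s n \<otimes> z \<ominus> l \<otimes> z) \<le> cnorm A (s n \<ominus> l) * cnorm A z" for n
    using assms cnorm_mult[of "s n \<ominus> l" z] by (simp add: conv_def l_distr l_minus minus_eq)
  show "(\<lambda>n. cnorm A (s n \<ominus> l) * cnorm A z) \<longlonglongrightarrow> 0"
    using assms unfolding conv_def by (auto intro: tendsto_mult_left_zero)
qed (use assms conv_def in auto)

lemma conv_star:
  assumes "conv s l" shows "conv (\<lambda>n. star A (s n)) (star A l)"
proof (rule convI_bound)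
  show "cnorm A (star A (s n) \<ominus> star A l) \<le> cnorm A (s n \<ominus> l)" for n
    using assms cnorm_star[of "s n \<ominus> l"] by (simp add: conv_def star_minus)
qed (use assms conv_def in auto)

lemma conv_bound:
  assumes "conv s l" "\<And>n. cnorm A (s n) \<le> b" shows "cnorm A l \<le> b"
proof -
  have c: "l \<in> carrier A" "\<And>n. s n \<in> carrier A" using assms by (auto simp: conv_def)
  have *: "cnorm A l \<le> cnorm A (s n \<ominus> l) + b" for n
  proof -
    have "l = s n \<ominus> (s n \<ominus> l)" using c(1) c(2)[of n] by (simp add: calg)
    then have "cnorm A l \<le> cnorm A (s n) + cnorm A (s n \<ominus> l)"
      by (metis c cnorm_minus minus_closed)
    then show ?thesis using assms(2)[of n] by simp
  qed
  have "(\<lambda>n. cnorm A (s n \<ominus> l) + b) \<longlonglongrightarrow> 0 + b"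
    using assms(1) by (intro tendsto_add) (auto simp: conv_def)
  then have "cnorm A l \<le> 0 + b" by (rule LIMSEQ_le_const) (use * in auto)
  then show ?thesis by simp
qed

text \<open>The iteration \<open>y \<mapsto> (x + y\<^sup>2)/2\<close> started at \<open>0\<close> converges to \<open>1 - sqrt (1 - x)\<close>. Increments are
  dominated by those of the same iteration in the reals at \<open>x = 1\<close>, which increases to \<open>1\<close>.\<close>

primrec sqrt_iter :: "'a \<Rightarrow> nat \<Rightarrow> 'a" where
  "sqrt_iter x 0 = \<zero>"
| "sqrt_iter x (Suc n) = (1/2) \<odot> (x \<oplus> sqrt_iter x n \<otimes> sqrt_iter x n)"

end

primrec real_iter :: "nat \<Rightarrow> real" where
  "real_iter 0 = 0"
| "real_iter (Suc n) = (1 + (real_iter n)\<^sup>2) / 2"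

lemma real_iter_range: "0 \<le> real_iter n \<and> real_iter n \<le> 1"
  by (induction n) (auto simp: power_le_one)

text \<open>The increment is half the square of \<open>1 - real_iter n\<close>.\<close>

lemma real_iter_mono: "real_iter n \<le> real_iter (Suc n)"
proof -
  have "0 \<le> (1 - real_iter n)\<^sup>2" by simp
  then show ?thesis by (simp add: power2_eq_square algebra_simps)
qed

lemma Cauchy_real_iter: "Cauchy real_iter"
  using real_iter_range real_iter_mono
  by (intro convergent_Cauchy Bseq_mono_convergent BseqI'[of _ 1])
     (auto intro: lift_Suc_mono_le)

context cstar_algebra
begin

lemma sqrt_iter_closed [simp]: "x \<in> carrier A \<Longrightarrow> sqrt_iter x n \<in> carrier A"
  by (induction n) auto

lemma sqrt_iter_bound:
  assumes "x \<in> carrier A" "cnorm A x \<le> 1"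
  shows "cnorm A (sqrt_iter x n) \<le> real_iter n"
proof (induction n)
  case (Suc n)
  have "cnorm A (sqrt_iter x (Suc n)) \<le> (cnorm A x + cnorm A (sqrt_iter x n \<otimes> sqrt_iter x n)) / 2"
    using assms cnorm_add[of x "sqrt_iter x n \<otimes> sqrt_iter x n"] by (simp add: cnorm_smult)
  also have "\<dots> \<le> (1 + real_iter n * real_iter n) / 2"
    using Suc assms cnorm_mono_mult[OF _ _ Suc Suc] by simp
  finally show ?case by (simp add: power2_eq_square)
qed simp

text \<open>Without commutativity the difference of squares is split as
  \<open>(x - y) x + y (x - y)\<close>.\<close>

lemma sq_diff_bound:
  assumes "x \<in> carrier A" "y \<in> carrier A"
  shows "cnorm A (x \<otimes> x \<ominus> y \<otimes> y) \<le> cnorm A (x \<ominus> y) * (cnorm A x + cnorm A y)"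
proof -
  have "x \<otimes> x \<ominus> y \<otimes> y = (x \<ominus> y) \<otimes> x \<oplus> y \<otimes> (x \<ominus> y)" using assms by algebra
  then have "cnorm A (x \<otimes> x \<ominus> y \<otimes> y) \<le> cnorm A ((x \<ominus> y) \<otimes> x) + cnorm A (y \<otimes> (x \<ominus> y))"
    using assms cnorm_add by simp
  also have "\<dots> \<le> cnorm A (x \<ominus> y) * cnorm A x + cnorm A y * cnorm A (x \<ominus> y)"
    using assms by (intro add_mono cnorm_mult) auto
  finally show ?thesis by (simp add: algebra_simps)
qed

lemma half_diff:
  assumes "x \<in> carrier A" "a \<in> carrier A" "b \<in> carrier A"
  shows "cnorm A ((1/2) \<odot> (x \<oplus> a) \<ominus> (1/2) \<odot> (x \<oplus> b)) = cnorm A (a \<ominus> b) / 2"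
proof -
  have "(1/2) \<odot> (x \<oplus> a) \<ominus> (1/2) \<odot> (x \<oplus> b) = (1/2) \<odot> (a \<ominus> b)" using assms by (simp add: calg)
  then show ?thesis using assms by (simp add: cnorm_smult)
qed

text \<open>An increment is half a difference of squares, so it is at most the previous increment
  times the mean of the two norms. The scalar iteration satisfies the same recursion with
  equality.\<close>

lemma sqrt_iter_step:
  assumes "x \<in> carrier A" "cnorm A x \<le> 1"
  shows "cnorm A (sqrt_iter x (Suc n) \<ominus> sqrt_iter x n) \<le> real_iter (Suc n) - real_iter n"
proof (induction n)
  case 0 then show ?case using assms by (simp add: cnorm_smult minus_eq)
next
  case (Suc n)
  let ?y = "sqrt_iter x (Suc n)" and ?w = "sqrt_iter x n"
  have "cnorm A (sqrt_iter x (Suc (Suc n)) \<ominus> ?y) = cnorm A (?y \<otimes> ?y \<ominus> ?w \<otimes> ?w) / 2"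
    using half_diff[of x "?y \<otimes> ?y" "?w \<otimes> ?w"] assms by simp
  also have "\<dots> \<le> cnorm A (?y \<ominus> ?w) * (cnorm A ?y + cnorm A ?w) / 2"
    using sq_diff_bound[of ?y ?w] assms by (simp del: sqrt_iter.simps)
  also have "\<dots> \<le> (real_iter (Suc n) - real_iter n) * (real_iter (Suc n) + real_iter n) / 2"
    using Suc sqrt_iter_bound[OF assms, of n] sqrt_iter_bound[OF assms, of "Suc n"] assms real_iter_mono[of n]
    by (intro divide_right_mono mult_mono add_mono) (simp_all del: sqrt_iter.simps real_iter.simps)
  also have "\<dots> = real_iter (Suc (Suc n)) - real_iter (Suc n)"
    by (simp add: power2_eq_square field_simps)
  finally show ?case .
qed

lemma sqrt_iter_diff:
  assumes "x \<in> carrier A" "cnorm A x \<le> 1"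
  shows "cnorm A (sqrt_iter x (n + k) \<ominus> sqrt_iter x n) \<le> real_iter (n + k) - real_iter n"
proof (induction k)
  case 0 then show ?case using assms by simp
next
  case (Suc k)
  then show ?case
    using cnorm_triangle[of "sqrt_iter x (Suc (n+k))" "sqrt_iter x (n+k)" "sqrt_iter x n"]
      sqrt_iter_step[OF assms, of "n+k"] assms by (simp del: sqrt_iter.simps real_iter.simps)
qed

lemma sqrt_iter_convergent:
  assumes "x \<in> carrier A" "cnorm A x \<le> 1"
  shows "\<exists>l. conv (sqrt_iter x) l"
proof -
  have *: "cnorm A (sqrt_iter x m \<ominus> sqrt_iter x n) \<le> \<bar>real_iter m - real_iter n\<bar>" for m n
  proof (cases "n \<le> m")
    case True
    then obtain k where "m = n + k" using le_Suc_ex by blast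
    then show ?thesis using sqrt_iter_diff[OF assms, of n k] by simp
  next
    case False
    then obtain k where "n = m + k" using le_Suc_ex nat_le_linear by blast
    then show ?thesis using sqrt_iter_diff[OF assms, of m k] cnorm_minus_commute[of "sqrt_iter x m" "sqrt_iter x n"] assms by simp
  qed
  have "\<exists>l\<in>carrier A. (\<lambda>n. cnorm A (sqrt_iter x n \<ominus> l)) \<longlonglongrightarrow> 0"
  proof (rule complete)
    fix e :: real assume "0 < e"
    then obtain N where "\<forall>m\<ge>N. \<forall>n\<ge>N. norm (real_iter m - real_iter n) < e"
      using Cauchy_real_iter CauchyD by blast
    then show "\<exists>N. \<forall>m\<ge>N. \<forall>n\<ge>N. cnorm A (sqrt_iter x m \<ominus> sqrt_iter x n) < e"
      using * by (metis order_le_less_trans real_norm_def)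
  qed (use assms in auto)
  then show ?thesis using assms by (auto simp: conv_def)
qed

text \<open>The limit \<open>l\<close> of the iteration at \<open>1 - a\<close> solves
  \<open>2 l = 1 - a + l^2\<close>, which says that \<open>(1 - l)^2 = a\<close>.\<close>

definition sqrt_el :: "'a \<Rightarrow> 'a" where
  "sqrt_el a = \<one> \<ominus> (SOME l. conv (sqrt_iter (\<one> \<ominus> a)) l)"

context
  fixes a assumes a [simp]: "a \<in> carrier A" and a1: "cnorm A (\<one> \<ominus> a) \<le> 1"
begin

lemma conv_sqrt_el: "conv (sqrt_iter (\<one> \<ominus> a)) (\<one> \<ominus> sqrt_el a)"
proof -
  obtain l where l: "conv (sqrt_iter (\<one> \<ominus> a)) l" using sqrt_iter_convergent[of "\<one> \<ominus> a"] a1 by auto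
  then have *: "conv (sqrt_iter (\<one> \<ominus> a)) (SOME l. conv (sqrt_iter (\<one> \<ominus> a)) l)" by (rule someI)
  then have "(SOME l. conv (sqrt_iter (\<one> \<ominus> a)) l) \<in> carrier A" by (simp add: conv_def)
  then have "\<one> \<ominus> sqrt_el a = (SOME l. conv (sqrt_iter (\<one> \<ominus> a)) l)" by (simp add: sqrt_el_def)
  with * show ?thesis by simp
qed

lemma sqrt_el_closed [simp]: "sqrt_el a \<in> carrier A"
proof -
  obtain l where l: "conv (sqrt_iter (\<one> \<ominus> a)) l" using sqrt_iter_convergent[of "\<one> \<ominus> a"] a1 by auto
  then have *: "conv (sqrt_iter (\<one> \<ominus> a)) (SOME l. conv (sqrt_iter (\<one> \<ominus> a)) l)" by (rule someI)
  then show ?thesis by (simp add: conv_def sqrt_el_def)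
qed

text \<open>The root satisfies the same norm condition as \<open>a\<close>. This is what later
  places a self-adjoint root in the cone, with constant 1.\<close>

lemma sqrt_el_norm: "cnorm A (\<one> \<ominus> sqrt_el a) \<le> 1"
  using conv_bound[OF conv_sqrt_el] sqrt_iter_bound[of "\<one> \<ominus> a"] a1 real_iter_range
  by (meson a minus_closed one_closed order_trans)

lemma sqrt_el_sq: "sqrt_el a \<otimes> sqrt_el a = a"
proof -
  define x where "x = \<one> \<ominus> a"
  define l where "l = \<one> \<ominus> sqrt_el a"
  have [simp]: "x \<in> carrier A" "l \<in> carrier A" by (auto simp: x_def l_def)
  have l: "conv (sqrt_iter x) l" using conv_sqrt_el by (simp add: x_def l_def)
  have l1: "cnorm A l \<le> 1" using sqrt_el_norm by (simp add: l_def)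
  have x1: "cnorm A x \<le> 1" using a1 by (simp add: x_def)
  \<comment> \<open>One iteration step does not increase distances on the unit ball, because half
    the sum of the two norms is at most 1. Hence the shifted sequence converges to the image of
    \<open>l\<close>, and \<open>l\<close> is a fixed point.\<close>
  have "conv (\<lambda>n. sqrt_iter x (Suc n)) ((1/2) \<odot> (x \<oplus> l \<otimes> l))"
  proof (rule convI_bound)
    show "cnorm A (sqrt_iter x (Suc n) \<ominus> (1/2) \<odot> (x \<oplus> l \<otimes> l)) \<le> cnorm A (sqrt_iter x n \<ominus> l)" for n
    proof -
      have "cnorm A (sqrt_iter x (Suc n) \<ominus> (1/2) \<odot> (x \<oplus> l \<otimes> l)) = cnorm A (sqrt_iter x n \<otimes> sqrt_iter x n \<ominus> l \<otimes> l) / 2"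
        by (simp add: half_diff)
      also have "\<dots> \<le> cnorm A (sqrt_iter x n \<ominus> l) * (cnorm A (sqrt_iter x n) + cnorm A l) / 2"
        using sq_diff_bound[of "sqrt_iter x n" l] by simp
      also have "\<dots> \<le> cnorm A (sqrt_iter x n \<ominus> l) * (1 + 1) / 2"
        using l1 sqrt_iter_bound[OF _ x1, of n] real_iter_range[of n]
        by (intro divide_right_mono mult_left_mono add_mono) auto
      finally show ?thesis by simp
    qed
    show "(\<lambda>n. cnorm A (sqrt_iter x n \<ominus> l)) \<longlonglongrightarrow> 0" using l by (simp add: conv_def)
  qed (simp_all del: sqrt_iter.simps)
  moreover have "conv (\<lambda>n. sqrt_iter x (Suc n)) l"
    using l LIMSEQ_Suc[of "\<lambda>n. cnorm A (sqrt_iter x n \<ominus> l)" 0] unfolding conv_def by auto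
  ultimately have "(1/2) \<odot> (x \<oplus> l \<otimes> l) = l" by (rule conv_unique)
  then have "2 \<odot> ((1/2) \<odot> (x \<oplus> l \<otimes> l)) = 2 \<odot> l" by simp
  then have eq: "x \<oplus> l \<otimes> l = 2 \<odot> l" by simp
  have "sqrt_el a = \<one> \<ominus> l" by (simp add: l_def)
  then have "sqrt_el a \<otimes> sqrt_el a = (\<one> \<ominus> x) \<oplus> ((x \<oplus> l \<otimes> l) \<ominus> 2 \<odot> l)" by (simp add: calg)
  also have "\<dots> = \<one> \<ominus> x" by (simp add: eq)
  also have "\<dots> = a" by (simp add: x_def)
  finally show ?thesis .
qed

end

text \<open>The iterates are polynomials in their starting element, so \<open>z\<close> moves
  through each of them and then through the limits. With \<open>a = b\<close> this gives
  commutation; different elements are needed to compare roots built from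
  \<open>star A z \<otimes> z\<close> and \<open>z \<otimes> star A z\<close>.\<close>

lemma sqrt_el_intertwine:
  assumes a: "a \<in> carrier A" "cnorm A (\<one> \<ominus> a) \<le> 1" and b: "b \<in> carrier A" "cnorm A (\<one> \<ominus> b) \<le> 1"
    and z: "z \<in> carrier A" "z \<otimes> a = b \<otimes> z"
  shows "z \<otimes> sqrt_el a = sqrt_el b \<otimes> z"
proof -
  note [simp] = a(1) b(1) z(1) sqrt_el_closed[OF a] sqrt_el_closed[OF b]
  have "z \<otimes> sqrt_iter (\<one> \<ominus> a) n = sqrt_iter (\<one> \<ominus> b) n \<otimes> z" for n
  proof (induction n)
    case (Suc n)
    let ?y = "sqrt_iter (\<one> \<ominus> a) n" and ?w = "sqrt_iter (\<one> \<ominus> b) n"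
    have "z \<otimes> (?y \<otimes> ?y) = (z \<otimes> ?y) \<otimes> ?y" by (simp add: m_assoc)
    also have "\<dots> = ?w \<otimes> (z \<otimes> ?y)" by (simp add: m_assoc Suc)
    finally have "z \<otimes> (?y \<otimes> ?y) = ?w \<otimes> ?w \<otimes> z" by (simp add: Suc m_assoc)
    then show ?case using z by (simp add: calg)
  qed simp
  moreover have "conv (\<lambda>n. z \<otimes> sqrt_iter (\<one> \<ominus> a) n) (z \<otimes> (\<one> \<ominus> sqrt_el a))"
    by (intro conv_mult_left conv_sqrt_el a) simp
  moreover have "conv (\<lambda>n. sqrt_iter (\<one> \<ominus> b) n \<otimes> z) ((\<one> \<ominus> sqrt_el b) \<otimes> z)"
    by (intro conv_mult_right conv_sqrt_el b) simp
  ultimately have eq: "z \<otimes> (\<one> \<ominus> sqrt_el a) = (\<one> \<ominus> sqrt_el b) \<otimes> z" using conv_unique by simp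
  have "z \<otimes> sqrt_el a = z \<ominus> z \<otimes> (\<one> \<ominus> sqrt_el a)"
    by (simp add: minus_eq r_distr r_minus) (simp add: minus_eq[symmetric])
  also have "\<dots> = z \<ominus> (\<one> \<ominus> sqrt_el b) \<otimes> z" by (simp add: eq)
  also have "\<dots> = sqrt_el b \<otimes> z"
    by (simp add: minus_eq l_distr l_minus) (simp add: minus_eq[symmetric])
  finally show ?thesis .
qed

text \<open>All iterates are self-adjoint and the involution is isometric, so the limit equals its
  own adjoint.\<close>

lemma sqrt_el_sa:
  assumes a: "a \<in> carrier A" "cnorm A (\<one> \<ominus> a) \<le> 1" and sa: "star A a = a"
  shows "star A (sqrt_el a) = sqrt_el a"
proof -
  note [simp] = a(1) sa sqrt_el_closed[OF a]
  have "star A (sqrt_iter (\<one> \<ominus> a) n) = sqrt_iter (\<one> \<ominus> a) n" for n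
    by (induction n) (simp_all add: star_smult star_add star_minus star_mult)
  then have "conv (sqrt_iter (\<one> \<ominus> a)) (star A (\<one> \<ominus> sqrt_el a))"
    using conv_star[OF conv_sqrt_el[OF a]] by simp
  then have "star A (\<one> \<ominus> sqrt_el a) = \<one> \<ominus> sqrt_el a" using conv_sqrt_el[OF a] by (rule conv_unique)
  then have "\<one> \<ominus> (\<one> \<ominus> star A (sqrt_el a)) = \<one> \<ominus> (\<one> \<ominus> sqrt_el a)" by (simp add: star_minus)
  then show ?thesis by simp
qed


subsection \<open>The positive cone\<close>

definition sa :: "'a set" where
  "sa = {a \<in> carrier A. star A a = a}"

lemma saI: "a \<in> carrier A \<Longrightarrow> star A a = a \<Longrightarrow> a \<in> sa"
  by (simp add: sa_def)

lemma sa_zero [simp]: "\<zero> \<in> sa" and sa_one [simp]: "\<one> \<in> sa"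
  by (simp_all add: sa_def)

lemma sa_add [simp]: "a \<in> sa \<Longrightarrow> b \<in> sa \<Longrightarrow> a \<oplus> b \<in> sa"
  and sa_minus [simp]: "a \<in> sa \<Longrightarrow> b \<in> sa \<Longrightarrow> a \<ominus> b \<in> sa"
  and sa_neg [simp]: "a \<in> sa \<Longrightarrow> \<ominus> a \<in> sa"
  and sa_smult [simp]: "a \<in> sa \<Longrightarrow> complex_of_real r \<odot> a \<in> sa"
  and sa_sq [simp]: "a \<in> sa \<Longrightarrow> a \<otimes> a \<in> sa"
  by (simp_all add: sa_def star_add star_minus star_neg star_smult star_mult)

lemma sa_mult: "a \<in> sa \<Longrightarrow> b \<in> sa \<Longrightarrow> a \<otimes> b = b \<otimes> a \<Longrightarrow> a \<otimes> b \<in> sa"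
  by (simp add: sa_def star_mult)

lemma sa_star_mult [simp]: "x \<in> carrier A \<Longrightarrow> star A x \<otimes> x \<in> sa"
  and sa_mult_star [simp]: "x \<in> carrier A \<Longrightarrow> x \<otimes> star A x \<in> sa"
  by (simp_all add: sa_def star_mult)

lemma sa_sqrt_el: "a \<in> sa \<Longrightarrow> cnorm A (\<one> \<ominus> a) \<le> 1 \<Longrightarrow> sqrt_el a \<in> sa"
  by (simp add: sa_def sqrt_el_sa sqrt_el_closed)

lemma sa_carrier [simp]: "a \<in> sa \<Longrightarrow> a \<in> carrier A"
  and sa_star [simp]: "a \<in> sa \<Longrightarrow> star A a = a"
  by (auto simp: sa_def)

text \<open>Compare \<open>b\<close> with the normal element \<open>b + i s\<close>.\<close>

lemma commuting_sq_norm: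
  assumes [simp]: "b \<in> sa" "s \<in> sa" and comm: "b \<otimes> s = s \<otimes> b"
  shows "(cnorm A b)\<^sup>2 \<le> cnorm A (b \<otimes> b \<oplus> s \<otimes> s)"
proof -
  define u where "u = b \<oplus> \<i> \<odot> s"
  have [simp]: "u \<in> carrier A" by (simp add: u_def)
  have us: "star A u = b \<oplus> (-\<i>) \<odot> s" by (simp add: u_def star_add star_smult)
  have "star A u \<otimes> u = b \<otimes> b \<oplus> s \<otimes> s"
    unfolding us by (simp add: u_def calg comm)
  then have "(cnorm A u)\<^sup>2 = cnorm A (b \<otimes> b \<oplus> s \<otimes> s)" using cstar_identity[of u] by simp
  moreover have "cnorm A b \<le> cnorm A u"
  proof -
    have "b = (1/2) \<odot> (u \<oplus> star A u)" unfolding us by (simp add: u_def calg)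
    then have "cnorm A b = cnorm A ((1/2) \<odot> (u \<oplus> star A u))" by simp
    also have "\<dots> = cnorm A (u \<oplus> star A u) / 2" using cnorm_smult[of "u \<oplus> star A u" "1/2"] by simp
    finally have "cnorm A b = cnorm A (u \<oplus> star A u) / 2" .
    then show ?thesis using cnorm_add[of u "star A u"] by simp
  qed
  ultimately show ?thesis by (metis cnorm_nonneg power_mono sa_carrier assms(1))
qed

text \<open>The element \<open>a = 1 - b^2\<close> lies within distance 1 of the unit, so it has a
  self-adjoint root \<open>s\<close> that commutes with \<open>b\<close>. Since
  \<open>s^2 + b^2 = 1\<close>, \<open>commuting_sq_norm\<close> bounds \<open>s\<close>.\<close>

lemma norm_one_minus_sq:
  assumes [simp]: "b \<in> sa" and "cnorm A b \<le> 1"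
  shows "cnorm A (\<one> \<ominus> b \<otimes> b) \<le> 1"
proof -
  define a where "a = \<one> \<ominus> b \<otimes> b"
  have [simp]: "a \<in> sa" by (simp add: a_def)
  have a1: "cnorm A (\<one> \<ominus> a) \<le> 1" using cnorm_sa_sq[of b] assms by (simp add: a_def power_le_one)
  define s where "s = sqrt_el a"
  have [simp]: "s \<in> sa" using a1 by (simp add: s_def sa_sqrt_el)
  have ss: "s \<otimes> s = a" using a1 by (simp add: s_def sqrt_el_sq)
  have "b \<otimes> a = a \<otimes> b" by (simp add: a_def calg)
  then have "b \<otimes> s = s \<otimes> b" unfolding s_def using a1 by (intro sqrt_el_intertwine) auto
  then have "(cnorm A s)\<^sup>2 \<le> cnorm A (s \<otimes> s \<oplus> b \<otimes> b)" by (intro commuting_sq_norm) auto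
  also have "s \<otimes> s \<oplus> b \<otimes> b = \<one>" unfolding ss a_def by (simp add: minus_eq a_assoc l_neg)
  finally show ?thesis using cnorm_one_le cnorm_sa_sq[of s] ss by (simp add: a_def)
qed

abbreviation rscale :: "real \<Rightarrow> 'a \<Rightarrow> 'a" where
  "rscale r x \<equiv> complex_of_real r \<odot> x"

text \<open>In spectral terms the inequality says that the spectrum of the self-adjoint
  \<open>a\<close> lies in \<open>[0, 2 t]\<close>. In this form closure under sums and nonnegative
  multiples is a triangle inequality.\<close>

definition nonneg :: "'a \<Rightarrow> bool" where
  "nonneg a \<longleftrightarrow> a \<in> sa \<and> (\<exists>t\<ge>0. cnorm A (rscale t \<one> \<ominus> a) \<le> t)"

lemma nonneg_sa [simp]: "nonneg a \<Longrightarrow> a \<in> sa" by (simp add: nonneg_def)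

lemma nonneg_add:
  assumes "nonneg a" "nonneg b" shows "nonneg (a \<oplus> b)"
proof -
  obtain s t where st: "s \<ge> 0" "cnorm A (rscale s \<one> \<ominus> a) \<le> s" "t \<ge> 0" "cnorm A (rscale t \<one> \<ominus> b) \<le> t"
    using assms by (auto simp: nonneg_def)
  have "rscale (s + t) \<one> \<ominus> (a \<oplus> b) = (rscale s \<one> \<ominus> a) \<oplus> (rscale t \<one> \<ominus> b)"
    using assms by (simp add: calg)
  then have "cnorm A (rscale (s + t) \<one> \<ominus> (a \<oplus> b)) \<le> s + t"
    using cnorm_add[of "rscale s \<one> \<ominus> a" "rscale t \<one> \<ominus> b"] st assms by simp
  then show ?thesis using st assms by (auto simp: nonneg_def intro!: exI[of _ "s + t"])
qed

lemma nonneg_scale: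
  assumes "nonneg a" "0 \<le> r" shows "nonneg (rscale r a)"
proof -
  obtain s where s: "s \<ge> 0" "cnorm A (rscale s \<one> \<ominus> a) \<le> s" using assms by (auto simp: nonneg_def)
  have "rscale (r * s) \<one> \<ominus> rscale r a = rscale r (rscale s \<one> \<ominus> a)"
    using assms by (simp add: calg)
  then have "cnorm A (rscale (r * s) \<one> \<ominus> rscale r a) \<le> r * s"
    using s assms by (simp add: cnorm_smult mult_left_mono)
  then show ?thesis using s assms by (auto simp: nonneg_def intro!: exI[of _ "r * s"])
qed

text \<open>The constant \<open>t\<close> itself is a witness, because
  \<open>t - (t - a) = a\<close>. Thus every self-adjoint element lies below its norm.\<close>

lemma nonneg_norm_diff:
  assumes "a \<in> sa" "cnorm A a \<le> t" shows "nonneg (rscale t \<one> \<ominus> a)"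
  using assms order_trans[OF cnorm_nonneg[of a] assms(2)] by (auto simp: nonneg_def intro!: exI[of _ t])

text \<open>Division by the constant of the cone moves \<open>a\<close> into the domain of
  \<open>sqrt_el\<close>. The last clause is there so that roots of commuting elements can be shown
  to commute.\<close>

lemma nonneg_root:
  assumes "nonneg a"
  shows "\<exists>r. nonneg r \<and> r \<otimes> r = a \<and> (\<forall>z\<in>carrier A. z \<otimes> a = a \<otimes> z \<longrightarrow> z \<otimes> r = r \<otimes> z)"
proof -
  obtain t where t: "t \<ge> 0" "cnorm A (rscale t \<one> \<ominus> a) \<le> t" using assms by (auto simp: nonneg_def)
  show ?thesis
  proof (cases "t = 0")
    case True
    then have "a = \<zero>" using t assms cnorm_eq_0[of a]
      by (simp add: minus_eq order_antisym)
    then show ?thesis by (intro exI[of _ "\<zero>"]) (auto simp: nonneg_def minus_eq intro!: exI[of _ 0])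
  next
    case False
    with t have t0: "t > 0" by simp
    define b where "b = rscale (1/t) a"
    have [simp]: "b \<in> sa" "a \<in> sa" using assms by (simp_all add: b_def del: of_real_divide)
    have ab: "a = rscale t b" using t0 by (simp add: b_def)
    have "rscale t \<one> \<ominus> a = rscale t (\<one> \<ominus> b)" unfolding ab by (simp add: calg)
    then have b1: "cnorm A (\<one> \<ominus> b) \<le> 1" using t t0 by (simp add: cnorm_smult)
    define r where "r = rscale (sqrt t) (sqrt_el b)"
    have [simp]: "sqrt_el b \<in> sa" using b1 by (simp add: sa_sqrt_el)
    have "nonneg (sqrt_el b)" using sqrt_el_norm[of b] b1 by (auto simp: nonneg_def intro!: exI[of _ 1])
    then have "nonneg r" unfolding r_def using t by (intro nonneg_scale) auto
    moreover have "r \<otimes> r = a" using t0 b1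
      by (simp add: r_def smult_mult_left smult_mult_right sqrt_el_sq ab flip: of_real_mult)
    moreover have "z \<otimes> r = r \<otimes> z" if z: "z \<in> carrier A" "z \<otimes> a = a \<otimes> z" for z
    proof -
      have "z \<otimes> b = b \<otimes> z" using z by (simp add: b_def smult_mult_left smult_mult_right)
      then have "z \<otimes> sqrt_el b = sqrt_el b \<otimes> z" using z b1 by (intro sqrt_el_intertwine) auto
      then show ?thesis using z by (simp add: r_def smult_mult_left smult_mult_right)
    qed
    ultimately show ?thesis by blast
  qed
qed

text \<open>Scaling \<open>b\<close> by \<open>1 / sqrt t\<close> reduces this to
  \<open>norm_one_minus_sq\<close>.\<close>

lemma nonneg_sq_norm:
  assumes [simp]: "b \<in> sa" and t: "(cnorm A b)\<^sup>2 \<le> t"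
  shows "cnorm A (rscale t \<one> \<ominus> b \<otimes> b) \<le> t"
proof (cases "t = 0")
  case True
  then have "b = \<zero>" using t cnorm_eq_0[of b] by simp
  then show ?thesis using True by (simp add: minus_eq)
next
  case False
  with t have t0: "t > 0" using zero_le_power2[of "cnorm A b"] by linarith
  define c where "c = rscale (1 / sqrt t) b"
  have [simp]: "c \<in> sa" by (simp add: c_def del: of_real_divide)
  have "cnorm A b \<le> sqrt t" using t by (simp add: real_le_rsqrt)
  then have "cnorm A c \<le> 1" using t0 by (simp add: c_def cnorm_smult norm_divide)
  then have "cnorm A (\<one> \<ominus> c \<otimes> c) \<le> 1" by (rule norm_one_minus_sq[rotated]) simp
  moreover have "rscale t \<one> \<ominus> b \<otimes> b = rscale t (\<one> \<ominus> c \<otimes> c)"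
    using t0 by (simp add: c_def calg flip: of_real_mult)
  ultimately show ?thesis using t0 by (simp add: cnorm_smult)
qed

lemma nonneg_sq [simp]: "b \<in> sa \<Longrightarrow> nonneg (b \<otimes> b)"
  using nonneg_sq_norm[of b "(cnorm A b)\<^sup>2"] by (auto simp: nonneg_def intro!: exI[of _ "(cnorm A b)\<^sup>2"])

text \<open>Any bound on the norm may serve as the constant of the cone: \<open>a\<close> is the
  square of a self-adjoint root whose squared norm is the norm of \<open>a\<close>. This uniformity
  is what makes the cone closed.\<close>

lemma nonneg_norm:
  assumes "nonneg a" "cnorm A a \<le> t" shows "cnorm A (rscale t \<one> \<ominus> a) \<le> t"
proof -
  obtain r where "nonneg r" "r \<otimes> r = a" using nonneg_root assms by blast
  then show ?thesis using nonneg_sq_norm[of r t] cnorm_sa_sq[of r] assms by simp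
qed

text \<open>By \<open>nonneg_norm\<close> the constant for \<open>a + e\<close> can be taken as
  \<open>?T + e\<close> with \<open>?T\<close> independent of \<open>e\<close>. The multiple
  \<open>e\<close> of the unit cancels in the difference, and letting \<open>e\<close> tend to 0
  leaves the constant \<open>?T\<close> for \<open>a\<close>.\<close>

lemma nonneg_closed:
  assumes [simp]: "a \<in> sa" and pos: "\<And>e. 0 < e \<Longrightarrow> nonneg (a \<oplus> rscale e \<one>)"
  shows "nonneg a"
proof -
  let ?T = "cnorm A a + 1"
  have "cnorm A (rscale ?T \<one> \<ominus> a) \<le> ?T + e" if "0 < e" for e
  proof -
    have "cnorm A (rscale e \<one>) \<le> e" using cnorm_one_le that by (simp add: cnorm_smult)
    then have "cnorm A (a \<oplus> rscale e \<one>) \<le> ?T + e"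
      using that cnorm_add[of a "rscale e \<one>"] by simp
    then have "cnorm A (rscale (?T + e) \<one> \<ominus> (a \<oplus> rscale e \<one>)) \<le> ?T + e"
      using pos that by (intro nonneg_norm) auto
    moreover have "rscale (?T + e) \<one> \<ominus> (a \<oplus> rscale e \<one>) = rscale ?T \<one> \<ominus> a"
      by (simp add: calg)
    ultimately show ?thesis by simp
  qed
  then have "cnorm A (rscale ?T \<one> \<ominus> a) \<le> ?T"
    by (rule field_le_epsilon)
  then show ?thesis by (auto simp: nonneg_def intro!: exI[of _ ?T])
qed

text \<open>The roots \<open>r\<close> and \<open>q\<close> of the factors commute, so
  \<open>r \<otimes> q\<close> is self-adjoint and the product is its square.\<close>

lemma nonneg_mult:
  assumes "nonneg a" "nonneg b" and comm: "a \<otimes> b = b \<otimes> a"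
  shows "nonneg (a \<otimes> b)"
proof -
  obtain r where r: "nonneg r" "r \<otimes> r = a" and rc: "\<And>z. z \<in> carrier A \<Longrightarrow> z \<otimes> a = a \<otimes> z \<Longrightarrow> z \<otimes> r = r \<otimes> z"
    using nonneg_root assms by blast
  obtain q where q: "nonneg q" "q \<otimes> q = b" and qc: "\<And>z. z \<in> carrier A \<Longrightarrow> z \<otimes> b = b \<otimes> z \<Longrightarrow> z \<otimes> q = q \<otimes> z"
    using nonneg_root assms by blast
  note [simp] = nonneg_sa[OF r(1)] nonneg_sa[OF q(1)]
  have "b \<otimes> r = r \<otimes> b" using rc[of b] assms by simp
  then have rq: "r \<otimes> q = q \<otimes> r" using qc[of r] by simp
  have "a \<otimes> b = (r \<otimes> r) \<otimes> (q \<otimes> q)" by (simp add: r q)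
  also have "\<dots> = r \<otimes> (r \<otimes> q) \<otimes> q" by (simp add: m_assoc)
  also have "\<dots> = r \<otimes> (q \<otimes> r) \<otimes> q" by (simp only: rq)
  also have "\<dots> = (r \<otimes> q) \<otimes> (r \<otimes> q)" by (simp add: m_assoc)
  finally show ?thesis using sa_mult[of r q] rq by simp
qed

text \<open>The product of the two assumed elements is \<open>t^2 - a^2\<close>. It has a root
  \<open>s\<close> that commutes with \<open>a\<close>, and \<open>a^2 + s^2 = t^2\<close> bounds
  \<open>a\<close> through \<open>commuting_sq_norm\<close>.\<close>

lemma nonneg_sandwich:
  assumes "a \<in> sa" and p: "nonneg (rscale t \<one> \<ominus> a)" and q: "nonneg (rscale t \<one> \<oplus> a)" and t: "0 \<le> t"
  shows "cnorm A a \<le> t"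
proof -
  note [simp] = assms(1)
  have "nonneg ((rscale t \<one> \<ominus> a) \<otimes> (rscale t \<one> \<oplus> a))"
    by (rule nonneg_mult[OF p q]) (simp add: calg)
  then obtain s where s: "nonneg s" "s \<otimes> s = (rscale t \<one> \<ominus> a) \<otimes> (rscale t \<one> \<oplus> a)"
     "\<And>z. z \<in> carrier A \<Longrightarrow> z \<otimes> ((rscale t \<one> \<ominus> a) \<otimes> (rscale t \<one> \<oplus> a)) = ((rscale t \<one> \<ominus> a) \<otimes> (rscale t \<one> \<oplus> a)) \<otimes> z
       \<Longrightarrow> z \<otimes> s = s \<otimes> z"
    using nonneg_root by blast
  have "a \<otimes> s = s \<otimes> a" by (rule s(3)) (simp_all add: calg)
  then have "(cnorm A a)\<^sup>2 \<le> cnorm A (a \<otimes> a \<oplus> s \<otimes> s)" using s(1) by (intro commuting_sq_norm) auto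
  also have "a \<otimes> a \<oplus> s \<otimes> s = rscale (t * t) \<one>" unfolding s(2) by (simp add: calg)
  also have "cnorm A \<dots> \<le> t * t" using cnorm_one_le t by (simp add: cnorm_smult norm_mult mult_left_le)
  finally show ?thesis using t by (simp add: power2_eq_square[symmetric] abs_le_square_iff[symmetric])
qed

text \<open>This is \<open>nonneg_sandwich\<close> with \<open>t = 0\<close>.\<close>

lemma nonneg_proper:
  assumes "nonneg a" "nonneg (\<ominus> a)" shows "a = \<zero>"
proof -
  have "cnorm A a \<le> 0" using assms by (intro nonneg_sandwich) (simp_all add: minus_eq)
  then show ?thesis using assms cnorm_eq_0[of a] by (simp add: order_antisym)
qed

text \<open>Put \<open>e = b - d\<close>; then \<open>(b + d) e = 0\<close>. The elements
  \<open>b e^2\<close> and \<open>d e^2\<close> are in the cone and sum to 0, so both vanish by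
  properness. Their difference is \<open>e^3\<close>, hence \<open>e^4 = 0\<close>, and the
  C*-identity gives \<open>e = 0\<close>.\<close>

lemma root_unique:
  assumes b: "nonneg b" and d: "nonneg d" and comm: "b \<otimes> d = d \<otimes> b" and eq: "b \<otimes> b = d \<otimes> d"
  shows "b = d"
proof -
  note [simp] = nonneg_sa[OF b] nonneg_sa[OF d]
  define e where "e = b \<ominus> d"
  have [simp]: "e \<in> sa" by (simp add: e_def)
  have be: "b \<otimes> e = e \<otimes> b" and de: "d \<otimes> e = e \<otimes> d"
    unfolding e_def by (simp_all add: calg comm)
  have e0: "(b \<oplus> d) \<otimes> e = \<zero>" by (simp add: e_def calg comm eq)
  have "nonneg (b \<otimes> (e \<otimes> e))"
    by (rule nonneg_mult) (use b be in \<open>simp_all add: m_assoc\<close>, metis be m_assoc sa_carrier \<open>e \<in> sa\<close> \<open>b \<in> sa\<close>)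
  moreover have "nonneg (d \<otimes> (e \<otimes> e))"
    by (rule nonneg_mult) (use d de in \<open>simp_all add: m_assoc\<close>, metis de m_assoc sa_carrier \<open>e \<in> sa\<close> \<open>d \<in> sa\<close>)
  moreover have "b \<otimes> (e \<otimes> e) \<oplus> d \<otimes> (e \<otimes> e) = \<zero>"
    using e0 by (metis l_distr m_assoc sa_carrier \<open>e \<in> sa\<close> \<open>d \<in> sa\<close> \<open>b \<in> sa\<close> l_null a_closed m_closed)
  then have neg: "\<ominus> (b \<otimes> (e \<otimes> e)) = d \<otimes> (e \<otimes> e)"
    by (metis minus_equality a_comm sa_carrier \<open>e \<in> sa\<close> \<open>d \<in> sa\<close> \<open>b \<in> sa\<close> m_closed)
  ultimately have 0: "b \<otimes> (e \<otimes> e) = \<zero>" using nonneg_proper by metis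
  with neg have 1: "d \<otimes> (e \<otimes> e) = \<zero>" by simp
  have "e \<otimes> (e \<otimes> e) = b \<otimes> (e \<otimes> e) \<ominus> d \<otimes> (e \<otimes> e)"
    by (subst (1) e_def) (simp add: minus_eq l_distr l_minus)
  then have "e \<otimes> (e \<otimes> e) = \<zero>" using 0 1 by simp
  then have "(e \<otimes> e) \<otimes> (e \<otimes> e) = \<zero>" by (metis m_assoc r_null sa_carrier \<open>e \<in> sa\<close> m_closed)
  then have "((cnorm A e)\<^sup>2)\<^sup>2 = 0" using cnorm_sa_sq[of e] cnorm_sa_sq[of "e \<otimes> e"] by simp
  then have "e = \<zero>" using cnorm_eq_0[of e] by simp
  then show ?thesis using minus_zero_imp_eq[of b d] by (simp add: e_def)
qed

text \<open>Intertwining makes the root of \<open>a \<otimes> a\<close> commute with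
  \<open>a\<close>, so \<open>root_unique\<close> identifies the two. The norm bound puts
  \<open>a \<otimes> a\<close> in the domain of \<open>sqrt_el\<close>.\<close>

lemma sqrt_el_of_sq:
  assumes a: "nonneg a" "cnorm A a \<le> 1"
  shows "sqrt_el (a \<otimes> a) = a"
proof (rule root_unique)
  have n: "cnorm A (\<one> \<ominus> a \<otimes> a) \<le> 1" using a by (intro norm_one_minus_sq) auto
  have [simp]: "a \<in> sa" using a by simp
  show "nonneg (sqrt_el (a \<otimes> a))" using n sqrt_el_norm[of "a \<otimes> a"] by (auto simp: nonneg_def intro!: sa_sqrt_el exI[of _ 1])
  show "sqrt_el (a \<otimes> a) \<otimes> a = a \<otimes> sqrt_el (a \<otimes> a)" using n by (intro sqrt_el_intertwine[symmetric]) (auto simp: m_assoc)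
  show "sqrt_el (a \<otimes> a) \<otimes> sqrt_el (a \<otimes> a) = a \<otimes> a" using n by (intro sqrt_el_sq) auto
qed (fact a)

text \<open>With \<open>c = - z^* z\<close> and \<open>d = z z^*\<close>, both in the cone,
  \<open>z c^2 = d^2 z\<close> passes to roots as \<open>z c = d z\<close>. But
  \<open>d z = z z^* z = - z c\<close>, so \<open>z c = 0\<close> and then
  \<open>c^2 = 0\<close>.\<close>

lemma star_mult_neg_imp_zero:
  assumes z [simp]: "z \<in> carrier A" and n: "cnorm A z \<le> 1" and neg: "nonneg (\<ominus> (star A z \<otimes> z))"
  shows "z = \<zero>"
proof -
  define c where "c = \<ominus> (star A z \<otimes> z)"
  define d where "d = z \<otimes> star A z"
  have c: "nonneg c" using neg by (simp add: c_def)
  have [simp]: "c \<in> sa" "d \<in> sa" by (simp_all add: c_def d_def)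
  have zz: "star A z \<otimes> z = \<ominus> c" by (simp add: c_def)
  define h where "h = z \<oplus> star A z"
  define k where "k = \<i> \<odot> (z \<ominus> star A z)"
  have [simp]: "h \<in> sa" by (rule saI) (simp_all add: h_def star_add a_comm)
  have [simp]: "k \<in> sa" by (rule saI) (simp_all add: k_def calg)
  \<comment> \<open>The squares of \<open>h\<close> and \<open>k\<close> sum to
    \<open>2 (z^* z + z z^* )\<close>, so \<open>z z^*\<close> is half that sum plus
    \<open>c\<close>, a sum of elements of the cone.\<close>
  have "d = rscale (1/2) (h \<otimes> h \<oplus> k \<otimes> k) \<oplus> c"
    unfolding h_def k_def c_def d_def by (simp add: calg)
  then have d: "nonneg d" using c by (simp add: nonneg_add nonneg_scale del: of_real_divide)
  have nz: "cnorm A (star A z \<otimes> z) \<le> 1" using n cstar_identity[of z] by (simp add: power_le_one)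
  then have nc: "cnorm A c \<le> 1" by (simp add: c_def)
  have nd: "cnorm A d \<le> 1" using n cstar_identity[of "star A z"] by (simp add: d_def power_le_one)
  have "z \<otimes> sqrt_el (c \<otimes> c) = sqrt_el (d \<otimes> d) \<otimes> z"
  proof (rule sqrt_el_intertwine)
    show "z \<otimes> (c \<otimes> c) = d \<otimes> d \<otimes> z"
      unfolding c_def d_def by (simp add: l_minus r_minus m_assoc)
  qed (use nc nd norm_one_minus_sq in auto)
  then have "z \<otimes> c = d \<otimes> z" using sqrt_el_of_sq c d nc nd by simp
  also have "d \<otimes> z = \<ominus> (z \<otimes> c)" unfolding d_def by (simp add: m_assoc zz r_minus)
  finally have zc: "z \<otimes> c = \<ominus> (z \<otimes> c)" .
  then have "z \<otimes> c \<oplus> z \<otimes> c = \<zero>" by (metis r_neg m_closed z sa_carrier \<open>c \<in> sa\<close>)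
  then have "2 \<odot> (z \<otimes> c) = \<zero>" by (simp add: collect)
  then have "z \<otimes> c = \<zero>" using smult_eq_0[of "z \<otimes> c" 2] by simp
  then have "star A z \<otimes> z \<otimes> c = \<zero>" by (simp add: m_assoc)
  then have "c \<otimes> c = \<zero>" by (simp add: zz l_minus)
  then have "c = \<zero>" using cnorm_sa_sq[of c] cnorm_eq_0[of c] by simp
  then have "star A z \<otimes> z = \<zero>" by (simp add: zz)
  then show ?thesis using cstar_identity[of z] cnorm_eq_0[of z] by simp
qed

lemma star_mult_neg_imp_zero':
  assumes z [simp]: "z \<in> carrier A" and neg: "nonneg (\<ominus> (star A z \<otimes> z))"
  shows "z = \<zero>"
proof -
  define t where "t = 1 / (cnorm A z + 1)"
  have z0: "0 < cnorm A z + 1" using cnorm_nonneg[OF z] by linarith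
  then have t: "0 < t" by (simp add: t_def)
  have "cnorm A (rscale t z) \<le> 1" using t z0
    by (simp add: cnorm_smult) (simp add: t_def divide_simps)
  moreover have "\<ominus> (star A (rscale t z) \<otimes> rscale t z) = rscale (t * t) (\<ominus> (star A z \<otimes> z))"
    by (simp add: calg)
  then have "nonneg (\<ominus> (star A (rscale t z) \<otimes> rscale t z))"
    using nonneg_scale[OF neg, of "t * t"] t by simp
  ultimately have "rscale t z = \<zero>" by (intro star_mult_neg_imp_zero) auto
  then show ?thesis using smult_eq_0[of z "complex_of_real t"] t by simp
qed

text \<open>With \<open>a = y\<^sup>* y\<close> and \<open>m = \<bar>a\<bar> - a\<close> one has \<open>a m = - \<bar>a\<bar> m\<close>, so \<open>z = y m\<close> satisfies
  \<open>- z\<^sup>* z = \<bar>a\<bar> m\<^sup>2 \<ge> 0\<close>. Hence \<open>z = 0\<close>, \<open>a m = 0\<close>, \<open>m\<^sup>2 = 0\<close> and \<open>a = \<bar>a\<bar>\<close>.\<close>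

lemma nonneg_star_mult:
  assumes y [simp]: "y \<in> carrier A"
  shows "nonneg (star A y \<otimes> y)"
proof -
  define a where "a = star A y \<otimes> y"
  have [simp]: "a \<in> sa" by (simp add: a_def)
  obtain b where b: "nonneg b" "b \<otimes> b = a \<otimes> a" and bc: "\<And>z. z \<in> carrier A \<Longrightarrow> z \<otimes> (a \<otimes> a) = (a \<otimes> a) \<otimes> z \<Longrightarrow> z \<otimes> b = b \<otimes> z"
    using nonneg_root[OF nonneg_sq[OF \<open>a \<in> sa\<close>]] by blast
  have [simp]: "b \<in> sa" using b by simp
  have ab: "a \<otimes> b = b \<otimes> a" using bc[of a] by (simp add: m_assoc)
  define m where "m = b \<ominus> a"
  have [simp]: "m \<in> sa" by (simp add: m_def)
  have bm: "b \<otimes> m = m \<otimes> b" by (simp add: m_def calg ab)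
  have am: "a \<otimes> m = \<ominus> (b \<otimes> m)" unfolding m_def by (simp add: calg b ab)
  have "star A (y \<otimes> m) \<otimes> (y \<otimes> m) = m \<otimes> (a \<otimes> m)"
    by (simp add: star_mult m_assoc a_def)
  also have "\<dots> = \<ominus> (b \<otimes> (m \<otimes> m))"
    by (simp add: am r_minus) (metis bm m_assoc sa_carrier \<open>b \<in> sa\<close> \<open>m \<in> sa\<close>)
  finally have "\<ominus> (star A (y \<otimes> m) \<otimes> (y \<otimes> m)) = b \<otimes> (m \<otimes> m)" by simp
  moreover have "nonneg (b \<otimes> (m \<otimes> m))"
    by (rule nonneg_mult) (use b bm in \<open>simp_all\<close>, metis bm m_assoc sa_carrier \<open>b \<in> sa\<close> \<open>m \<in> sa\<close>)
  ultimately have "y \<otimes> m = \<zero>" by (intro star_mult_neg_imp_zero') auto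
  then have am0: "a \<otimes> m = \<zero>" by (simp add: a_def m_assoc)
  then have bm0: "b \<otimes> m = \<zero>" using am by (metis minus_minus minus_zero m_closed sa_carrier \<open>b \<in> sa\<close> \<open>m \<in> sa\<close>)
  have "m \<otimes> m = b \<otimes> m \<ominus> a \<otimes> m" by (subst (1) m_def) (simp add: minus_eq l_distr l_minus)
  then have "m \<otimes> m = \<zero>" using am0 bm0 by simp
  then have "m = \<zero>" using cnorm_sa_sq[of m] cnorm_eq_0[of m] by simp
  then have "b = a" using minus_zero_imp_eq[of b a] by (simp add: m_def)
  then show ?thesis using b by (simp add: a_def)
qed

lemma positive_iff: "positive A a \<longleftrightarrow> nonneg a"
proof
  assume "positive A a" then show "nonneg a" using nonneg_star_mult by (auto simp: positive_def)
next
  assume "nonneg a"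
  then obtain r where "nonneg r" "r \<otimes> r = a" using nonneg_root by blast
  then show "positive A a" unfolding positive_def by (intro bexI[of _ r]) auto
qed

end


section \<open>The Hahn-Banach theorem\<close>

text \<open>The theorem is applied to two spaces that are not types: the self-adjoint part of a
  C*-algebra and the pairs of continuous real functions. Negatives are written as
  \<open>sc (-1)\<close>.\<close>

locale real_vec =
  fixes V :: "'v set" and pl :: "'v \<Rightarrow> 'v \<Rightarrow> 'v" and sc :: "real \<Rightarrow> 'v \<Rightarrow> 'v" and z :: 'v
  assumes pl_closed [simp]: "x \<in> V \<Longrightarrow> y \<in> V \<Longrightarrow> pl x y \<in> V"
    and sc_closed [simp]: "x \<in> V \<Longrightarrow> sc r x \<in> V"
    and z_closed [simp]: "z \<in> V"
    and pl_assoc: "x \<in> V \<Longrightarrow> y \<in> V \<Longrightarrow> w \<in> V \<Longrightarrow> pl (pl x y) w = pl x (pl y w)"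
    and pl_comm: "x \<in> V \<Longrightarrow> y \<in> V \<Longrightarrow> pl x y = pl y x"
    and pl_z [simp]: "x \<in> V \<Longrightarrow> pl z x = x"
    and sc_one [simp]: "x \<in> V \<Longrightarrow> sc 1 x = x"
    and sc_pl: "x \<in> V \<Longrightarrow> y \<in> V \<Longrightarrow> sc r (pl x y) = pl (sc r x) (sc r y)"
    and sc_add: "x \<in> V \<Longrightarrow> sc (r + s) x = pl (sc r x) (sc s x)"
    and sc_sc: "x \<in> V \<Longrightarrow> sc r (sc s x) = sc (r * s) x"
    and sc_0 [simp]: "x \<in> V \<Longrightarrow> sc 0 x = z"
begin

lemma pl_left_comm: "x \<in> V \<Longrightarrow> y \<in> V \<Longrightarrow> w \<in> V \<Longrightarrow> pl x (pl y w) = pl y (pl x w)"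
  by (metis pl_assoc pl_comm)

lemma sc_z [simp]: "sc r z = z"
  using sc_sc[of z r 0] by simp

lemma pl_neg [simp]: "x \<in> V \<Longrightarrow> pl x (sc (-1) x) = z"
  using sc_add[of x 1 "-1"] by simp

definition sublinear :: "('v \<Rightarrow> real) \<Rightarrow> bool" where
  "sublinear q \<longleftrightarrow> (\<forall>x\<in>V. \<forall>y\<in>V. q (pl x y) \<le> q x + q y) \<and> (\<forall>r\<ge>0. \<forall>x\<in>V. q (sc r x) = r * q x)"

text \<open>One inequality for positive factors is enough: applied to \<open>1/r\<close> and
  \<open>sc r x\<close> it gives the converse.\<close>

lemma sublinearI:
  assumes "\<And>x y. x \<in> V \<Longrightarrow> y \<in> V \<Longrightarrow> q (pl x y) \<le> q x + q y"
    and le: "\<And>r x. r > 0 \<Longrightarrow> x \<in> V \<Longrightarrow> q (sc r x) \<le> r * q x" and "q z = 0"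
  shows "sublinear q"
proof -
  have "q (sc r x) = r * q x" if "0 \<le> r" "x \<in> V" for r x
  proof (cases "r = 0")
    case False
    with that have r: "r > 0" by simp
    have "q x \<le> 1/r * q (sc r x)" using le[of "1/r" "sc r x"] r that by (simp add: sc_sc)
    then have "r * q x \<le> q (sc r x)" using r by (simp add: field_simps)
    then show ?thesis using le[OF r that(2)] by simp
  qed (use assms that in simp)
  then show ?thesis using assms by (simp add: sublinear_def)
qed

lemma sublinear_z: "sublinear q \<Longrightarrow> q z = 0"
  unfolding sublinear_def by (metis mult_zero_left order_refl sc_0 z_closed)

lemma sublinear_neg:
  assumes "sublinear q" "x \<in> V" shows "- q (sc (-1) x) \<le> q x"
proof -
  have "q (pl x (sc (-1) x)) \<le> q x + q (sc (-1) x)" using assms sc_closed unfolding sublinear_def by blast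
  then show ?thesis using assms sublinear_z[OF assms(1)] by simp
qed

lemma sublinear_shift:
  assumes m: "sublinear m" and y: "y \<in> V"
  shows "\<exists>q. sublinear q \<and> (\<forall>x\<in>V. q x \<le> m x \<and> q x \<le> m (pl x y) - m y)"
proof -
  \<comment> \<open>The terms \<open>t = 0\<close> and \<open>t = 1\<close> of the infimum give the
    two required bounds. \<open>lower\<close> keeps the infimum finite, and in the triangle
    inequality the parameters \<open>t\<close> and \<open>s\<close> add up.\<close>
  define q where "q x = (INF t\<in>{0..}. m (pl x (sc t y)) - t * m y)" for x
  have m_add: "m (pl a b) \<le> m a + m b" if "a \<in> V" "b \<in> V" for a b
    using m that by (auto simp: sublinear_def)
  have m_sc: "m (sc r a) = r * m a" if "0 \<le> r" "a \<in> V" for a r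
    using m that by (auto simp: sublinear_def)
  have lower: "- m (sc (-1) x) \<le> m (pl x (sc t y)) - t * m y" if "x \<in> V" "t \<ge> 0" for x t
  proof -
    have "sc t y = pl (sc (-1) x) (pl x (sc t y))"
      using that y pl_assoc[of "sc (-1) x" x "sc t y"] pl_comm[of "sc (-1) x" x] by simp
    then have "m (sc t y) \<le> m (sc (-1) x) + m (pl x (sc t y))" using m_add that y
      by (metis pl_closed sc_closed)
    then show ?thesis using m_sc that y by simp
  qed
  have bdd: "bdd_below ((\<lambda>t. m (pl x (sc t y)) - t * m y) ` {0..})" if "x \<in> V" for x
    using lower[OF that] by (auto intro!: bdd_belowI2)
  have q_le: "q x \<le> m (pl x (sc t y)) - t * m y" if "x \<in> V" "t \<ge> 0" for x t
    unfolding q_def using that by (intro cINF_lower bdd) auto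
  have q_ge: "b \<le> q x" if "\<And>t. t \<ge> 0 \<Longrightarrow> b \<le> m (pl x (sc t y)) - t * m y" for b x
    unfolding q_def using that by (intro cINF_greatest) auto
  have "sublinear q"
  proof (rule sublinearI)
    fix x w assume x: "x \<in> V" and w: "w \<in> V"
    have "q (pl x w) - (m (pl x (sc t y)) - t * m y) \<le> m (pl w (sc s y)) - s * m y"
      if "t \<ge> 0" "s \<ge> 0" for t s
    proof -
      have "pl (pl x w) (sc (t + s) y) = pl (pl x (sc t y)) (pl w (sc s y))"
        using x w y by (simp add: sc_add pl_assoc pl_left_comm)
      then have "m (pl (pl x w) (sc (t + s) y)) \<le> m (pl x (sc t y)) + m (pl w (sc s y))"
        using m_add x w y by simp
      then show ?thesis using q_le[of "pl x w" "t + s"] that x w by (simp add: algebra_simps)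
    qed
    then have "q (pl x w) - (m (pl x (sc t y)) - t * m y) \<le> q w" if "t \<ge> 0" for t
      using that by (intro q_ge) auto
    then have "q (pl x w) - q w \<le> q x" by (intro q_ge) (simp add: algebra_simps)
    then show "q (pl x w) \<le> q x + q w" by simp
  next
    fix r x assume r: "(0::real) < r" and x: "x \<in> V"
    have "q (sc r x) / r \<le> m (pl x (sc t y)) - t * m y" if "t \<ge> 0" for t
    proof -
      have "q (sc r x) \<le> m (pl (sc r x) (sc (r * t) y)) - r * t * m y"
        using q_le[of "sc r x" "r * t"] r that x by simp
      also have "pl (sc r x) (sc (r * t) y) = sc r (pl x (sc t y))" using x y by (simp add: sc_pl sc_sc)
      finally show ?thesis using r x y m_sc[of r "pl x (sc t y)"] by (simp add: field_simps)
    qed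
    then have "q (sc r x) / r \<le> q x" by (rule q_ge)
    then show "q (sc r x) \<le> r * q x" using r by (simp add: field_simps)
  next
    have "0 \<le> q z" using lower[of z] sublinear_z[OF m] by (intro q_ge) simp
    then show "q z = 0" using q_le[of z 0] y sublinear_z[OF m] by simp
  qed
  moreover have "q x \<le> m x \<and> q x \<le> m (pl x y) - m y" if "x \<in> V" for x
    using q_le[of x 0] q_le[of x 1] that y pl_comm[of x z] by simp
  ultimately show ?thesis by blast
qed

text \<open>Minimal sublinear functionals are linear: by \<open>sublinear_shift\<close> they satisfy \<open>m x \<le> m (x + y) - m y\<close>.\<close>

lemma minimal_sublinear:
  assumes p: "sublinear p"
  shows "\<exists>m. sublinear m \<and> (\<forall>x\<in>V. m x \<le> p x) \<and>
    (\<forall>q. sublinear q \<and> (\<forall>x\<in>V. q x \<le> m x) \<longrightarrow> (\<forall>x\<in>V. q x = m x))"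
proof -
  \<comment> \<open>Extensionality on \<open>V\<close> makes the pointwise order antisymmetric, as
    Zorn's lemma requires.\<close>
  define S where "S = {q \<in> extensional V. sublinear q \<and> (\<forall>x\<in>V. q x \<le> p x)}"
  \<comment> \<open>The order is reversed, so that a maximal element for Zorn's lemma is a minimal
    functional.\<close>
  define R where "R q q' \<longleftrightarrow> (\<forall>x\<in>V. q' x \<le> q x)" for q q' :: "'v \<Rightarrow> real"
  have restr: "sublinear (restrict q V)" if "sublinear q" for q
    using that unfolding sublinear_def by simp
  have "\<exists>m\<in>S. \<forall>a\<in>S. R m a \<longrightarrow> a = m"
  proof (rule predicate_Zorn)
    show "partial_order_on S (relation_of R S)"
      unfolding partial_order_on_def preorder_on_def refl_on_def trans_def antisym_def relation_of_def R_def S_def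
      by (auto intro: order_trans) (rule extensionalityI[where A=V]; simp add: order_antisym)
  next
    fix C assume C: "C \<in> Chains (relation_of R S)"
    then have CS: "q \<in> S" if "q \<in> C" for q using that by (auto simp: Chains_def relation_of_def)
    have Cc: "R q q' \<or> R q' q" if "q \<in> C" "q' \<in> C" for q q'
      using C that by (auto simp: Chains_def relation_of_def)
    show "\<exists>u\<in>S. \<forall>a\<in>C. R a u"
    proof (cases "C = {}")
      case True
      have "restrict p V \<in> S" using p restr by (simp add: S_def)
      then show ?thesis using True by blast
    next
      case False
      define u where "u = (\<lambda>x\<in>V. INF q\<in>C. q x)"
      have sub: "sublinear q" if "q \<in> C" for q using CS[OF that] by (simp add: S_def)
      have lower: "- p (sc (-1) x) \<le> q x" if "q \<in> C" "x \<in> V" for q x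
      proof -
        have "q (sc (-1) x) \<le> p (sc (-1) x)" using CS[OF that(1)] that(2) by (simp add: S_def)
        then show ?thesis using sublinear_neg[OF sub[OF that(1)] that(2)] by simp
      qed
      have u_le: "u x \<le> q x" if "q \<in> C" "x \<in> V" for q x
        unfolding u_def using that lower by (auto intro!: cINF_lower bdd_belowI2)
      have u_ge: "b \<le> u x" if "\<And>q. q \<in> C \<Longrightarrow> b \<le> q x" "x \<in> V" for b x
        unfolding u_def using that False by (auto intro!: cINF_greatest)
      have "sublinear u"
      proof (rule sublinearI)
        fix x w assume x: "x \<in> V" and w: "w \<in> V"
        have "u (pl x w) - q x \<le> q' w" if q: "q \<in> C" "q' \<in> C" for q q'
        proof -
          \<comment> \<open>The smaller of two members of the chain lies below both, so one
            \<open>k\<close> serves at \<open>x\<close> and at \<open>w\<close>; this is why the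
            infimum of the chain is subadditive.\<close>
          obtain k where k: "k \<in> C" "k x \<le> q x" "k w \<le> q' w"
            using Cc[OF q] q x w by (auto simp: R_def)
          have "u (pl x w) \<le> k (pl x w)" using u_le k x w by simp
          also have "\<dots> \<le> k x + k w" using sub[OF k(1)] x w by (simp add: sublinear_def)
          finally show ?thesis using k by simp
        qed
        then have "u (pl x w) - q x \<le> u w" if "q \<in> C" for q using that w by (intro u_ge) auto
        then have "u (pl x w) - u w \<le> u x" using x by (intro u_ge) (auto simp: algebra_simps)
        then show "u (pl x w) \<le> u x + u w" by simp
      next
        fix r x assume r: "(0::real) < r" and x: "x \<in> V"
        have "u (sc r x) / r \<le> q x" if "q \<in> C" for q
          using u_le[OF that, of "sc r x"] sub[OF that] r x by (simp add: sublinear_def field_simps)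
        then have "u (sc r x) / r \<le> u x" using x by (rule u_ge)
        then show "u (sc r x) \<le> r * u x" using r by (simp add: field_simps)
      next
        have q0: "q z = 0" if "q \<in> C" for q using sublinear_z[OF sub[OF that]] .
        obtain q where "q \<in> C" using False by blast
        then have "u z \<le> 0" using u_le[of q z] q0[of q] by (metis z_closed)
        moreover have "0 \<le> q z" if "q \<in> C" for q using q0[OF that] by simp
        then have "0 \<le> u z" by (rule u_ge[OF _ z_closed])
        ultimately show "u z = 0" by simp
      qed
      moreover obtain q0 where q0: "q0 \<in> C" using False by blast
      moreover have "u x \<le> p x" if "x \<in> V" for x
        using u_le[OF q0 that] CS[OF q0] that by (auto simp: S_def intro: order_trans)
      moreover have "u \<in> extensional V" by (simp add: u_def)
      ultimately have "u \<in> S" by (simp add: S_def)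
      then show ?thesis using u_le by (auto simp: R_def)
    qed
  qed
  then obtain m where m: "m \<in> S" and min: "\<And>a. a \<in> S \<Longrightarrow> R m a \<Longrightarrow> a = m" by blast
  have "q x = m x" if "sublinear q" "\<forall>x\<in>V. q x \<le> m x" "x \<in> V" for q x
  proof -
    have "restrict q V = m" using that m restr[of q]
      by (intro min) (auto simp: S_def R_def intro: order_trans)
    then show ?thesis using that(3) by auto
  qed
  then show ?thesis using m by (auto simp: S_def)
qed

text \<open>No functional is extended from a subspace. First \<open>p\<close> is replaced by its
  shift \<open>p'\<close> at \<open>x0\<close>; a linear functional below \<open>p'\<close> has
  value at least \<open>p x0\<close> at \<open>x0\<close>, as testing at \<open>-x0\<close> shows. A
  minimal sublinear functional below \<open>p'\<close> is linear.\<close>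

theorem hahn_banach:
  assumes p: "sublinear p" and x0: "x0 \<in> V"
  obtains f where "\<And>x y. x \<in> V \<Longrightarrow> y \<in> V \<Longrightarrow> f (pl x y) = f x + f y"
    "\<And>r x. x \<in> V \<Longrightarrow> f (sc r x) = r * f x" "\<And>x. x \<in> V \<Longrightarrow> f x \<le> p x" "f x0 = p x0"
proof -
  obtain p' where p': "sublinear p'" and le: "\<And>x. x \<in> V \<Longrightarrow> p' x \<le> p x"
    and at: "\<And>x. x \<in> V \<Longrightarrow> p' x \<le> p (pl x x0) - p x0"
    using sublinear_shift[OF p x0] by blast
  obtain f where f: "sublinear f" and fp: "\<And>x. x \<in> V \<Longrightarrow> f x \<le> p' x"
    and min: "\<And>q x. sublinear q \<Longrightarrow> (\<And>x. x \<in> V \<Longrightarrow> q x \<le> f x) \<Longrightarrow> x \<in> V \<Longrightarrow> q x = f x"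
    using minimal_sublinear[OF p'] by blast
  have add: "f (pl x y) = f x + f y" if x: "x \<in> V" and y: "y \<in> V" for x y
  proof -
    obtain q where "sublinear q" and q: "\<And>x. x \<in> V \<Longrightarrow> q x \<le> f x" "\<And>x. x \<in> V \<Longrightarrow> q x \<le> f (pl x y) - f y"
      using sublinear_shift[OF f y] by blast
    then have "q x = f x" using min x by blast
    then have "f x + f y \<le> f (pl x y)" using q(2)[OF x] by simp
    moreover have "f (pl x y) \<le> f x + f y" using f x y by (simp add: sublinear_def)
    ultimately show ?thesis by simp
  qed
  have neg: "f (sc (-1) x) = - f x" if "x \<in> V" for x
    using add[of x "sc (-1) x"] sublinear_z[OF f] that by simp
  have scale: "f (sc r x) = r * f x" if x: "x \<in> V" for r x
  proof (cases "0 \<le> r")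
    case True then show ?thesis using f x by (simp add: sublinear_def)
  next
    case False
    then have "f (sc (-r) (sc (-1) x)) = (-r) * f (sc (-1) x)"
      using f x unfolding sublinear_def by (metis linear neg_0_le_iff_le sc_closed)
    then show ?thesis using x neg by (simp add: sc_sc)
  qed
  have "f (sc (-1) x0) \<le> p (pl (sc (-1) x0) x0) - p x0"
    using fp at x0 by (meson order_trans sc_closed)
  then have "p x0 \<le> f x0" using neg x0 pl_comm[of "sc (-1) x0" x0] sublinear_z[OF p] by simp
  then have eq: "f x0 = p x0" using fp[OF x0] le[OF x0] by simp
  have "f x \<le> p x" if "x \<in> V" for x using fp[OF that] le[OF that] by simp
  from that[OF add scale this eq] show thesis .
qed

end


section \<open>States\<close>

lemma positive_complex: "positive complex_cstar x \<longleftrightarrow> Im x = 0 \<and> 0 \<le> Re x"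
proof
  assume "positive complex_cstar x"
  then obtain y where "x = cnj y * y" by (auto simp: positive_def)
  then have "x = complex_of_real ((cmod y)\<^sup>2)" by (metis complex_norm_square mult.commute)
  then show "Im x = 0 \<and> 0 \<le> Re x" by simp
next
  assume x: "Im x = 0 \<and> 0 \<le> Re x"
  then have "x = cnj (complex_of_real (sqrt (Re x))) * complex_of_real (sqrt (Re x))"
    by (simp add: complex_eq_iff)
  then show "positive complex_cstar x" unfolding positive_def complex_cstar_simps by blast
qed

context cstar_algebra
begin

lemma sa_smult_minus_one [simp]: "a \<in> sa \<Longrightarrow> (-1) \<odot> a \<in> sa"
  using sa_smult[of a "-1"] by simp

definition re_part :: "'a \<Rightarrow> 'a" where "re_part x = (1/2) \<odot> (x \<oplus> star A x)"
definition im_part :: "'a \<Rightarrow> 'a" where "im_part x = (-\<i>/2) \<odot> (x \<ominus> star A x)"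

lemma re_part_sa [simp]: "x \<in> carrier A \<Longrightarrow> re_part x \<in> sa"
  and im_part_sa [simp]: "x \<in> carrier A \<Longrightarrow> im_part x \<in> sa"
  by (rule saI; simp add: re_part_def im_part_def calg)+

lemma re_im: "x \<in> carrier A \<Longrightarrow> x = re_part x \<oplus> \<i> \<odot> im_part x"
  by (simp add: re_part_def im_part_def calg)

lemma re_im_add: 
  assumes "x \<in> carrier A" "y \<in> carrier A"
  shows "re_part (x \<oplus> y) = re_part x \<oplus> re_part y" "im_part (x \<oplus> y) = im_part x \<oplus> im_part y"
  using assms by (simp_all add: re_part_def im_part_def calg)

lemma re_im_smult: 
  assumes "x \<in> carrier A"
  shows "re_part (c \<odot> x) = rscale (Re c) (re_part x) \<oplus> rscale (- Im c) (im_part x)"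
    "im_part (c \<odot> x) = rscale (Re c) (im_part x) \<oplus> rscale (Im c) (re_part x)"
proof -
  have *: "a \<odot> x \<oplus> b \<odot> star A x = a' \<odot> x \<oplus> b' \<odot> star A x" if "a = a'" "b = b'" for a a' b b'
    using that by simp
  show "re_part (c \<odot> x) = rscale (Re c) (re_part x) \<oplus> rscale (- Im c) (im_part x)"
    "im_part (c \<odot> x) = rscale (Re c) (im_part x) \<oplus> rscale (Im c) (re_part x)"
    using assms by (simp_all add: re_part_def im_part_def calg) (rule *; simp add: complex_eq_iff)+
qed

lemma re_im_of_sa: "x \<in> sa \<Longrightarrow> re_part x = x" "x \<in> sa \<Longrightarrow> im_part x = \<zero>"
  by (simp_all add: re_part_def im_part_def calg)

lemma cnorm_re_im: 
  assumes "x \<in> carrier A"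
  shows "cnorm A (re_part x) \<le> cnorm A x" "cnorm A (im_part x) \<le> cnorm A x"
  using assms cnorm_add[of x "star A x"] cnorm_minus[of x "star A x"] 
  by (simp_all add: re_part_def im_part_def cnorm_smult norm_divide)

lemma nonneg_one [simp]: "nonneg \<one>" using nonneg_sq[of \<one>] by simp
lemma nonneg_zero [simp]: "nonneg \<zero>" using nonneg_sq[of \<zero>] by simp

abbreviation states :: "('a \<Rightarrow> complex) set" where "states \<equiv> pu_maps A complex_cstar"

context
  fixes \<phi> assumes \<phi>: "\<phi> \<in> states"
begin

lemma state_add: "x \<in> carrier A \<Longrightarrow> y \<in> carrier A \<Longrightarrow> \<phi> (x \<oplus> y) = \<phi> x + \<phi> y"
  and state_smult: "x \<in> carrier A \<Longrightarrow> \<phi> (c \<odot> x) = c * \<phi> x"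
  and state_one: "\<phi> \<one> = 1"
  and state_nonneg: "nonneg x \<Longrightarrow> Im (\<phi> x) = 0 \<and> 0 \<le> Re (\<phi> x)"
  using \<phi> by (auto simp: pu_maps_def positive_iff positive_complex)

lemma state_minus: "x \<in> carrier A \<Longrightarrow> y \<in> carrier A \<Longrightarrow> \<phi> (x \<ominus> y) = \<phi> x - \<phi> y"
  by (simp add: minus_eq_smult state_add state_smult)

text \<open>Both \<open>norm a - a\<close> and \<open>norm a + a\<close> are in the cone, and a
  state is real and nonnegative there.\<close>

lemma state_sa:
  assumes "a \<in> sa"
  shows "Im (\<phi> a) = 0" "\<bar>Re (\<phi> a)\<bar> \<le> cnorm A a"
proof -
  have "Im (\<phi> (rscale (cnorm A a) \<one> \<ominus> a)) = 0 \<and> 0 \<le> Re (\<phi> (rscale (cnorm A a) \<one> \<ominus> a))"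
    using assms by (intro state_nonneg nonneg_norm_diff) auto
  moreover have "Im (\<phi> (rscale (cnorm A a) \<one> \<ominus> \<ominus> a)) = 0 \<and> 0 \<le> Re (\<phi> (rscale (cnorm A a) \<one> \<ominus> \<ominus> a))"
    using assms by (intro state_nonneg nonneg_norm_diff) auto
  ultimately show "Im (\<phi> a) = 0" "\<bar>Re (\<phi> a)\<bar> \<le> cnorm A a"
    using assms by (simp_all add: state_minus state_smult state_one neg_eq_smult abs_le_iff)
qed

text \<open>The factor 2 comes from estimating real and imaginary part separately. For compactness
  of the state space any bound that is uniform in the state will do.\<close>

lemma state_bound: "x \<in> carrier A \<Longrightarrow> cmod (\<phi> x) \<le> 2 * cnorm A x"
proof -
  assume x: "x \<in> carrier A"
  have "\<phi> x = \<phi> (re_part x) + \<i> * \<phi> (im_part x)"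
    using x by (subst re_im[OF x]) (simp add: state_add state_smult)
  moreover have "cmod (\<phi> a) \<le> cnorm A a" if "a \<in> sa" for a
    using state_sa[OF that] by (simp add: cmod_eq_Re)
  then have "cmod (\<phi> (re_part x)) \<le> cnorm A x" "cmod (\<phi> (im_part x)) \<le> cnorm A x"
    using cnorm_re_im[OF x] x by (meson order_trans re_part_sa im_part_sa)+
  ultimately show ?thesis
    using norm_triangle_ineq[of "\<phi> (re_part x)" "\<i> * \<phi> (im_part x)"] by (simp add: norm_mult)
qed

end

text \<open>Complexification: \<open>g\<close> is applied to real and imaginary part, and
  \<open>g 0 = 0\<close> makes the result real on self-adjoint elements. All states that are
  constructed rather than restricted arise here.\<close>

lemma state_extend:
  assumes add: "\<And>a b. a \<in> sa \<Longrightarrow> b \<in> sa \<Longrightarrow> g (a \<oplus> b) = g a + g b"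
    and scale: "\<And>r a. a \<in> sa \<Longrightarrow> g (rscale r a) = r * g a"
    and pos: "\<And>a. nonneg a \<Longrightarrow> 0 \<le> g a" and one: "g \<one> = (1::real)"
  shows "\<exists>\<phi>\<in>states. \<forall>a\<in>sa. \<phi> a = complex_of_real (g a)"
proof -
  define \<phi> where "\<phi> = (\<lambda>x\<in>carrier A. Complex (g (re_part x)) (g (im_part x)))"
  have g0: "g \<zero> = 0" using add[of "\<zero>" "\<zero>"] by simp
  have on_sa: "\<phi> a = complex_of_real (g a)" if "a \<in> sa" for a
    using that by (simp add: \<phi>_def re_im_of_sa g0 complex_of_real_def)
  have "\<phi> (x \<oplus> y) = \<phi> x + \<phi> y" if "x \<in> carrier A" "y \<in> carrier A" for x y
    using that by (simp add: \<phi>_def re_im_add add complex_eq_iff)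
  moreover have "\<phi> (c \<odot> x) = c * \<phi> x" if "x \<in> carrier A" for x c
    using that by (simp add: \<phi>_def re_im_smult add scale complex_eq_iff del: of_real_minus)
  moreover have "positive complex_cstar (\<phi> x)" if "nonneg x" for x
    using that on_sa[of x] pos by (simp add: positive_complex)
  moreover have "\<phi> \<in> carrier A \<rightarrow>\<^sub>E UNIV" by (simp add: \<phi>_def)
  ultimately have "\<phi> \<in> states" using on_sa[of \<one>] one by (simp add: pu_maps_def positive_iff)
  then show ?thesis using on_sa by blast
qed

lemma real_vec_sa: "real_vec sa (add A) rscale \<zero>"
  by unfold_locales (simp_all add: a_ac smult_dist smult_add)

text \<open>The functional \<open>p x\<close> is the infimum of all \<open>t\<close> with
  \<open>x\<close> below \<open>t\<close>, the top of the spectrum. A linear functional below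
  \<open>p\<close> is positive and unital. Hahn-Banach at \<open>-a\<close> gives one with
  \<open>f a = - p (-a)\<close>, and closedness of the cone makes this value negative.\<close>

lemma state_separation:
  assumes a: "a \<in> sa" and not: "\<not> nonneg a"
  shows "\<exists>\<phi>\<in>states. Re (\<phi> a) < 0"
proof -
  interpret rv: real_vec sa "add A" rscale "\<zero>" by (rule real_vec_sa)
  \<comment> \<open>In the zero algebra every element is in the cone and there are no states;
    \<open>p\<close> would not be bounded below.\<close>
  have ne: "\<one> \<noteq> \<zero>"
  proof
    assume "\<one> = \<zero>"
    then have "a = \<zero>" using a by (metis l_null l_one sa_carrier)
    then show False using not by simp
  qed
  define U where "U x = {t. nonneg (rscale t \<one> \<ominus> x)}" for x
  define p where "p x = Inf (U x)" for x
  \<comment> \<open>Adding \<open>norm x + x\<close> and \<open>t - x\<close> leaves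
    \<open>s\<close> times the unit. If \<open>s\<close> were negative, the cone would contain
    \<open>-1\<close> and properness would give \<open>1 = 0\<close>.\<close>
  have lower: "- cnorm A x \<le> t" if "x \<in> sa" "t \<in> U x" for x t
  proof (rule ccontr)
    assume "\<not> - cnorm A x \<le> t"
    define s where "s = t + cnorm A x"
    have neg: "s < 0" using \<open>\<not> - cnorm A x \<le> t\<close> by (simp add: s_def)
    have "nonneg (rscale (cnorm A x) \<one> \<ominus> \<ominus> x)" using that by (intro nonneg_norm_diff) auto
    then have "nonneg ((rscale (cnorm A x) \<one> \<ominus> \<ominus> x) \<oplus> (rscale t \<one> \<ominus> x))"
      using that by (intro nonneg_add) (auto simp: U_def)
    also have "(rscale (cnorm A x) \<one> \<ominus> \<ominus> x) \<oplus> (rscale t \<one> \<ominus> x) = rscale s \<one>"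
      using that by (simp add: calg s_def)
    finally have "nonneg (rscale s \<one>)" .
    then have "nonneg (rscale (- inverse s) (rscale s \<one>))"
      by (rule nonneg_scale) (use neg in simp)
    also have "rscale (- inverse s) (rscale s \<one>) = \<ominus> \<one>"
      using neg by (simp add: neg_eq_smult)
    finally have "nonneg (\<ominus> \<one>)" .
    then show False using nonneg_proper[of \<one>] ne by simp
  qed
  have bdd: "bdd_below (U x)" if "x \<in> sa" for x using lower[OF that] by (rule bdd_belowI)
  have norm_U: "cnorm A x \<in> U x" if "x \<in> sa" for x using nonneg_norm_diff[OF that] by (simp add: U_def)
  have p_le: "p x \<le> t" if "x \<in> sa" "nonneg (rscale t \<one> \<ominus> x)" for x t
    unfolding p_def using that bdd by (auto intro!: cInf_lower simp: U_def)
  have p_ge: "b \<le> p x" if "x \<in> sa" "\<And>t. nonneg (rscale t \<one> \<ominus> x) \<Longrightarrow> b \<le> t" for b x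
    unfolding p_def using that norm_U by (intro cInf_greatest) (auto simp: U_def)
  have sub: "rv.sublinear p"
  proof (rule rv.sublinearI)
    fix x y assume x: "x \<in> sa" and y: "y \<in> sa"
    have "p (x \<oplus> y) - s \<le> t" if "nonneg (rscale s \<one> \<ominus> x)" "nonneg (rscale t \<one> \<ominus> y)" for s t
    proof -
      have "(rscale s \<one> \<ominus> x) \<oplus> (rscale t \<one> \<ominus> y) = rscale (s + t) \<one> \<ominus> (x \<oplus> y)"
        using x y by (simp add: calg)
      then have "p (x \<oplus> y) \<le> s + t" using nonneg_add[OF that] x y by (intro p_le) auto
      then show ?thesis by simp
    qed
    then have "p (x \<oplus> y) - s \<le> p y" if "nonneg (rscale s \<one> \<ominus> x)" for s using that y by (intro p_ge) auto
    then have "p (x \<oplus> y) - p y \<le> p x" using x by (intro p_ge) (auto simp: algebra_simps)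
    then show "p (x \<oplus> y) \<le> p x + p y" by simp
  next
    fix r x assume r: "(0::real) < r" and x: "x \<in> sa"
    have "p (rscale r x) / r \<le> t" if "nonneg (rscale t \<one> \<ominus> x)" for t
    proof -
      have "rscale r (rscale t \<one> \<ominus> x) = rscale (r * t) \<one> \<ominus> rscale r x" using x by (simp add: calg)
      then have "p (rscale r x) \<le> r * t" using nonneg_scale[OF that, of r] r x by (intro p_le) auto
      then show ?thesis using r by (simp add: field_simps)
    qed
    then have "p (rscale r x) / r \<le> p x" using x by (intro p_ge) auto
    then show "p (rscale r x) \<le> r * p x" using r by (simp add: field_simps)
  next
    have "p \<zero> \<le> 0" by (intro p_le) (simp_all add: minus_eq)
    moreover have "0 \<le> p \<zero>" using lower[of "\<zero>"] by (intro p_ge) (auto simp: U_def)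
    ultimately show "p \<zero> = 0" by simp
  qed
  obtain f where f: "\<And>x y. x \<in> sa \<Longrightarrow> y \<in> sa \<Longrightarrow> f (x \<oplus> y) = f x + f y"
    "\<And>r x. x \<in> sa \<Longrightarrow> f (rscale r x) = r * f x" "\<And>x. x \<in> sa \<Longrightarrow> f x \<le> p x" "f (\<ominus> a) = p (\<ominus> a)"
    by (rule rv.hahn_banach[OF sub sa_neg[OF a]]) (rule that)
  have fneg: "f (\<ominus> x) = - f x" if "x \<in> sa" for x
    using f(2)[OF that, of "-1"] that by (simp add: neg_eq_smult)
  have pos: "0 \<le> f x" if "nonneg x" for x
  proof -
    have "p (\<ominus> x) \<le> 0" using that by (intro p_le) (simp_all add: minus_eq)
    then show ?thesis using f(3)[of "\<ominus> x"] fneg[of x] that by simp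
  qed
  have one: "f \<one> = 1"
  proof -
    \<comment> \<open>The two bounds confine \<open>f 1\<close> from above and from below.\<close>
    have "p \<one> \<le> 1" "p (\<ominus> \<one>) \<le> -1" by (intro p_le; simp add: calg)+
    then show ?thesis using f(3)[of \<one>] f(3)[of "\<ominus> \<one>"] fneg[of \<one>] by simp
  qed
  obtain \<phi> where \<phi>: "\<phi> \<in> states" "\<And>x. x \<in> sa \<Longrightarrow> \<phi> x = complex_of_real (f x)"
    using state_extend[OF f(1,2) pos one] by blast
  \<comment> \<open>Otherwise, for each \<open>e > 0\<close>, some \<open>t < e\<close> has
    \<open>t + a\<close> in the cone; then all \<open>a + e\<close> are in it, and closedness puts
    \<open>a\<close> there.\<close>
  have "\<not> p (\<ominus> a) \<le> 0"
  proof
    assume le: "p (\<ominus> a) \<le> 0"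
    have "nonneg (a \<oplus> rscale e \<one>)" if "0 < e" for e
    proof -
      have "\<exists>t\<in>U (\<ominus> a). t < e"
        using le that norm_U[of "\<ominus> a"] a cInf_lessD[of "U (\<ominus> a)" e] by (auto simp: p_def)
      then obtain t where t: "nonneg (rscale t \<one> \<ominus> \<ominus> a)" "t < e" by (auto simp: U_def)
      have "a \<oplus> rscale e \<one> = (rscale t \<one> \<ominus> \<ominus> a) \<oplus> rscale (e - t) \<one>" using a by (simp add: calg)
      then show ?thesis using t by (simp add: nonneg_add nonneg_scale del: of_real_diff)
    qed
    then show False using nonneg_closed[OF a] not by blast
  qed
  then have "f a < 0" using f(4) fneg[OF a] by simp
  then show ?thesis using \<phi> a by (intro bexI[of _ \<phi>]) auto
qed

lemma nonneg_iff_states: "a \<in> sa \<Longrightarrow> nonneg a \<longleftrightarrow> (\<forall>\<phi>\<in>states. 0 \<le> Re (\<phi> a))"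
  using state_separation state_nonneg by fastforce

text \<open>States detect the order, so bounds on all states become \<open>-t <= a <= t\<close>,
  which \<open>nonneg_sandwich\<close> turns into a norm bound.\<close>

lemma cnorm_le_states:
  assumes "a \<in> sa" "0 \<le> t" "\<And>\<phi>. \<phi> \<in> states \<Longrightarrow> \<bar>Re (\<phi> a)\<bar> \<le> t"
  shows "cnorm A a \<le> t"
proof (rule nonneg_sandwich)
  have "0 \<le> Re (\<phi> (rscale t \<one> \<ominus> a)) \<and> 0 \<le> Re (\<phi> (rscale t \<one> \<oplus> a))" if "\<phi> \<in> states" for \<phi>
    using assms(3)[OF that] assms(1) that by (simp add: state_minus state_add state_smult state_one abs_le_iff)
  then show "nonneg (rscale t \<one> \<ominus> a)" "nonneg (rscale t \<one> \<oplus> a)"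
    using assms(1) by (simp_all add: nonneg_iff_states)
qed (use assms in auto)

lemma states_eq_imp_eq:
  assumes "a \<in> sa" "b \<in> sa" "\<And>\<phi>. \<phi> \<in> states \<Longrightarrow> Re (\<phi> a) = Re (\<phi> b)"
  shows "a = b"
proof -
  have "cnorm A (a \<ominus> b) \<le> 0" using assms by (intro cnorm_le_states) (auto simp: state_minus)
  moreover have "0 \<le> cnorm A (a \<ominus> b)" using assms by simp
  ultimately have "cnorm A (a \<ominus> b) = 0" by (rule order_antisym)
  then have "a \<ominus> b = \<zero>" using assms cnorm_eq_0[of "a \<ominus> b"] by simp
  then show ?thesis by (rule minus_zero_imp_eq[rotated 2]) (use assms in simp_all)
qed

end


section \<open>The C*-algebra of continuous functions\<close>

lemma cring_complex: "cring complex_cstar"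
proof (rule cringI)
  show "abelian_group complex_cstar"
  proof (rule abelian_groupI)
    show "\<exists>y\<in>carrier complex_cstar. y \<oplus>\<^bsub>complex_cstar\<^esub> x = \<zero>\<^bsub>complex_cstar\<^esub>" for x
      by (simp add: exI[of _ "- x"])
  qed auto
  show "comm_monoid complex_cstar" by (rule comm_monoidI) auto
qed (auto simp: algebra_simps)

lemma continuous_map_euclidean_compose:
  "continuous_map X euclidean f \<Longrightarrow> continuous_on UNIV g \<Longrightarrow> continuous_map X euclidean (\<lambda>x. g (f x))"
  using continuous_map_compose[of X euclidean f euclidean g] by (simp add: o_def)

lemma continuous_map_mult:
  fixes f :: "'x \<Rightarrow> 'b::real_normed_algebra"
  shows "\<lbrakk>continuous_map X euclidean f; continuous_map X euclidean g\<rbrakk>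
    \<Longrightarrow> continuous_map X euclidean (\<lambda>x. f x * g x)"
  by (simp add: continuous_map_atin tendsto_mult)

lemma continuous_map_restrict:
  "continuous_map X Y f \<Longrightarrow> continuous_map X Y (restrict f (topspace X))"
  by (erule continuous_map_eq) simp

lemma ch_mapsI: "continuous_map X Y f \<Longrightarrow> restrict f (topspace X) \<in> ch_maps X Y"
  by (auto simp: ch_maps_def continuous_map_restrict dest: continuous_map_funspace)

lemma ch_mapsD: "f \<in> ch_maps X Y \<Longrightarrow> continuous_map X Y f"
  by (simp add: ch_maps_def)

lemma ch_maps_closed: "f \<in> ch_maps X Y \<Longrightarrow> x \<in> topspace X \<Longrightarrow> f x \<in> topspace Y"
  by (auto simp: ch_maps_def)

lemma ch_maps_restrict: "f \<in> ch_maps X Y \<Longrightarrow> restrict f (topspace X) = f"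
  by (auto simp: ch_maps_def PiE_def extensional_restrict)

lemma ch_maps_compose: "f \<in> ch_maps X Y \<Longrightarrow> g \<in> ch_maps Y Z \<Longrightarrow> compose (topspace X) g f \<in> ch_maps X Z"
  unfolding compose_def using ch_mapsI[OF continuous_map_compose[OF ch_mapsD ch_mapsD]] by (simp add: o_def)

lemma cfun_simps [simp]:
  "carrier (cfun X) = ch_maps X euclidean"
  "v \<otimes>\<^bsub>cfun X\<^esub> w = (\<lambda>x\<in>topspace X. v x * w x)" "\<one>\<^bsub>cfun X\<^esub> = (\<lambda>x\<in>topspace X. 1)"
  "v \<oplus>\<^bsub>cfun X\<^esub> w = (\<lambda>x\<in>topspace X. v x + w x)" "\<zero>\<^bsub>cfun X\<^esub> = (\<lambda>x\<in>topspace X. 0)"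
  "c \<odot>\<^bsub>cfun X\<^esub> v = (\<lambda>x\<in>topspace X. c * v x)" "star (cfun X) v = (\<lambda>x\<in>topspace X. cnj (v x))"
  by (simp_all add: cfun_def)

lemma cfun_closed [simp]:
  assumes "v \<in> ch_maps X euclidean" "w \<in> ch_maps X euclidean"
  shows "(\<lambda>x\<in>topspace X. v x * w x :: complex) \<in> ch_maps X euclidean"
    "(\<lambda>x\<in>topspace X. v x + w x) \<in> ch_maps X euclidean"
    "(\<lambda>x\<in>topspace X. cnj (v x)) \<in> ch_maps X euclidean"
  using assms by (auto intro!: ch_mapsI continuous_map_mult continuous_map_add
      continuous_map_euclidean_compose[where g = cnj] continuous_intros dest!: ch_mapsD)

lemma cfun_const [simp]: "(\<lambda>x\<in>topspace X. c :: complex) \<in> ch_maps X euclidean"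
  by (rule ch_mapsI) simp

lemma cfun_smult [simp]:
  "v \<in> ch_maps X euclidean \<Longrightarrow> (\<lambda>x\<in>topspace X. c * v x :: complex) \<in> ch_maps X euclidean"
  by (auto intro!: ch_mapsI continuous_map_mult dest!: ch_mapsD)

lemma cfun_uminus [simp]:
  "v \<in> ch_maps X euclidean \<Longrightarrow> (\<lambda>x\<in>topspace X. - v x :: complex) \<in> ch_maps X euclidean"
  using cfun_smult[of v X "-1"] by simp

lemma cfun_eqI:
  "v \<in> ch_maps X euclidean \<Longrightarrow> (\<And>x. x \<in> topspace X \<Longrightarrow> v x = f x) \<Longrightarrow> v = restrict f (topspace X)"
  by (metis ch_maps_restrict restrict_ext)

context
  fixes X :: "'x topology" assumes X: "ch_space X"
begin

lemma cfun_bounded: "v \<in> ch_maps X euclidean \<Longrightarrow> bdd_above (insert 0 ((\<lambda>x. cmod (v x)) ` topspace X))"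
proof -
  assume v: "v \<in> ch_maps X euclidean"
  have "compactin X (topspace X)" using X by (simp add: ch_space_def compact_space_def)
  then have "compactin euclidean (v ` topspace X)"
    using image_compactin ch_mapsD[OF v] by blast
  then have "bounded (v ` topspace X)" by (simp add: compact_imp_bounded)
  then obtain B where "\<forall>x\<in>topspace X. cmod (v x) \<le> B" by (auto simp: bounded_iff)
  then show ?thesis by (intro bdd_aboveI[where M = "max 0 B"]) (auto simp: le_max_iff_disj)
qed

lemma cfun_norm_upper:
  assumes "v \<in> ch_maps X euclidean"
  shows "x \<in> topspace X \<Longrightarrow> cmod (v x) \<le> cnorm (cfun X) v" "0 \<le> cnorm (cfun X) v"
  using cSup_upper[OF _ cfun_bounded[OF assms]] by (auto simp: cfun_def)

lemma cfun_norm_least: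
  "0 \<le> t \<Longrightarrow> (\<And>x. x \<in> topspace X \<Longrightarrow> cmod (v x) \<le> t) \<Longrightarrow> cnorm (cfun X) v \<le> t"
  unfolding cfun_def by (auto intro!: cSup_least)

lemma ring_cfun: "ring (cfun X)"
proof (rule ringI)
  show "abelian_group (cfun X)"
  proof (rule abelian_groupI)
    fix v assume v: "v \<in> carrier (cfun X)"
    show "\<exists>w\<in>carrier (cfun X). w \<oplus>\<^bsub>cfun X\<^esub> v = \<zero>\<^bsub>cfun X\<^esub>"
      by (rule bexI[of _ "(-1) \<odot>\<^bsub>cfun X\<^esub> v"]) (use v in \<open>auto intro!: restrict_ext\<close>)
  qed (auto simp: algebra_simps intro!: restrict_ext cfun_eqI[symmetric])
  show "monoid (cfun X)"
    by (rule monoidI) (auto simp: algebra_simps intro!: restrict_ext cfun_eqI[symmetric])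
qed (auto simp: algebra_simps intro!: restrict_ext)

lemma cfun_minus:
  assumes "v \<in> ch_maps X euclidean" "w \<in> ch_maps X euclidean"
  shows "v \<ominus>\<^bsub>cfun X\<^esub> w = (\<lambda>x\<in>topspace X. v x - w x)"
proof -
  interpret ring "cfun X" by (rule ring_cfun)
  have "\<ominus>\<^bsub>cfun X\<^esub> w = (-1) \<odot>\<^bsub>cfun X\<^esub> w"
    by (rule minus_equality) (use assms in \<open>auto intro!: restrict_ext\<close>)
  then show ?thesis by (auto simp: a_minus_def intro!: restrict_ext)
qed

lemma cfun_complete:
  fixes s :: "nat \<Rightarrow> 'x \<Rightarrow> complex"
  assumes s: "\<And>n. s n \<in> ch_maps X euclidean"
    and cau: "\<And>e. 0 < e \<Longrightarrow> \<exists>N. \<forall>m\<ge>N. \<forall>n\<ge>N. cnorm (cfun X) (s m \<ominus>\<^bsub>cfun X\<^esub> s n) < e"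
  shows "\<exists>l\<in>ch_maps X euclidean. (\<lambda>n. cnorm (cfun X) (s n \<ominus>\<^bsub>cfun X\<^esub> l)) \<longlonglongrightarrow> 0"
proof -
  interpret ring "cfun X" by (rule ring_cfun)
  have diff_le: "cmod (s m x - s n x) \<le> cnorm (cfun X) (s m \<ominus>\<^bsub>cfun X\<^esub> s n)" if "x \<in> topspace X" for m n x
    using cfun_norm_upper(1)[of "s m \<ominus>\<^bsub>cfun X\<^esub> s n" x] minus_closed[of "s m" "s n"] s that by (simp add: cfun_minus)
  define l where "l = (\<lambda>x\<in>topspace X. lim (\<lambda>n. s n x))"
  have lim: "(\<lambda>n. s n x) \<longlonglongrightarrow> l x" if x: "x \<in> topspace X" for x
  proof -
    have "Cauchy (\<lambda>n. s n x)"
    proof (rule CauchyI)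
      fix e :: real assume "0 < e"
      then obtain N where "\<forall>m\<ge>N. \<forall>n\<ge>N. cnorm (cfun X) (s m \<ominus>\<^bsub>cfun X\<^esub> s n) < e" using cau by blast
      then show "\<exists>M. \<forall>m\<ge>M. \<forall>n\<ge>M. norm (s m x - s n x) < e"
        using diff_le[OF x] by (meson le_less_trans)
    qed
    then show ?thesis using x by (simp add: l_def Cauchy_convergent convergent_LIMSEQ_iff[symmetric])
  qed
  \<comment> \<open>The limit in \<open>m\<close> leaves only a non-strict bound, so the uses below
    take \<open>e/2\<close>.\<close>
  have unif: "\<exists>N. \<forall>n\<ge>N. \<forall>x\<in>topspace X. cmod (s n x - l x) \<le> e" if e: "0 < e" for e
  proof -
    obtain N where N: "\<forall>m\<ge>N. \<forall>n\<ge>N. cnorm (cfun X) (s m \<ominus>\<^bsub>cfun X\<^esub> s n) < e" using cau[OF e] by blast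
    have "cmod (s n x - l x) \<le> e" if n: "n \<ge> N" and x: "x \<in> topspace X" for n x
    proof (rule tendsto_upperbound)
      show "(\<lambda>m. cmod (s n x - s m x)) \<longlonglongrightarrow> cmod (s n x - l x)"
        using lim[OF x] by (intro tendsto_intros)
      show "\<forall>\<^sub>F m in sequentially. cmod (s n x - s m x) \<le> e"
        unfolding eventually_sequentially using N n diff_le[OF x, of n] by (meson less_imp_le order_trans)
    qed simp
    then show ?thesis by blast
  qed
  have "continuous_map X Met_TC.mtopology l"
  proof (rule Met_TC.continuous_map_uniform_limit_alt[where f = s and F = sequentially])
    show "\<forall>\<^sub>F \<xi> in sequentially. continuous_map X Met_TC.mtopology (s \<xi>)"
      using ch_mapsD[OF s] by simp
    fix e :: real assume "0 < e"
    then obtain N where N: "\<forall>n\<ge>N. \<forall>x\<in>topspace X. cmod (s n x - l x) \<le> e/2" using unif[of "e/2"] by auto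
    have "cmod (s n x - l x) < e" if "n \<ge> N" "x \<in> topspace X" for n x
      using N that \<open>0 < e\<close> by fastforce
    then show "\<forall>\<^sub>F \<xi> in sequentially. \<forall>x\<in>topspace X. dist (s \<xi> x) (l x) < e"
      by (auto simp: dist_norm eventually_sequentially)
  qed auto
  then have "restrict l (topspace X) \<in> ch_maps X euclidean" by (intro ch_mapsI) simp
  then have l: "l \<in> ch_maps X euclidean" by (simp add: l_def)
  have "(\<lambda>n. cnorm (cfun X) (s n \<ominus>\<^bsub>cfun X\<^esub> l)) \<longlonglongrightarrow> 0"
  proof (rule LIMSEQ_I)
    fix e :: real assume "0 < e"
    then obtain N where N: "\<forall>n\<ge>N. \<forall>x\<in>topspace X. cmod (s n x - l x) \<le> e/2" using unif[of "e/2"] by auto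
    have "norm (cnorm (cfun X) (s n \<ominus>\<^bsub>cfun X\<^esub> l) - 0) < e" if "n \<ge> N" for n
    proof -
      have "cnorm (cfun X) (s n \<ominus>\<^bsub>cfun X\<^esub> l) \<le> e/2"
        using N that \<open>0 < e\<close> s l by (intro cfun_norm_least) (auto simp: cfun_minus)
      moreover have "0 \<le> cnorm (cfun X) (s n \<ominus>\<^bsub>cfun X\<^esub> l)"
        using minus_closed[of "s n" l] s l by (intro cfun_norm_upper(2)) simp
      ultimately show ?thesis using \<open>0 < e\<close> by simp
    qed
    then show "\<exists>N. \<forall>n\<ge>N. norm (cnorm (cfun X) (s n \<ominus>\<^bsub>cfun X\<^esub> l) - 0) < e" by blast
  qed
  with l show ?thesis by blast
qed

lemma cfun_cstar_identity:
  assumes v: "v \<in> ch_maps X euclidean"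
  shows "cnorm (cfun X) (\<lambda>x\<in>topspace X. cnj (v x) * v x) = (cnorm (cfun X) v)\<^sup>2"
proof (rule order_antisym)
  have sq: "cmod (cnj (v x) * v x) = (cmod (v x))\<^sup>2" for x by (simp add: norm_mult power2_eq_square)
  show "cnorm (cfun X) (\<lambda>x\<in>topspace X. cnj (v x) * v x) \<le> (cnorm (cfun X) v)\<^sup>2"
    using cfun_norm_upper[OF v] by (intro cfun_norm_least) (auto simp: norm_mult power2_eq_square intro!: mult_mono)
  have in_c: "(\<lambda>x\<in>topspace X. cnj (v x) * v x) \<in> ch_maps X euclidean"
    using v by (intro ch_mapsI continuous_map_mult continuous_map_euclidean_compose[where g = cnj] ch_mapsD[OF v])
       (auto intro: continuous_intros)
  have "cnorm (cfun X) v \<le> sqrt (cnorm (cfun X) (\<lambda>x\<in>topspace X. cnj (v x) * v x))"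
  proof (rule cfun_norm_least)
    fix x assume x: "x \<in> topspace X"
    have "(cmod (v x))\<^sup>2 \<le> cnorm (cfun X) (\<lambda>x\<in>topspace X. cnj (v x) * v x)"
      using cfun_norm_upper(1)[OF in_c x] x sq[of x] by simp
    then show "cmod (v x) \<le> sqrt (cnorm (cfun X) (\<lambda>x\<in>topspace X. cnj (v x) * v x))"
      by (rule real_le_rsqrt)
  qed (use cfun_norm_upper(2)[OF in_c] in simp)
  then show "(cnorm (cfun X) v)\<^sup>2 \<le> cnorm (cfun X) (\<lambda>x\<in>topspace X. cnj (v x) * v x)"
    using cfun_norm_upper(2)[OF in_c] cfun_norm_upper(2)[OF v]
    by (metis power_mono real_sqrt_pow2)
qed

lemma cfun_cstar: "cstar_algebra (cfun X)"
proof -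
  interpret ring "cfun X" by (rule ring_cfun)
  have mod: "module complex_cstar (cfun X)"
    by (rule moduleI) (auto simp: cring_complex is_abelian_group algebra_simps intro!: restrict_ext cfun_eqI[symmetric])
  show ?thesis
  proof (intro cstar_algebra.intro mod ring_cfun cstar_algebra_axioms.intro)
    fix v w :: "'x \<Rightarrow> complex" and c :: complex
    assume v: "v \<in> carrier (cfun X)"
    then have v': "v \<in> ch_maps X euclidean" by simp
    note nv = cfun_norm_upper[OF v']
    show "cnorm (cfun X) v = 0 \<longleftrightarrow> v = \<zero>\<^bsub>cfun X\<^esub>"
    proof
      assume "cnorm (cfun X) v = 0"
      then have "v x = 0" if "x \<in> topspace X" for x using nv(1)[OF that] by simp
      then show "v = \<zero>\<^bsub>cfun X\<^esub>" using cfun_eqI[OF v', of "\<lambda>_. 0"] by simp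
    next
      assume "v = \<zero>\<^bsub>cfun X\<^esub>"
      then have "cnorm (cfun X) v \<le> 0" by (intro cfun_norm_least) auto
      then show "cnorm (cfun X) v = 0" using nv(2) by simp
    qed
    show "cnorm (cfun X) (c \<odot>\<^bsub>cfun X\<^esub> v) = cmod c * cnorm (cfun X) v"
    proof (rule order_antisym)
      show le: "cnorm (cfun X) (c \<odot>\<^bsub>cfun X\<^esub> v) \<le> cmod c * cnorm (cfun X) v"
        using nv by (intro cfun_norm_least) (auto simp: norm_mult mult_left_mono)
      show "cmod c * cnorm (cfun X) v \<le> cnorm (cfun X) (c \<odot>\<^bsub>cfun X\<^esub> v)"
      proof (cases "c = 0")
        case True then show ?thesis using cfun_norm_upper(2)[OF cfun_smult[OF v', of c]] by simp
      next
        case False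
        have "cnorm (cfun X) v \<le> cnorm (cfun X) (c \<odot>\<^bsub>cfun X\<^esub> v) / cmod c"
        proof (rule cfun_norm_least)
          fix x assume x: "x \<in> topspace X"
          show "cmod (v x) \<le> cnorm (cfun X) (c \<odot>\<^bsub>cfun X\<^esub> v) / cmod c"
            using cfun_norm_upper(1)[OF cfun_smult[OF v', of c] x] False x
            by (simp add: norm_mult field_simps)
        qed (use cfun_norm_upper(2)[OF cfun_smult[OF v', of c]] in simp)
        then show ?thesis using False by (simp add: field_simps)
      qed
    qed
    show "cnorm (cfun X) (star (cfun X) v \<otimes>\<^bsub>cfun X\<^esub> v) = (cnorm (cfun X) v)\<^sup>2"
    proof -
      have "(\<lambda>x\<in>topspace X. (\<lambda>x\<in>topspace X. cnj (v x)) x * v x) = (\<lambda>x\<in>topspace X. cnj (v x) * v x)"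
        by (auto intro!: restrict_ext)
      then show ?thesis using cfun_cstar_identity[OF v'] by simp
    qed
    assume w: "w \<in> carrier (cfun X)"
    then have w': "w \<in> ch_maps X euclidean" by simp
    note nw = cfun_norm_upper[OF w']
    show "cnorm (cfun X) (v \<oplus>\<^bsub>cfun X\<^esub> w) \<le> cnorm (cfun X) v + cnorm (cfun X) w"
      using nv nw by (intro cfun_norm_least) (auto intro!: norm_triangle_le add_mono)
    show "cnorm (cfun X) (v \<otimes>\<^bsub>cfun X\<^esub> w) \<le> cnorm (cfun X) v * cnorm (cfun X) w"
      using nv nw by (intro cfun_norm_least) (auto simp: norm_mult intro!: mult_mono)
  next
    fix s :: "nat \<Rightarrow> 'x \<Rightarrow> complex"
    assume "\<And>n. s n \<in> carrier (cfun X)"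
      "\<And>e. 0 < e \<Longrightarrow> \<exists>N. \<forall>m\<ge>N. \<forall>n\<ge>N. cnorm (cfun X) (s m \<ominus>\<^bsub>cfun X\<^esub> s n) < e"
    then show "\<exists>l\<in>carrier (cfun X). (\<lambda>n. cnorm (cfun X) (s n \<ominus>\<^bsub>cfun X\<^esub> l)) \<longlonglongrightarrow> 0"
      using cfun_complete by simp
  qed (auto simp: cfun_norm_upper algebra_simps intro!: restrict_ext cfun_eqI[symmetric])
qed

end

lemma positive_cfun:
  "positive (cfun X) v \<longleftrightarrow> v \<in> ch_maps X euclidean \<and> (\<forall>x\<in>topspace X. Im (v x) = 0 \<and> 0 \<le> Re (v x))"
proof
  assume "positive (cfun X) v"
  then obtain y where y: "y \<in> ch_maps X euclidean" "v = star (cfun X) y \<otimes>\<^bsub>cfun X\<^esub> y"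
    unfolding positive_def cfun_simps(1) by blast
  have "star (cfun X) y \<in> ch_maps X euclidean" using y(1) by simp
  then have "v \<in> ch_maps X euclidean" unfolding y(2) cfun_simps(2) using y(1) by (rule cfun_closed(1))
  then show "v \<in> ch_maps X euclidean \<and> (\<forall>x\<in>topspace X. Im (v x) = 0 \<and> 0 \<le> Re (v x))"
    using y(2) by simp
next
  assume v: "v \<in> ch_maps X euclidean \<and> (\<forall>x\<in>topspace X. Im (v x) = 0 \<and> 0 \<le> Re (v x))"
  let ?y = "\<lambda>x\<in>topspace X. complex_of_real (sqrt (Re (v x)))"
  have "?y \<in> ch_maps X euclidean"
    using v by (intro ch_mapsI continuous_map_euclidean_compose[where g = "\<lambda>z. complex_of_real (sqrt (Re z))"])
      (auto intro!: continuous_intros dest: ch_mapsD)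
  moreover have "v = star (cfun X) ?y \<otimes>\<^bsub>cfun X\<^esub> ?y"
    using v by (auto simp: complex_eq_iff intro!: cfun_eqI)
  ultimately show "positive (cfun X) v" unfolding positive_def cfun_simps(1) by blast
qed


section \<open>Compactness of the state spaces\<close>

text \<open>Spaces of structure-preserving maps are cut out of a product by families of closed
  conditions on coordinates; \<open>I\<close> indexes the instances of one axiom.\<close>

lemma closedin_conditions:
  fixes g :: "'i \<Rightarrow> 't \<Rightarrow> 'c::t1_space"
  assumes "\<And>i. i \<in> I \<Longrightarrow> continuous_map T euclidean (g i)" "\<And>i. i \<in> I \<Longrightarrow> closed (C i)"
  shows "closedin T {f \<in> topspace T. \<forall>i\<in>I. g i f \<in> C i}"
proof -
  have eq: "{f \<in> topspace T. \<forall>i\<in>I. g i f \<in> C i} = \<Inter> (insert (topspace T) ((\<lambda>i. {f \<in> topspace T. g i f \<in> C i}) ` I))"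
    by auto
  show ?thesis unfolding eq
    using assms by (intro closedin_Inter) (auto intro!: closedin_continuous_map_preimage)
qed

text \<open>The Banach-Alaoglu pattern: a pointwise bounded closed set lies in a product of compact
  sets, which is compact by Tychonoff.\<close>

lemma compact_space_product_cube:
  assumes "\<And>i. i \<in> I \<Longrightarrow> compact (K i)"
    and "\<And>f i. f \<in> F \<Longrightarrow> i \<in> I \<Longrightarrow> f i \<in> K i"
    and "closedin (product_topology (\<lambda>_. euclidean) I) F"
  shows "ch_space (subtopology (product_topology (\<lambda>_. euclidean :: 'c::metric_space topology) I) F)"
proof -
  let ?T = "product_topology (\<lambda>_. euclidean :: 'c topology) I"
  have "compactin ?T (PiE I K)" using assms(1) by (simp add: compactin_PiE)
  moreover have "F \<subseteq> PiE I K"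
    using assms(2) closedin_subset[OF assms(3)] by (auto simp: PiE_iff subset_iff)
  ultimately have "compactin ?T F" using assms(3) by (rule closed_compactin)
  then have "compact_space (subtopology ?T F)" by (rule compact_space_subtopology)
  moreover have "Hausdorff_space ?T" by (simp add: Hausdorff_space_product_topology)
  then have "Hausdorff_space (subtopology ?T F)" by (rule Hausdorff_space_subtopology)
  ultimately show ?thesis by (simp add: ch_space_def)
qed

lemma topspace_stat [simp]: "topspace (stat A) = pu_maps A complex_cstar"
  by (auto simp: stat_def pu_maps_def)

lemma topspace_radon [simp]: "topspace (radon X) = pu_maps (cfun X) complex_cstar"
  by (simp add: radon_def)

lemma continuous_map_stat_eval:
  "a \<in> carrier A \<Longrightarrow> continuous_map (stat A) euclidean (\<lambda>\<phi>. \<phi> a)"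
  unfolding stat_def by (intro continuous_map_from_subtopology continuous_map_product_projection)

lemma continuous_map_into_stat:
  assumes "\<And>x. x \<in> topspace Y \<Longrightarrow> f x \<in> pu_maps A complex_cstar"
    and "\<And>a. a \<in> carrier A \<Longrightarrow> continuous_map Y euclidean (\<lambda>x. f x a)"
  shows "continuous_map Y (stat A) f"
  unfolding stat_def continuous_map_in_subtopology continuous_map_componentwise
  using assms by (auto simp: pu_maps_def PiE_iff)

context cstar_algebra
begin

text \<open>Coordinates lie in discs of radius \<open>2 * cnorm A i\<close> by
  \<open>state_bound\<close>. The sets \<open>1\<close> to \<open>4\<close> express additivity,
  homogeneity, positivity and unitality.\<close>

lemma ch_space_stat: "ch_space (stat A)"
  unfolding stat_def
proof (rule compact_space_product_cube)
  let ?T = "product_topology (\<lambda>_. euclidean :: complex topology) (carrier A)"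
  show "compact (cball (0::complex) (2 * cnorm A i))" for i by simp
  show "f i \<in> cball 0 (2 * cnorm A i)" if "f \<in> states" "i \<in> carrier A" for f i
    using state_bound[OF that] by simp
  have ev: "continuous_map ?T euclidean (\<lambda>f. f a)" if "a \<in> carrier A" for a
    using that by (rule continuous_map_product_projection)
  have 1: "closedin ?T {f \<in> topspace ?T. \<forall>i\<in>carrier A \<times> carrier A. f (fst i \<oplus> snd i) - f (fst i) - f (snd i) \<in> {0}}"
    by (intro closedin_conditions continuous_map_diff ev) auto
  have 2: "closedin ?T {f \<in> topspace ?T. \<forall>i\<in>UNIV \<times> carrier A. f (fst i \<odot> snd i) - fst i * f (snd i) \<in> {0}}"
    by (intro closedin_conditions continuous_map_diff continuous_map_mult ev) auto
  have 3: "closedin ?T {f \<in> topspace ?T. \<forall>x\<in>Collect nonneg. f x \<in> {z. Im z = 0 \<and> 0 \<le> Re z}}"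
    by (intro closedin_conditions ev closed_Collect_conj closed_Collect_eq closed_Collect_le)
      (auto intro: continuous_intros)
  have 4: "closedin ?T {f \<in> topspace ?T. \<forall>x\<in>{\<one>}. f x \<in> {1}}"
    by (intro closedin_conditions ev) auto
  have "states = {f \<in> topspace ?T. \<forall>i\<in>carrier A \<times> carrier A. f (fst i \<oplus> snd i) - f (fst i) - f (snd i) \<in> {0}} \<inter>
     {f \<in> topspace ?T. \<forall>i\<in>UNIV \<times> carrier A. f (fst i \<odot> snd i) - fst i * f (snd i) \<in> {0}} \<inter>
     {f \<in> topspace ?T. \<forall>x\<in>Collect nonneg. f x \<in> {z. Im z = 0 \<and> 0 \<le> Re z}} \<inter>
     {f \<in> topspace ?T. \<forall>x\<in>{\<one>}. f x \<in> {1}}"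
    by (auto simp: pu_maps_def positive_iff positive_complex algebra_simps)
  then show "closedin ?T states" using closedin_Int[OF closedin_Int[OF closedin_Int[OF 1 2] 3] 4] by simp
qed

end

lemma ch_space_radon: "ch_space X \<Longrightarrow> ch_space (radon X)"
  unfolding radon_def by (intro cstar_algebra.ch_space_stat cfun_cstar)


section \<open>Integrating real functions against a state\<close>

text \<open>Hides the passage from real to complex functions and back; \<open>mean_of_real\<close>
  shows that \<open>Re\<close> discards nothing when \<open>p\<close> is continuous.\<close>

definition mean :: "'x topology \<Rightarrow> (('x \<Rightarrow> complex) \<Rightarrow> complex) \<Rightarrow> ('x \<Rightarrow> real) \<Rightarrow> real" where
  "mean X h p = Re (h (cplx (topspace X) p))"

lemma cplx_closed [simp]:
  "continuous_map X euclideanreal p \<Longrightarrow> cplx (topspace X) p \<in> ch_maps X euclidean"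
  unfolding cplx_def
  by (intro ch_mapsI continuous_map_euclidean_compose[where g = complex_of_real]) (auto intro: continuous_intros)

lemma cplx_cong: "(\<And>x. x \<in> S \<Longrightarrow> p x = q x) \<Longrightarrow> cplx S p = cplx S q"
  by (auto simp: cplx_def intro: restrict_ext)

lemma mean_cong: "(\<And>x. x \<in> topspace X \<Longrightarrow> p x = q x) \<Longrightarrow> mean X h p = mean X h q"
  by (simp add: mean_def cong: cplx_cong)

context
  fixes X :: "'x topology" and h
  assumes X: "ch_space X" and h: "h \<in> pu_maps (cfun X) complex_cstar"
begin

lemma mean_of_real:
  assumes p: "continuous_map X euclideanreal p"
  shows "h (cplx (topspace X) p) = complex_of_real (mean X h p)"
proof -
  interpret C: cstar_algebra "cfun X" using X by (rule cfun_cstar)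
  have "cplx (topspace X) p \<in> C.sa"
  proof (rule C.saI)
    show "star (cfun X) (cplx (topspace X) p) = cplx (topspace X) p"
      by (auto simp: cplx_def intro!: restrict_ext)
  qed (use p in simp)
  then show ?thesis using C.state_sa(1)[OF h] by (simp add: mean_def complex_eq_iff)
qed

lemma mean_add:
  assumes "continuous_map X euclideanreal p" "continuous_map X euclideanreal q"
  shows "mean X h (\<lambda>x. p x + q x) = mean X h p + mean X h q"
proof -
  interpret C: cstar_algebra "cfun X" using X by (rule cfun_cstar)
  have "cplx (topspace X) (\<lambda>x. p x + q x) = cplx (topspace X) p \<oplus>\<^bsub>cfun X\<^esub> cplx (topspace X) q"
    by (auto simp: cplx_def intro!: restrict_ext)
  then show ?thesis using C.state_add[OF h, of "cplx (topspace X) p" "cplx (topspace X) q"] assms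
    by (simp add: mean_def)
qed

lemma mean_cmul:
  assumes "continuous_map X euclideanreal p"
  shows "mean X h (\<lambda>x. c * p x) = c * mean X h p"
proof -
  interpret C: cstar_algebra "cfun X" using X by (rule cfun_cstar)
  have "cplx (topspace X) (\<lambda>x. c * p x) = complex_of_real c \<odot>\<^bsub>cfun X\<^esub> cplx (topspace X) p"
    by (auto simp: cplx_def intro!: restrict_ext)
  then show ?thesis using C.state_smult[OF h, of "cplx (topspace X) p" "complex_of_real c"] assms
    by (simp add: mean_def)
qed

lemma mean_one: "mean X h (\<lambda>x. 1) = 1"
  using h by (simp add: mean_def cplx_def pu_maps_def)

lemma mean_const: "mean X h (\<lambda>x. c) = c"
  using mean_cmul[of "\<lambda>_. 1" c] mean_one by simp

lemma mean_diff:
  assumes "continuous_map X euclideanreal p" "continuous_map X euclideanreal q"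
  shows "mean X h (\<lambda>x. p x - q x) = mean X h p - mean X h q"
  using mean_add[of p "\<lambda>x. - 1 * q x"] mean_cmul[of q "-1"] assms by simp

lemma mean_nonneg:
  assumes "continuous_map X euclideanreal p" "\<And>x. x \<in> topspace X \<Longrightarrow> 0 \<le> p x"
  shows "0 \<le> mean X h p"
proof -
  have "positive (cfun X) (cplx (topspace X) p)"
    using assms by (simp add: positive_cfun) (simp add: cplx_def)
  then have "positive complex_cstar (h (cplx (topspace X) p))"
    using h assms(1) by (simp add: pu_maps_def)
  then show ?thesis by (simp add: positive_complex mean_def)
qed

lemma mean_mono:
  assumes "continuous_map X euclideanreal p" "continuous_map X euclideanreal q"
    "\<And>x. x \<in> topspace X \<Longrightarrow> p x \<le> q x"
  shows "mean X h p \<le> mean X h q"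
  using mean_nonneg[of "\<lambda>x. q x - p x"] mean_diff[of q p] assms by (simp add: continuous_map_diff)

lemma mean_unit_interval:
  assumes "continuous_map X euclideanreal p" "\<And>x. x \<in> topspace X \<Longrightarrow> p x \<in> {0..1}"
  shows "mean X h p \<in> {0..1}"
  using mean_nonneg[of p] mean_mono[of p "\<lambda>_. 1"] mean_one assms by simp

end


section \<open>Positive unital maps\<close>

lemma pu_mapsD:
  assumes "f \<in> pu_maps A B"
  shows "x \<in> carrier A \<Longrightarrow> f x \<in> carrier B"
    "x \<in> carrier A \<Longrightarrow> y \<in> carrier A \<Longrightarrow> f (x \<oplus>\<^bsub>A\<^esub> y) = f x \<oplus>\<^bsub>B\<^esub> f y"
    "x \<in> carrier A \<Longrightarrow> f (c \<odot>\<^bsub>A\<^esub> x) = c \<odot>\<^bsub>B\<^esub> f x"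
    "x \<in> carrier A \<Longrightarrow> positive A x \<Longrightarrow> positive B (f x)"
    "f \<one>\<^bsub>A\<^esub> = \<one>\<^bsub>B\<^esub>" "f \<in> extensional (carrier A)"
  using assms by (auto simp: pu_maps_def PiE_iff)

lemma pu_maps_eqI:
  "f \<in> pu_maps A B \<Longrightarrow> g \<in> pu_maps A C \<Longrightarrow> (\<And>x. x \<in> carrier A \<Longrightarrow> f x = g x) \<Longrightarrow> f = g"
  by (auto simp: pu_maps_def intro: PiE_ext)

lemma pu_maps_compose:
  assumes A: "cstar_algebra A" and f: "f \<in> pu_maps A B" and g: "g \<in> pu_maps B C"
  shows "compose (carrier A) g f \<in> pu_maps A C"
proof -
  interpret cstar_algebra A by fact
  show ?thesis using pu_mapsD[OF f] pu_mapsD[OF g] by (auto simp: pu_maps_def compose_def)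
qed

text \<open>The map \<open>C(Y) \<rightarrow> C(X)\<close> that a Kleisli map \<open>X \<rightarrow> \<R>(Y)\<close> amounts to.\<close>

definition kl_dual ::
    "'x topology \<Rightarrow> 'y topology \<Rightarrow> ('x \<Rightarrow> ('y \<Rightarrow> complex) \<Rightarrow> complex) \<Rightarrow> ('y \<Rightarrow> complex) \<Rightarrow> 'x \<Rightarrow> complex" where
  "kl_dual X Y f = (\<lambda>v\<in>ch_maps Y euclidean. \<lambda>x\<in>topspace X. f x v)"

text \<open>Evaluation at \<open>v\<close> is continuous on \<open>radon Y\<close>, so each image
  function is continuous. The algebraic laws hold at every \<open>x\<close> because
  \<open>f x\<close> is a state.\<close>

lemma kl_dual_pu:
  assumes Y: "ch_space Y" and f: "f \<in> ch_maps X (radon Y)"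
  shows "kl_dual X Y f \<in> pu_maps (cfun Y) (cfun X)"
proof -
  interpret Y: cstar_algebra "cfun Y" using Y by (rule cfun_cstar)
  have st: "f x \<in> pu_maps (cfun Y) complex_cstar" if "x \<in> topspace X" for x
    using ch_maps_closed[OF f that] by simp
  note d = pu_mapsD[OF st]
  have cont: "(\<lambda>x\<in>topspace X. f x v) \<in> ch_maps X euclidean" if "v \<in> ch_maps Y euclidean" for v
  proof -
    have "continuous_map X euclidean ((\<lambda>h. h v) \<circ> f)"
      using that by (intro continuous_map_compose[OF ch_mapsD[OF f]]) (simp add: radon_def continuous_map_stat_eval)
    then show ?thesis by (intro ch_mapsI) (simp add: o_def)
  qed
  have "kl_dual X Y f v \<in> ch_maps X euclidean" if "v \<in> ch_maps Y euclidean" for v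
    using cont[OF that] that by (simp add: kl_dual_def)
  moreover have "kl_dual X Y f (v \<oplus>\<^bsub>cfun Y\<^esub> w) = kl_dual X Y f v \<oplus>\<^bsub>cfun X\<^esub> kl_dual X Y f w"
    if "v \<in> ch_maps Y euclidean" "w \<in> ch_maps Y euclidean" for v w
    using that d(2)[of _ v w] by (auto simp: kl_dual_def intro!: restrict_ext)
  moreover have "kl_dual X Y f (c \<odot>\<^bsub>cfun Y\<^esub> v) = c \<odot>\<^bsub>cfun X\<^esub> kl_dual X Y f v"
    if "v \<in> ch_maps Y euclidean" for v c
    using that d(3)[of _ v c] by (auto simp: kl_dual_def intro!: restrict_ext)
  moreover have "positive (cfun X) (kl_dual X Y f v)" if "v \<in> ch_maps Y euclidean" "positive (cfun Y) v" for v
    using that d(4)[of _ v] cont by (simp add: positive_cfun[of X] kl_dual_def positive_complex)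
  moreover have "kl_dual X Y f \<one>\<^bsub>cfun Y\<^esub> = \<one>\<^bsub>cfun X\<^esub>"
    using d(5) by (auto simp: kl_dual_def intro!: restrict_ext)
  ultimately show ?thesis unfolding pu_maps_def cfun_simps(1) by (auto simp: kl_dual_def)
qed

text \<open>Precomposition with \<open>f\<close> as a positive unital map.
  \<open>radon_map_eq\<close> then exhibits \<open>radon_map\<close> as composition of positive
  unital maps, so that its closure needs no separate proof.\<close>

definition pullback :: "'x topology \<Rightarrow> 'y topology \<Rightarrow> ('x \<Rightarrow> 'y) \<Rightarrow> ('y \<Rightarrow> complex) \<Rightarrow> 'x \<Rightarrow> complex" where
  "pullback X Y f = (\<lambda>v\<in>ch_maps Y euclidean. compose (topspace X) v f)"

lemma pullback_pu:
  assumes f: "f \<in> ch_maps X Y"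
  shows "pullback X Y f \<in> pu_maps (cfun Y) (cfun X)"
proof -
  have "compose (topspace X) v f \<in> ch_maps X euclidean" if "v \<in> ch_maps Y euclidean" for v
    using ch_maps_compose[OF f that] .
  then show ?thesis using ch_maps_closed[OF f]
    by (auto simp: pu_maps_def pullback_def positive_cfun compose_def PiE_iff intro!: restrict_ext)
qed

lemma radon_map_eq:
  "h \<in> pu_maps (cfun X) complex_cstar \<Longrightarrow> radon_map X Y f h = compose (ch_maps Y euclidean) h (pullback X Y f)"
  by (auto simp: radon_map_def compose_def pullback_def intro!: restrict_ext)

lemma radon_map_closed:
  assumes "ch_space Y" "f \<in> ch_maps X Y" "h \<in> pu_maps (cfun X) complex_cstar"
  shows "radon_map X Y f h \<in> pu_maps (cfun Y) complex_cstar"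
  using pu_maps_compose[OF cfun_cstar[OF assms(1)] pullback_pu[OF assms(2)] assms(3)] assms(3)
  by (simp add: radon_map_eq)

lemma radon_map_compose:
  assumes "ch_space Y" "f \<in> ch_maps X Y" "g \<in> ch_maps Y Z" "h \<in> pu_maps (cfun X) complex_cstar"
  shows "radon_map X Z (compose (topspace X) g f) h = radon_map Y Z g (radon_map X Y f h)"
  using radon_map_closed[OF assms(1,2,4)] assms(4) ch_maps_closed[OF assms(2)] ch_maps_compose[OF assms(3), of _ "euclidean :: complex topology"]
  by (auto simp: radon_map_def compose_def intro!: restrict_ext arg_cong[where f = h])

lemma radon_map_id:
  assumes "h \<in> pu_maps (cfun X) complex_cstar"
  shows "radon_map X X (\<lambda>x\<in>topspace X. x) h = h"
proof -
  have "radon_map X X (\<lambda>x\<in>topspace X. x) h = restrict h (ch_maps X euclidean)"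
    using assms by (auto simp: radon_map_def compose_def intro!: restrict_ext arg_cong[where f = h] cfun_eqI[symmetric])
  then show ?thesis using pu_mapsD(6)[OF assms] by (simp add: extensional_restrict)
qed

lemma mean_radon_map:
  assumes h: "h \<in> pu_maps (cfun X) complex_cstar" and f: "f \<in> ch_maps X Y"
    and q: "continuous_map Y euclideanreal q"
  shows "mean Y (radon_map X Y f h) q = mean X h (\<lambda>x. q (f x))"
proof -
  have "compose (topspace X) (cplx (topspace Y) q) f = cplx (topspace X) (\<lambda>x. q (f x))"
    using ch_maps_closed[OF f] by (auto simp: compose_def cplx_def intro!: restrict_ext)
  then show ?thesis using h q by (simp add: mean_def radon_map_def)
qed

lemma radon_eta_closed:
  "ch_space X \<Longrightarrow> x \<in> topspace X \<Longrightarrow> radon_eta X x \<in> pu_maps (cfun X) complex_cstar"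
  by (auto simp: radon_eta_def pu_maps_def positive_cfun positive_complex)

lemma radon_eta_ch: "ch_space X \<Longrightarrow> radon_eta X \<in> ch_maps X (radon X)"
proof -
  assume X: "ch_space X"
  have "continuous_map X (stat (cfun X)) (radon_eta X)"
  proof (rule continuous_map_into_stat)
    fix v assume v: "v \<in> carrier (cfun X)"
    have "continuous_map X euclidean v" using v by (simp add: ch_mapsD)
    then show "continuous_map X euclidean (\<lambda>x. radon_eta X x v)"
      by (rule continuous_map_eq) (use v in \<open>simp add: radon_eta_def\<close>)
  qed (rule radon_eta_closed[OF X])
  then show ?thesis using ch_mapsI[of X "radon X" "radon_eta X"]
    by (simp add: radon_def) (simp add: radon_eta_def)
qed

lemma mean_eta:
  "x \<in> topspace X \<Longrightarrow> continuous_map X euclideanreal p \<Longrightarrow> mean X (radon_eta X x) p = p x"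
  by (simp add: mean_def radon_eta_def) (simp add: cplx_def)

section \<open>Barycentres and the Radon algebra of states\<close>

lemma eval_closed:
  "a \<in> carrier A \<Longrightarrow> (\<lambda>\<phi>\<in>pu_maps A complex_cstar. \<phi> a) \<in> ch_maps (stat A) euclidean"
  using ch_mapsI[OF continuous_map_stat_eval] by simp

text \<open>Kadison's function representation. It is positive and unital but in general not
  multiplicative, and composing a state of C(Stat A) with it is taking the barycentre.\<close>

definition gelfand :: "'a cstar \<Rightarrow> 'a \<Rightarrow> ('a \<Rightarrow> complex) \<Rightarrow> complex" where
  "gelfand A = (\<lambda>a\<in>carrier A. \<lambda>\<phi>\<in>pu_maps A complex_cstar. \<phi> a)"

lemma gelfand_pu:
  assumes "cstar_algebra A" shows "gelfand A \<in> pu_maps A (cfun (stat A))"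
proof -
  interpret cstar_algebra A by fact
  have "gelfand A a \<in> ch_maps (stat A) euclidean" if "a \<in> carrier A" for a
    using eval_closed that by (simp add: gelfand_def)
  moreover have "positive (cfun (stat A)) (gelfand A a)" if "a \<in> carrier A" "positive A a" for a
    using that eval_closed[of a A] state_nonneg by (simp add: positive_cfun gelfand_def positive_iff)
  ultimately show ?thesis
    unfolding pu_maps_def[of A "cfun (stat A)"] by (auto simp: gelfand_def state_add state_smult state_one intro!: restrict_ext)
qed

definition barycentre :: "'a cstar \<Rightarrow> ((('a \<Rightarrow> complex) \<Rightarrow> complex) \<Rightarrow> complex) \<Rightarrow> 'a \<Rightarrow> complex" where
  "barycentre A \<omega> = (\<lambda>a\<in>carrier A. \<omega> (\<lambda>\<phi>\<in>pu_maps A complex_cstar. \<phi> a))"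

lemma barycentre_closed:
  assumes "cstar_algebra A" "\<omega> \<in> pu_maps (cfun (stat A)) complex_cstar"
  shows "barycentre A \<omega> \<in> pu_maps A complex_cstar"
proof -
  have "barycentre A \<omega> = compose (carrier A) \<omega> (gelfand A)"
    by (auto simp: barycentre_def compose_def gelfand_def intro!: restrict_ext)
  then show ?thesis using pu_maps_compose[OF assms(1) gelfand_pu[OF assms(1)] assms(2)] by simp
qed

lemma act_stat_alg: "act (stat_alg A) = (\<lambda>\<omega>\<in>pu_maps (cfun (stat A)) complex_cstar. barycentre A \<omega>)"
  and space_stat_alg [simp]: "alg_space (stat_alg A) = stat A"
  by (simp_all add: stat_alg_def barycentre_def)

lemma barycentre_continuous:
  assumes "cstar_algebra A"
  shows "continuous_map (radon (stat A)) (stat A) (barycentre A)"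
proof (rule continuous_map_into_stat)
  show "barycentre A x \<in> pu_maps A complex_cstar" if "x \<in> topspace (radon (stat A))" for x
    using barycentre_closed[OF assms] that by simp
  fix a assume a: "a \<in> carrier A"
  then have "continuous_map (radon (stat A)) euclidean (\<lambda>\<omega>. \<omega> (\<lambda>\<phi>\<in>pu_maps A complex_cstar. \<phi> a))"
    unfolding radon_def by (intro continuous_map_stat_eval) (simp add: eval_closed)
  then show "continuous_map (radon (stat A)) euclidean (\<lambda>\<omega>. barycentre A \<omega> a)"
    using a by (simp add: barycentre_def)
qed

lemma radon_mu_eq:
  "g \<in> pu_maps (cfun (radon X)) complex_cstar \<Longrightarrow> radon_mu X g = barycentre (cfun X) g"
  by (simp add: radon_mu_def barycentre_def)

lemma radon_mu_closed:
  assumes X: "ch_space X" and g: "g \<in> pu_maps (cfun (radon X)) complex_cstar"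
  shows "radon_mu X g \<in> pu_maps (cfun X) complex_cstar"
  unfolding radon_mu_eq[OF g] by (rule barycentre_closed[OF cfun_cstar[OF X] g[unfolded radon_def]])

text \<open>States are compared at each \<open>a\<close>, where the action evaluates a functional at
  the coordinate function of \<open>a\<close>; both laws then concern single coordinate
  functions.\<close>

lemma radon_algebra_stat:
  assumes A: "cstar_algebra A"
  shows "radon_algebra (stat_alg A)"
proof
  show ch: "ch_space (alg_space (stat_alg A))" using cstar_algebra.ch_space_stat[OF A] by simp
  show act: "act (stat_alg A) \<in> ch_maps (radon (alg_space (stat_alg A))) (alg_space (stat_alg A))"
    using ch_mapsI[OF barycentre_continuous[OF A]] by (simp add: act_stat_alg)
  show "act (stat_alg A) (radon_eta (alg_space (stat_alg A)) \<phi>) = \<phi>" if "\<phi> \<in> points (stat_alg A)" for \<phi>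
  proof -
    have \<phi>: "\<phi> \<in> pu_maps A complex_cstar" using that by simp
    have "barycentre A (radon_eta (stat A) \<phi>) = \<phi>"
      using that ch by (intro pu_maps_eqI[OF barycentre_closed[OF A radon_eta_closed] \<phi>])
        (simp_all add: barycentre_def radon_eta_def eval_closed)
    then show ?thesis using radon_eta_closed[of "stat A" \<phi>] ch that by (simp add: act_stat_alg)
  qed
  fix g assume g: "g \<in> topspace (radon (radon (alg_space (stat_alg A))))"
  let ?X = "stat A"
  have g': "g \<in> pu_maps (cfun (radon ?X)) complex_cstar" using g by simp
  have mu: "radon_mu ?X g \<in> pu_maps (cfun ?X) complex_cstar"
    using ch g' by (intro radon_mu_closed) simp_all
  have rm: "radon_map (radon ?X) ?X (act (stat_alg A)) g \<in> pu_maps (cfun ?X) complex_cstar"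
    using ch act by (intro radon_map_closed g') simp_all
  show "act (stat_alg A) (radon_mu (alg_space (stat_alg A)) g) =
      act (stat_alg A) (radon_map (radon (alg_space (stat_alg A))) (alg_space (stat_alg A)) (act (stat_alg A)) g)"
  proof -
    have "barycentre A (radon_mu ?X g) a = barycentre A (radon_map (radon ?X) ?X (act (stat_alg A)) g) a"
      if a: "a \<in> carrier A" for a
    proof -
      let ?ev = "\<lambda>\<phi>\<in>pu_maps A complex_cstar. \<phi> a"
      \<comment> \<open>The coordinate function of \<open>a\<close>, pulled back along the action,
        is evaluation of functionals at that coordinate function. Both sides of the associativity
        law apply \<open>g\<close> to it.\<close>
      have "compose (topspace (radon ?X)) ?ev (act (stat_alg A)) = (\<lambda>h\<in>topspace (radon ?X). h ?ev)"
        unfolding compose_def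
      proof (rule restrict_ext)
        fix h assume "h \<in> topspace (radon ?X)"
        then have h: "h \<in> pu_maps (cfun ?X) complex_cstar" by simp
        have "act (stat_alg A) h = barycentre A h" using h by (simp only: act_stat_alg restrict_apply if_True)
        moreover have "?ev (barycentre A h) = barycentre A h a"
          using barycentre_closed[OF A h] by (simp only: restrict_apply if_True)
        moreover have "barycentre A h a = h ?ev" using a by (simp only: barycentre_def restrict_apply if_True)
        ultimately show "?ev (act (stat_alg A) h) = h ?ev" by (simp only:)
      qed
      then show ?thesis using a g' eval_closed[OF a]
        by (simp add: barycentre_def[of A] radon_mu_def radon_map_def)
    qed
    then have "barycentre A (radon_mu ?X g) = barycentre A (radon_map (radon ?X) ?X (act (stat_alg A)) g)"
      by (rule pu_maps_eqI[OF barycentre_closed[OF A mu] barycentre_closed[OF A rm]])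
    then show ?thesis using mu rm by (simp add: act_stat_alg)
  qed
qed

lemma comparison_eq: "comparison X = stat_alg (cfun X)"
  by (simp add: comparison_def stat_alg_def radon_mu_def radon_def)

section \<open>Morphisms of Radon algebras\<close>

lemma act_closed: "radon_algebra P \<Longrightarrow> h \<in> pu_maps (cfun (alg_space P)) complex_cstar \<Longrightarrow> act P h \<in> points P"
  using ch_maps_closed[OF radon_algebra.act_map] by fastforce

lemma em_mapsD:
  assumes "f \<in> em_maps P Q"
  shows "f \<in> ch_maps (alg_space P) (alg_space Q)" "x \<in> points P \<Longrightarrow> f x \<in> points Q"
    "h \<in> pu_maps (cfun (alg_space P)) complex_cstar \<Longrightarrow> f (act P h) = act Q (radon_map (alg_space P) (alg_space Q) f h)"
  using assms ch_maps_closed by (auto simp: em_maps_def)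

lemma em_maps_compose:
  assumes P: "radon_algebra P" and Q: "ch_space (alg_space Q)" and f: "f \<in> em_maps P Q" and g: "g \<in> em_maps Q R"
  shows "compose (points P) g f \<in> em_maps P R"
  unfolding em_maps_def
proof (clarify, intro conjI ballI)
  show "compose (points P) g f \<in> ch_maps (alg_space P) (alg_space R)"
    using em_mapsD(1)[OF f] em_mapsD(1)[OF g] by (rule ch_maps_compose)
  fix h assume "h \<in> topspace (radon (alg_space P))"
  then have h: "h \<in> pu_maps (cfun (alg_space P)) complex_cstar" by simp
  show "compose (points P) g f (act P h) = act R (radon_map (alg_space P) (alg_space R) (compose (points P) g f) h)"
    using em_mapsD[OF f] em_mapsD[OF g] act_closed[OF P h] h radon_map_closed[OF Q em_mapsD(1)[OF f] h]
      radon_map_compose[OF Q em_mapsD(1)[OF f] em_mapsD(1)[OF g] h]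
    by (simp add: compose_eq)
qed

text \<open>The inverse of a continuous bijection of compact Hausdorff spaces is continuous, and the
  inverse of a bijective algebra map is an algebra map.\<close>

lemma em_isoI:
  assumes P: "radon_algebra P" and Q: "radon_algebra Q"
    and f: "f \<in> em_maps P Q" and bij: "bij_betw f (points P) (points Q)"
  shows "em_iso P Q f"
proof -
  define g where "g = (\<lambda>y\<in>points Q. inv_into (points P) f y)"
  note fD = em_mapsD[OF f]
  have chP: "ch_space (alg_space P)" and chQ: "ch_space (alg_space Q)"
    using P Q by (simp_all add: radon_algebra.ch_space)
  have gf: "g (f x) = x" if "x \<in> points P" for x
    using that bij fD(2) by (simp add: g_def bij_betw_inv_into_left)
  have fg: "f (g y) = y" and gP: "g y \<in> points P" if "y \<in> points Q" for y
    using that bij bij_betw_imp_surj_on[OF bij] by (auto simp: g_def bij_betw_inv_into_right inv_into_into)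
  have "homeomorphic_map (alg_space P) (alg_space Q) f"
    using chP chQ ch_mapsD[OF fD(1)] bij unfolding ch_space_def
    by (intro continuous_imp_homeomorphic_map) (auto simp: bij_betw_def)
  then obtain g' where g': "homeomorphic_maps (alg_space P) (alg_space Q) f g'"
    by (auto simp: homeomorphic_map_maps)
  have "continuous_map (alg_space Q) (alg_space P) g"
  proof (rule continuous_map_eq)
    show cg': "continuous_map (alg_space Q) (alg_space P) g'" using g' by (simp add: homeomorphic_maps_def)
    show "g' y = g y" if "y \<in> points Q" for y
    proof -
      have "g' y \<in> points P" using cg' that by (auto dest: continuous_map_funspace)
      moreover have "f (g' y) = y" using g' that by (simp add: homeomorphic_maps_def)
      ultimately show ?thesis using gf by metis
    qed
  qed
  then have gch: "g \<in> ch_maps (alg_space Q) (alg_space P)"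
    using gP by (auto simp: ch_maps_def g_def)
  have fgid: "compose (points Q) f g = (\<lambda>y\<in>points Q. y)" and gfid: "compose (points P) g f = (\<lambda>x\<in>points P. x)"
    using fg gf by (auto simp: compose_def intro!: restrict_ext)
  have "g (act Q h) = act P (radon_map (alg_space Q) (alg_space P) g h)"
    if h: "h \<in> pu_maps (cfun (alg_space Q)) complex_cstar" for h
  proof -
    have k: "radon_map (alg_space Q) (alg_space P) g h \<in> pu_maps (cfun (alg_space P)) complex_cstar"
      using chP gch h by (rule radon_map_closed)
    have "f (act P (radon_map (alg_space Q) (alg_space P) g h)) = act Q h"
      using fD(3)[OF k] radon_map_compose[OF chP gch fD(1) h] fgid radon_map_id[OF h] by simp
    then show ?thesis using gf[OF act_closed[OF P k]] by simp
  qed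
  then have "g \<in> em_maps Q P" using gch by (simp add: em_maps_def)
  then show ?thesis using f fgid gfid by (auto simp: em_iso_def)
qed


section \<open>Effect modules and Radon algebras\<close>

lemma pointwise_simps [simp]:
  "carrier (pointwise_emod S H) = H" "ezero (pointwise_emod S H) = (\<lambda>x\<in>S. 0)"
  "eplus (pointwise_emod S H) p q = (if \<forall>x\<in>S. p x + q x \<le> 1 then Some (\<lambda>x\<in>S. p x + q x) else None)"
  "eorth (pointwise_emod S H) p = (\<lambda>x\<in>S. 1 - p x)" "escale (pointwise_emod S H) r p = (\<lambda>x\<in>S. r * p x)"
  "eone (pointwise_emod S H) = (\<lambda>x\<in>S. 1)"
  by (simp_all add: pointwise_emod_def eone_def cong: restrict_cong)

text \<open>Reduces the effect modules of predicates, \<open>cont_pred\<close> and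
  \<open>alg_dual\<close>, to closure of a set of functions under the operations.\<close>

lemma effect_module_pointwise:
  assumes H: "\<And>p. p \<in> H \<Longrightarrow> p \<in> S \<rightarrow>\<^sub>E {0..1::real}"
    and zero: "(\<lambda>x\<in>S. 0) \<in> H"
    and orth: "\<And>p. p \<in> H \<Longrightarrow> (\<lambda>x\<in>S. 1 - p x) \<in> H"
    and plus: "\<And>p q. p \<in> H \<Longrightarrow> q \<in> H \<Longrightarrow> \<forall>x\<in>S. p x + q x \<le> 1 \<Longrightarrow> (\<lambda>x\<in>S. p x + q x) \<in> H"
    and scale: "\<And>r p. r \<in> {0..1} \<Longrightarrow> p \<in> H \<Longrightarrow> (\<lambda>x\<in>S. r * p x) \<in> H"
  shows "effect_module (pointwise_emod S H)"
proof -
  have rng: "0 \<le> p x" "p x \<le> 1" if "p \<in> H" "x \<in> S" for p x using H[OF that(1)] that(2) by (auto simp: PiE_iff)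
  have ext: "p = q" if "p \<in> H" "\<And>x. x \<in> S \<Longrightarrow> p x = q x" "q \<in> extensional S" for p q
    using H[OF that(1)] that by (auto simp: PiE_iff intro: extensionalityI)
  show ?thesis
  proof (intro effect_module.intro effect_algebra.intro effect_module_axioms.intro; simp only: pointwise_simps)
    fix p q r assume p: "p \<in> H" and q: "q \<in> H"
    show "(if \<forall>x\<in>S. p x + q x \<le> 1 then Some (\<lambda>x\<in>S. p x + q x) else None)
       = (if \<forall>x\<in>S. q x + p x \<le> 1 then Some (\<lambda>x\<in>S. q x + p x) else None)"
      by (simp add: add.commute)
    show "((if \<forall>x\<in>S. p x + q x \<le> 1 then Some (\<lambda>x\<in>S. p x + q x) else None) = Some (\<lambda>x\<in>S. 1))
        = (q = (\<lambda>x\<in>S. 1 - p x))" (is "?l = ?r")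
    proof
      assume l: ?l
      then have eq: "(\<lambda>x\<in>S. p x + q x) = (\<lambda>x\<in>S. 1)" by (simp split: if_splits)
      have "q x = (\<lambda>x\<in>S. 1 - p x) x" if "x \<in> S" for x
        using fun_cong[OF eq, of x] that by simp
      then show ?r by (intro ext[OF q]) simp_all
    next
      assume r: ?r then show ?l by (auto intro!: restrict_ext)
    qed
    assume r: "r \<in> H"
    \<comment> \<open>Both bracketings reduce to one conditional triple sum: where the total is at
      most 1 so is each partial sum, the remaining summand being nonnegative.\<close>
    have "Option.bind (if \<forall>x\<in>S. p x + q x \<le> 1 then Some (\<lambda>x\<in>S. p x + q x) else None)
         (\<lambda>s. if \<forall>x\<in>S. s x + r x \<le> 1 then Some (\<lambda>x\<in>S. s x + r x) else None)
       = (if \<forall>x\<in>S. p x + q x + r x \<le> 1 then Some (\<lambda>x\<in>S. p x + q x + r x) else None)"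
      using rng(1)[OF r] by (auto intro!: restrict_ext) (metis add_increasing2 add_le_cancel_left order_trans le_add_same_cancel1)
    moreover have "Option.bind (if \<forall>x\<in>S. q x + r x \<le> 1 then Some (\<lambda>x\<in>S. q x + r x) else None)
         (\<lambda>t. if \<forall>x\<in>S. p x + t x \<le> 1 then Some (\<lambda>x\<in>S. p x + t x) else None)
       = (if \<forall>x\<in>S. p x + q x + r x \<le> 1 then Some (\<lambda>x\<in>S. p x + q x + r x) else None)"
      using rng(1)[OF p] by (auto simp: add.assoc intro!: restrict_ext) (metis le_add_same_cancel2 order_trans)
    ultimately show "Option.bind (if \<forall>x\<in>S. p x + q x \<le> 1 then Some (\<lambda>x\<in>S. p x + q x) else None)
         (\<lambda>s. if \<forall>x\<in>S. s x + r x \<le> 1 then Some (\<lambda>x\<in>S. s x + r x) else None)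
       = Option.bind (if \<forall>x\<in>S. q x + r x \<le> 1 then Some (\<lambda>x\<in>S. q x + r x) else None)
         (\<lambda>t. if \<forall>x\<in>S. p x + t x \<le> 1 then Some (\<lambda>x\<in>S. p x + t x) else None)" by simp
  next
    fix p assume p: "p \<in> H" and "(if \<forall>x\<in>S. p x + (\<lambda>x\<in>S. 1) x \<le> 1 then Some (\<lambda>x\<in>S. p x + (\<lambda>x\<in>S. 1) x) else None) \<noteq> None"
    then have "\<forall>x\<in>S. p x + 1 \<le> 1" by (auto split: if_splits)
    then have "p x = 0" if "x \<in> S" for x using rng(1)[OF p that] that by (simp add: order_antisym)
    then show "p = (\<lambda>x\<in>S. 0)" by (intro ext[OF p]) simp_all
  next
    fix p assume p: "p \<in> H"
    have "(\<lambda>x\<in>S. (\<lambda>x\<in>S. 0) x + p x) = p" by (rule ext[OF p, symmetric]) simp_all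
    then show "(if \<forall>x\<in>S. (\<lambda>x\<in>S. 0) x + p x \<le> 1 then Some (\<lambda>x\<in>S. (\<lambda>x\<in>S. 0) x + p x) else None) = Some p"
      using rng(2)[OF p] by simp
    show "(\<lambda>x\<in>S. 1 * p x) = p" by (rule ext[OF p, symmetric]) simp_all
    fix r s :: real assume rs: "r \<in> {0..1}" "s \<in> {0..1}" "r + s \<le> 1"
    have "r * p x + s * p x \<le> 1" if "x \<in> S" for x
      using rng[OF p that] rs mult_mono[of "r + s" 1 "p x" 1] by (simp add: algebra_simps)
    then show "(if \<forall>x\<in>S. (\<lambda>x\<in>S. r * p x) x + (\<lambda>x\<in>S. s * p x) x \<le> 1
        then Some (\<lambda>x\<in>S. (\<lambda>x\<in>S. r * p x) x + (\<lambda>x\<in>S. s * p x) x) else None) = Some (\<lambda>x\<in>S. (r + s) * p x)"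
      by (auto simp: algebra_simps intro!: restrict_ext)
  next
    fix r p q z assume r: "r \<in> {0..1::real}" and p: "p \<in> H" and q: "q \<in> H"
      and z: "(if \<forall>x\<in>S. p x + q x \<le> 1 then Some (\<lambda>x\<in>S. p x + q x) else None) = Some z"
    have le: "\<forall>x\<in>S. p x + q x \<le> 1" and zeq: "z = (\<lambda>x\<in>S. p x + q x)" using z by (auto split: if_splits)
    have "r * p x + r * q x \<le> 1" if "x \<in> S" for x
      using le that r mult_mono[of r 1 "p x + q x" 1] rng(1)[OF p that] rng(1)[OF q that] by (simp add: algebra_simps)
    then show "(if \<forall>x\<in>S. (\<lambda>x\<in>S. r * p x) x + (\<lambda>x\<in>S. r * q x) x \<le> 1
        then Some (\<lambda>x\<in>S. (\<lambda>x\<in>S. r * p x) x + (\<lambda>x\<in>S. r * q x) x) else None) = Some (\<lambda>x\<in>S. r * z x)"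
      by (auto simp: algebra_simps zeq intro!: restrict_ext)
  qed (use zero orth plus scale in \<open>auto simp: mult.assoc split: if_splits intro!: restrict_ext\<close>)
qed

lemma unit_map_iff:
  "p \<in> ch_maps X (top_of_set {0..1::real}) \<longleftrightarrow>
     p \<in> extensional (topspace X) \<and> continuous_map X euclideanreal p \<and> (\<forall>x\<in>topspace X. p x \<in> {0..1})"
  by (auto simp: ch_maps_def continuous_map_in_subtopology PiE_iff)

lemma ch_space_unit: "ch_space (top_of_set {0..1::real})"
  by (simp add: ch_space_def compact_space_subtopology Hausdorff_space_subtopology)

lemma effect_module_cont_pred: "effect_module (cont_pred X)"
  unfolding cont_pred_def
  by (rule effect_module_pointwise)
     (auto simp: unit_map_iff PiE_iff mult_le_one intro!: continuous_map_restrict continuous_intros continuous_map_real_mult)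

section \<open>Algebra maps into the unit interval\<close>

lemma space_unit_alg [simp]: "alg_space unit_alg = top_of_set {0..1}"
  by (simp add: unit_alg_def)

lemma act_unit_alg:
  "h \<in> pu_maps (cfun (top_of_set {0..1})) complex_cstar \<Longrightarrow> act unit_alg h = mean (top_of_set {0..1}) h (\<lambda>t. t)"
  by (simp add: unit_alg_def mean_def)

text \<open>The mean of the image of \<open>h\<close> on the interval is the integral of
  \<open>p\<close> against \<open>h\<close>. This is the working form of affinity
  throughout.\<close>

lemma em_unit_iff:
  "p \<in> em_maps P unit_alg \<longleftrightarrow> p \<in> ch_maps (alg_space P) (top_of_set {0..1}) \<and>
     (\<forall>h\<in>pu_maps (cfun (alg_space P)) complex_cstar. p (act P h) = mean (alg_space P) h p)"
proof -
  have "act unit_alg (radon_map (alg_space P) (top_of_set {0..1}) p h) = mean (alg_space P) h p"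
    if p: "p \<in> ch_maps (alg_space P) (top_of_set {0..1})" and h: "h \<in> pu_maps (cfun (alg_space P)) complex_cstar" for h
    using radon_map_closed[OF ch_space_unit p h] mean_radon_map[OF h p, of "\<lambda>t. t"]
    by (simp add: act_unit_alg)
  then show ?thesis by (auto simp: em_maps_def)
qed

lemma carrier_alg_dual [simp]: "carrier (alg_dual P) = em_maps P unit_alg"
  by (simp add: alg_dual_def)

lemma em_unitD:
  assumes "p \<in> em_maps P unit_alg"
  shows "continuous_map (alg_space P) euclideanreal p" "x \<in> points P \<Longrightarrow> p x \<in> {0..1}"
    "p \<in> extensional (points P)"
    "h \<in> pu_maps (cfun (alg_space P)) complex_cstar \<Longrightarrow> p (act P h) = mean (alg_space P) h p"
  using assms by (auto simp: em_unit_iff unit_map_iff)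

lemma em_unitI:
  assumes P: "radon_algebra P"
    and p: "continuous_map (alg_space P) euclideanreal p" "\<And>x. x \<in> points P \<Longrightarrow> p x \<in> {0..1}"
    and act: "\<And>h. h \<in> pu_maps (cfun (alg_space P)) complex_cstar \<Longrightarrow> p (act P h) = mean (alg_space P) h p"
  shows "restrict p (points P) \<in> em_maps P unit_alg"
proof -
  have "mean (alg_space P) h (restrict p (points P)) = mean (alg_space P) h p" for h
    by (rule mean_cong) simp
  then show ?thesis unfolding em_unit_iff unit_map_iff
    using p act act_closed[OF P] by (auto intro: continuous_map_restrict)
qed

lemma effect_module_alg_dual:
  assumes P: "radon_algebra P" shows "effect_module (alg_dual P)"
  unfolding alg_dual_def
proof (rule effect_module_pointwise)
  have X: "ch_space (alg_space P)" using P by (rule radon_algebra.ch_space)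
  show "p \<in> points P \<rightarrow>\<^sub>E {0..1}" if "p \<in> em_maps P unit_alg" for p
    using em_unitD[OF that] by (auto simp: PiE_iff)
  show "(\<lambda>x\<in>points P. 0) \<in> em_maps P unit_alg"
    by (rule em_unitI[OF P]) (simp_all add: mean_const[OF X])
  fix p assume p: "p \<in> em_maps P unit_alg"
  note pD = em_unitD[OF p]
  show "(\<lambda>x\<in>points P. 1 - p x) \<in> em_maps P unit_alg"
    using pD by (intro em_unitI[OF P]) (auto simp: mean_diff[OF X] mean_one[OF X] intro: continuous_map_diff)
  show "(\<lambda>x\<in>points P. r * p x) \<in> em_maps P unit_alg" if "r \<in> {0..1}" for r
    using pD that by (intro em_unitI[OF P]) (auto simp: mean_cmul[OF X] mult_le_one intro: continuous_map_real_mult_left)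
  fix q assume q: "q \<in> em_maps P unit_alg" and le: "\<forall>x\<in>points P. p x + q x \<le> 1"
  note qD = em_unitD[OF q]
  show "(\<lambda>x\<in>points P. p x + q x) \<in> em_maps P unit_alg"
    using pD qD le by (intro em_unitI[OF P]) (auto simp: mean_add[OF X] intro: continuous_map_add)
qed

section \<open>Effect module maps and the dual of an effect module\<close>

lemma emod_mapsD:
  assumes "f \<in> emod_maps M N"
  shows "x \<in> carrier M \<Longrightarrow> f x \<in> carrier N" "f \<in> extensional (carrier M)" "f (eone M) = eone N"
    "\<lbrakk>x \<in> carrier M; y \<in> carrier M; eplus M x y = Some z\<rbrakk> \<Longrightarrow> eplus N (f x) (f y) = Some (f z)"
    "\<lbrakk>r \<in> {0..1}; x \<in> carrier M\<rbrakk> \<Longrightarrow> f (escale M r x) = escale N r (f x)"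
  using assms by (auto simp: emod_maps_def PiE_iff)

lemma (in effect_algebra) eone_closed: "eone M \<in> carrier M"
  using ezero_closed eorth_closed by (simp add: eone_def)

lemma emod_maps_compose:
  assumes M: "effect_module M" and f: "f \<in> emod_maps M N" and g: "g \<in> emod_maps N K"
  shows "compose (carrier M) g f \<in> emod_maps M K"
proof -
  interpret effect_module M by fact
  note F = emod_mapsD[OF f] and G = emod_mapsD[OF g]
  show ?thesis unfolding emod_maps_def
  proof (clarify, intro conjI ballI allI impI)
    show "compose (carrier M) g f \<in> carrier M \<rightarrow>\<^sub>E carrier K" using F(1) G(1) by (auto simp: compose_def)
    show "compose (carrier M) g f (eone M) = eone K" using F(3) G(3) eone_closed by (simp add: compose_eq)
  next
    fix x y z assume xyz: "x \<in> carrier M" "y \<in> carrier M" "eplus M x y = Some z"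
    show "eplus K (compose (carrier M) g f x) (compose (carrier M) g f y) = Some (compose (carrier M) g f z)"
      using G(4)[OF F(1) F(1) F(4)[OF xyz]] xyz eplus_closed[OF xyz] by (simp add: compose_eq)
  next
    fix r :: real and x assume rx: "r \<in> {0..1}" "x \<in> carrier M"
    show "compose (carrier M) g f (escale M r x) = escale K r (compose (carrier M) g f x)"
      using F(5)[OF rx] G(5)[OF rx(1) F(1)[OF rx(2)]] escale_closed[OF rx] rx(2) by (simp add: compose_eq)
  qed
qed

lemma unit_emod_simps [simp]:
  "carrier unit_emod = {0..1}" "ezero unit_emod = 0" "eone unit_emod = 1"
  "eplus unit_emod r s = (if r + s \<le> 1 then Some (r + s) else None)"
  "eorth unit_emod r = 1 - r" "escale unit_emod r s = r * s"
  by (simp_all add: unit_emod_def eone_def)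

lemma emod_unitD:
  assumes "v \<in> emod_maps M unit_emod"
  shows "x \<in> carrier M \<Longrightarrow> v x \<in> {0..1}" "v \<in> extensional (carrier M)" "v (eone M) = 1"
    "\<lbrakk>x \<in> carrier M; y \<in> carrier M; eplus M x y = Some z\<rbrakk> \<Longrightarrow> v z = v x + v y"
    "\<lbrakk>r \<in> {0..1}; x \<in> carrier M\<rbrakk> \<Longrightarrow> v (escale M r x) = r * v x"
proof -
  note D = emod_mapsD[OF assms]
  show "x \<in> carrier M \<Longrightarrow> v x \<in> {0..1}" "v \<in> extensional (carrier M)" "v (eone M) = 1"
    "\<lbrakk>r \<in> {0..1}; x \<in> carrier M\<rbrakk> \<Longrightarrow> v (escale M r x) = r * v x"
    using D(1-3,5) by simp_all
  show "\<lbrakk>x \<in> carrier M; y \<in> carrier M; eplus M x y = Some z\<rbrakk> \<Longrightarrow> v z = v x + v y"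
    using D(4)[of x y z] by (simp split: if_splits)
qed

text \<open>That the sum in \<open>unit_emod\<close> is defined follows from additivity, since the
  value at \<open>z\<close> lies in \<open>{0..1}\<close>.\<close>

lemma emod_unitI:
  assumes "effect_module M"
    and "\<And>x. x \<in> carrier M \<Longrightarrow> v x \<in> {0..1}" "v \<in> extensional (carrier M)" "v (eone M) = 1"
    and add: "\<And>x y z. \<lbrakk>x \<in> carrier M; y \<in> carrier M; eplus M x y = Some z\<rbrakk> \<Longrightarrow> v z = v x + v y"
    and "\<And>r x. \<lbrakk>r \<in> {0..1}; x \<in> carrier M\<rbrakk> \<Longrightarrow> v (escale M r x) = r * v x"
  shows "v \<in> emod_maps M unit_emod"
proof -
  interpret effect_module M by fact
  have "v x + v y \<le> 1" if "x \<in> carrier M" "y \<in> carrier M" "eplus M x y = Some z" for x y z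
    using add[OF that] assms(2)[OF eplus_closed[OF that]] by simp
  then show ?thesis using assms(2-) by (auto simp: emod_maps_def PiE_iff)
qed

text \<open>All values lie in \<open>{0..1}\<close> anyway, so the coordinates may range over the
  real line; this fits \<open>compact_space_product_cube\<close>.\<close>

lemma space_emod_dual:
  "alg_space (emod_dual M) =
    subtopology (product_topology (\<lambda>_. euclideanreal) (carrier M)) (emod_maps M unit_emod)"
proof -
  have "(carrier M \<rightarrow>\<^sub>E {0..1}) \<inter> emod_maps M unit_emod = emod_maps M unit_emod"
    by (auto simp: emod_maps_def)
  then show ?thesis
    by (simp add: emod_dual_def Let_def subtopology_product_topology[symmetric] subtopology_subtopology
        flip: subtopology_product_topology)
qed

lemma points_emod_dual [simp]: "points (emod_dual M) = emod_maps M unit_emod"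
  by (auto simp: space_emod_dual emod_maps_def)

lemma act_emod_dual:
  "h \<in> pu_maps (cfun (alg_space (emod_dual M))) complex_cstar \<Longrightarrow>
    act (emod_dual M) h = (\<lambda>m\<in>carrier M. mean (alg_space (emod_dual M)) h (\<lambda>v. v m))"
proof -
  assume h: "h \<in> pu_maps (cfun (alg_space (emod_dual M))) complex_cstar"
  have "topspace (alg_space (emod_dual M)) = emod_maps M unit_emod" by simp
  then show ?thesis using h by (simp add: mean_def) (simp add: emod_dual_def Let_def)
qed

lemma continuous_emod_eval:
  "m \<in> carrier M \<Longrightarrow> continuous_map (alg_space (emod_dual M)) euclideanreal (\<lambda>v. v m)"
  unfolding space_emod_dual by (intro continuous_map_from_subtopology continuous_map_product_projection)

lemma ch_space_emod_dual:
  assumes "effect_module M" shows "ch_space (alg_space (emod_dual M))"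
  unfolding space_emod_dual
proof (rule compact_space_product_cube)
  interpret effect_module M by fact
  let ?T = "product_topology (\<lambda>_. euclideanreal) (carrier M)"
  show "compact {0..1::real}" by simp
  show "v m \<in> {0..1}" if "v \<in> emod_maps M unit_emod" "m \<in> carrier M" for v m using emod_unitD(1)[OF that] .
  have ev: "continuous_map ?T euclideanreal (\<lambda>f. f a)" if "a \<in> carrier M" for a
    using that by (rule continuous_map_product_projection)
  \<comment> \<open>Additivity is a condition only where the partial sum is defined, so its
    instances are indexed by such triples.\<close>
  let ?I = "{(x, y, z). x \<in> carrier M \<and> y \<in> carrier M \<and> eplus M x y = Some z}"
  have I: "fst i \<in> carrier M" "fst (snd i) \<in> carrier M" "snd (snd i) \<in> carrier M" "closed {0::real}" if "i \<in> ?I" for i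
    using that eplus_closed[of "fst i" "fst (snd i)" "snd (snd i)"] by auto
  have 1: "closedin ?T {v \<in> topspace ?T. \<forall>x\<in>carrier M. v x \<in> {0..1}}"
    by (intro closedin_conditions ev) auto
  have 2: "closedin ?T {v \<in> topspace ?T. \<forall>x\<in>{eone M}. v x \<in> {1}}"
    using eone_closed by (intro closedin_conditions ev) auto
  have 3: "closedin ?T {v \<in> topspace ?T. \<forall>i\<in>?I. v (snd (snd i)) - v (fst i) - v (fst (snd i)) \<in> {0}}"
    by (intro closedin_conditions continuous_map_diff ev) (use I in blast)+
  have 4: "closedin ?T {v \<in> topspace ?T. \<forall>i\<in>{0..1}\<times>carrier M. v (escale M (fst i) (snd i)) - fst i * v (snd i) \<in> {0}}"
    by (intro closedin_conditions continuous_map_diff continuous_map_real_mult ev escale_closed) auto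
  have "emod_maps M unit_emod = {v \<in> topspace ?T. \<forall>x\<in>carrier M. v x \<in> {0..1}} \<inter>
     {v \<in> topspace ?T. \<forall>x\<in>{eone M}. v x \<in> {1}} \<inter>
     {v \<in> topspace ?T. \<forall>i\<in>?I. v (snd (snd i)) - v (fst i) - v (fst (snd i)) \<in> {0}} \<inter>
     {v \<in> topspace ?T. \<forall>i\<in>{0..1}\<times>carrier M. v (escale M (fst i) (snd i)) - fst i * v (snd i) \<in> {0}}" (is "_ = ?R")
  proof (intro equalityI subsetI)
    fix v assume v: "v \<in> emod_maps M unit_emod"
    then show "v \<in> ?R" using emod_unitD[OF v] by (auto simp: PiE_iff)
  next
    fix v assume v: "v \<in> ?R"
    show "v \<in> emod_maps M unit_emod"
      by (rule emod_unitI) (use v in \<open>auto simp: PiE_iff effect_module_axioms algebra_simps\<close>)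
  qed
  then show "closedin ?T (emod_maps M unit_emod)" using closedin_Int[OF closedin_Int[OF closedin_Int[OF 1 2] 3] 4] by simp
qed

text \<open>Each axiom of an effect module map is a linear identity or a bound on evaluations, and
  averaging over \<open>h\<close> preserves both.\<close>

lemma act_emod_dual_closed:
  assumes M: "effect_module M" and h: "h \<in> pu_maps (cfun (alg_space (emod_dual M))) complex_cstar"
  shows "act (emod_dual M) h \<in> emod_maps M unit_emod"
proof (rule emod_unitI[OF M])
  interpret effect_module M by fact
  let ?X = "alg_space (emod_dual M)"
  note X = ch_space_emod_dual[OF M]
  note ev = continuous_emod_eval
  have D: "v \<in> emod_maps M unit_emod" if "v \<in> topspace ?X" for v using that by simp
  show "act (emod_dual M) h x \<in> {0..1}" if "x \<in> carrier M" for x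
    using that mean_unit_interval[OF X h ev[OF that]] emod_unitD(1)[OF D] by (simp add: act_emod_dual[OF h])
  show "act (emod_dual M) h \<in> extensional (carrier M)" by (simp add: act_emod_dual[OF h])
  have "mean ?X h (\<lambda>v. v (eone M)) = mean ?X h (\<lambda>_. 1)"
    by (rule mean_cong) (simp add: emod_unitD(3))
  then show "act (emod_dual M) h (eone M) = 1" using eone_closed by (simp add: act_emod_dual[OF h] mean_one[OF X h])
  show "act (emod_dual M) h z = act (emod_dual M) h x + act (emod_dual M) h y"
    if xyz: "x \<in> carrier M" "y \<in> carrier M" "eplus M x y = Some z" for x y z
  proof -
    have "mean ?X h (\<lambda>v. v z) = mean ?X h (\<lambda>v. v x + v y)"
      by (rule mean_cong) (use emod_unitD(4) xyz in \<open>auto simp del: One_nat_def\<close>)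
    then show ?thesis using xyz eplus_closed[OF xyz] by (simp add: act_emod_dual[OF h] mean_add[OF X h] ev)
  qed
  show "act (emod_dual M) h (escale M r x) = r * act (emod_dual M) h x"
    if rx: "r \<in> {0..1}" "x \<in> carrier M" for r x
  proof -
    have "mean ?X h (\<lambda>v. v (escale M r x)) = mean ?X h (\<lambda>v. r * v x)"
      by (rule mean_cong) (rule emod_unitD(5)[OF D rx])
    then show ?thesis using rx escale_closed[OF rx] by (simp add: act_emod_dual[OF h] mean_cmul[OF X h] ev)
  qed
qed

lemma continuous_mean:
  assumes "continuous_map X euclideanreal p"
  shows "continuous_map (radon X) euclideanreal (\<lambda>h. mean X h p)"
  unfolding mean_def radon_def using assms
  by (intro continuous_map_euclidean_compose[where g = Re] continuous_map_stat_eval) (auto intro: continuous_intros)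

lemma continuous_map_into_emod_dual:
  assumes "\<And>x. x \<in> topspace X \<Longrightarrow> f x \<in> emod_maps M unit_emod"
    and "\<And>m. m \<in> carrier M \<Longrightarrow> continuous_map X euclideanreal (\<lambda>x. f x m)"
  shows "continuous_map X (alg_space (emod_dual M)) f"
  unfolding space_emod_dual continuous_map_in_subtopology continuous_map_componentwise
  using assms by (auto simp: emod_maps_def PiE_iff)

text \<open>Iterated integration. Evaluation of states at a real function is itself real, so it is
  the \<open>cplx\<close> of the inner mean.\<close>

lemma mean_radon_mu:
  assumes X: "ch_space X" and g: "g \<in> pu_maps (cfun (radon X)) complex_cstar" and p: "continuous_map X euclideanreal p"
  shows "mean X (radon_mu X g) p = mean (radon X) g (\<lambda>h. mean X h p)"
proof -
  have "(\<lambda>h\<in>topspace (radon X). h (cplx (topspace X) p)) = cplx (topspace (radon X)) (\<lambda>h. mean X h p)"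
    unfolding cplx_def[of "topspace (radon X)"] by (rule restrict_ext) (simp add: mean_of_real[OF X _ p])
  then show ?thesis using g p by (simp add: mean_def radon_mu_def)
qed

lemma radon_algebra_emod_dual:
  assumes M: "effect_module M" shows "radon_algebra (emod_dual M)"
proof
  let ?X = "alg_space (emod_dual M)"
  show X: "ch_space ?X" using M by (rule ch_space_emod_dual)
  have cont: "continuous_map (radon ?X) ?X (act (emod_dual M))"
  proof (rule continuous_map_into_emod_dual)
    fix m assume m: "m \<in> carrier M"
    have "continuous_map (radon ?X) euclideanreal (\<lambda>h. mean ?X h (\<lambda>v. v m))"
      using m by (intro continuous_mean continuous_emod_eval)
    then show "continuous_map (radon ?X) euclideanreal (\<lambda>h. act (emod_dual M) h m)"
      by (rule continuous_map_eq) (use m in \<open>simp add: act_emod_dual\<close>)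
  qed (use act_emod_dual_closed[OF M] in simp)
  have ext: "act (emod_dual M) \<in> extensional (topspace (radon ?X))"
    by (simp add: emod_dual_def Let_def)
  show act: "act (emod_dual M) \<in> ch_maps (radon ?X) ?X"
    using ch_mapsI[OF cont] ext by (simp add: extensional_restrict)
  show "act (emod_dual M) (radon_eta ?X v) = v" if v: "v \<in> points (emod_dual M)" for v
  proof -
    have h: "radon_eta ?X v \<in> pu_maps (cfun ?X) complex_cstar" using X v by (rule radon_eta_closed)
    show ?thesis unfolding act_emod_dual[OF h]
    proof (rule extensionalityI)
      show "(\<lambda>m\<in>carrier M. mean ?X (radon_eta ?X v) (\<lambda>v. v m)) m = v m" if "m \<in> carrier M" for m
        using mean_eta[OF v continuous_emod_eval[OF that]] that by simp
      show "v \<in> extensional (carrier M)" using v emod_unitD(2) by simp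
    qed simp
  qed
  fix g assume g: "g \<in> topspace (radon (radon ?X))"
  then have g': "g \<in> pu_maps (cfun (radon ?X)) complex_cstar" by simp
  have mu: "radon_mu ?X g \<in> pu_maps (cfun ?X) complex_cstar" using X g' by (rule radon_mu_closed)
  have rm: "radon_map (radon ?X) ?X (act (emod_dual M)) g \<in> pu_maps (cfun ?X) complex_cstar"
    using X act g' by (rule radon_map_closed)
  have "mean ?X (radon_mu ?X g) (\<lambda>v. v m) = mean ?X (radon_map (radon ?X) ?X (act (emod_dual M)) g) (\<lambda>v. v m)"
    if m: "m \<in> carrier M" for m
  proof -
    have "mean (radon ?X) g (\<lambda>h. mean ?X h (\<lambda>v. v m)) = mean (radon ?X) g (\<lambda>h. act (emod_dual M) h m)"
      by (rule mean_cong) (use m in \<open>simp add: act_emod_dual\<close>)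
    then show ?thesis
      using mean_radon_mu[OF X g' continuous_emod_eval[OF m]] mean_radon_map[OF g' act continuous_emod_eval[OF m]]
      by simp
  qed
  then show "act (emod_dual M) (radon_mu ?X g) = act (emod_dual M) (radon_map (radon ?X) ?X (act (emod_dual M)) g)"
    unfolding act_emod_dual[OF mu] act_emod_dual[OF rm] by (rule restrict_ext)
qed

lemma emod_eval_em:
  assumes M: "effect_module M" and m: "m \<in> carrier M"
  shows "(\<lambda>v\<in>emod_maps M unit_emod. v m) \<in> em_maps (emod_dual M) unit_alg"
proof -
  have "restrict (\<lambda>v. v m) (points (emod_dual M)) \<in> em_maps (emod_dual M) unit_alg"
  proof (rule em_unitI[OF radon_algebra_emod_dual[OF M] continuous_emod_eval[OF m]])
    show "v m \<in> {0..1}" if "v \<in> points (emod_dual M)" for v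
      using that m emod_unitD(1)[of v M m] by simp
  qed (simp add: act_emod_dual m)
  then show ?thesis by simp
qed

text \<open>The right-hand side is symmetric in \<open>x\<close> and \<open>m\<close> up to transposition, which gives the adjunction.\<close>

lemma em_maps_emod_dual_iff:
  assumes P: "radon_algebra P" and M: "effect_module M"
  shows "f \<in> em_maps P (emod_dual M) \<longleftrightarrow> f \<in> extensional (points P) \<and>
    (\<forall>x\<in>points P. f x \<in> emod_maps M unit_emod) \<and> (\<forall>m\<in>carrier M. (\<lambda>x\<in>points P. f x m) \<in> em_maps P unit_alg)"
proof (intro iffI conjI ballI)
  let ?X = "alg_space (emod_dual M)"
  assume f: "f \<in> em_maps P (emod_dual M)"
  note fD = em_mapsD[OF f]
  show "f \<in> extensional (points P)" using fD(1) by (simp add: ch_maps_def PiE_iff)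
  show "f x \<in> emod_maps M unit_emod" if "x \<in> points P" for x using fD(2)[OF that] by simp
  fix m assume m: "m \<in> carrier M"
  have "compose (points P) (\<lambda>v\<in>emod_maps M unit_emod. v m) f \<in> em_maps P unit_alg"
    using P ch_space_emod_dual[OF M] f emod_eval_em[OF M m] by (rule em_maps_compose)
  moreover have "compose (points P) (\<lambda>v\<in>emod_maps M unit_emod. v m) f = (\<lambda>x\<in>points P. f x m)"
    unfolding compose_def using fD(2) by (intro restrict_ext) simp
  ultimately show "(\<lambda>x\<in>points P. f x m) \<in> em_maps P unit_alg" by simp
next
  let ?X = "alg_space (emod_dual M)"
  assume a: "f \<in> extensional (points P) \<and>
    (\<forall>x\<in>points P. f x \<in> emod_maps M unit_emod) \<and> (\<forall>m\<in>carrier M. (\<lambda>x\<in>points P. f x m) \<in> em_maps P unit_alg)"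
  have "continuous_map (alg_space P) ?X f"
  proof (rule continuous_map_into_emod_dual)
    fix m assume "m \<in> carrier M"
    then have "continuous_map (alg_space P) euclideanreal (\<lambda>x\<in>points P. f x m)" using a em_unitD(1) by blast
    then show "continuous_map (alg_space P) euclideanreal (\<lambda>x. f x m)" by (rule continuous_map_eq) simp
  qed (use a in blast)
  then have fch: "f \<in> ch_maps (alg_space P) ?X" using a by (auto simp: ch_maps_def PiE_iff)
  have "f (act P h) = act (emod_dual M) (radon_map (alg_space P) ?X f h)"
    if h: "h \<in> pu_maps (cfun (alg_space P)) complex_cstar" for h
  proof -
    have rm: "radon_map (alg_space P) ?X f h \<in> pu_maps (cfun ?X) complex_cstar"
      using ch_space_emod_dual[OF M] fch h by (rule radon_map_closed)
    have ac: "act P h \<in> points P" using P h by (rule act_closed)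
    show ?thesis unfolding act_emod_dual[OF rm]
    proof (rule extensionalityI)
      show "f (act P h) \<in> extensional (carrier M)" using a ac emod_unitD(2) by blast
      fix m assume m: "m \<in> carrier M"
      have "f (act P h) m = mean (alg_space P) h (\<lambda>x\<in>points P. f x m)"
        using em_unitD(4)[of "\<lambda>x\<in>points P. f x m" P h] a m h ac by simp
      also have "\<dots> = mean (alg_space P) h (\<lambda>x. f x m)" by (rule mean_cong) simp
      also have "\<dots> = mean ?X (radon_map (alg_space P) ?X f h) (\<lambda>v. v m)"
        using mean_radon_map[OF h fch continuous_emod_eval[OF m]] by simp
      finally show "f (act P h) m = (\<lambda>m\<in>carrier M. mean ?X (radon_map (alg_space P) ?X f h) (\<lambda>v. v m)) m"
        using m by simp
    qed simp
  qed
  then show "f \<in> em_maps P (emod_dual M)" using fch by (simp add: em_maps_def)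
qed

section \<open>Functoriality of the two duals and their adjunction\<close>

lemma emod_dual_map_em:
  assumes M: "effect_module M" and N: "effect_module N" and f: "f \<in> emod_maps M N"
  shows "emod_dual_map M N f \<in> em_maps (emod_dual N) (emod_dual M)"
  unfolding em_maps_emod_dual_iff[OF radon_algebra_emod_dual[OF N] M] points_emod_dual
proof (intro conjI ballI)
  show "emod_dual_map M N f \<in> extensional (emod_maps N unit_emod)" by (simp add: emod_dual_map_def)
  show "emod_dual_map M N f v \<in> emod_maps M unit_emod" if "v \<in> emod_maps N unit_emod" for v
    using emod_maps_compose[OF M f that] that by (simp add: emod_dual_map_def)
  fix m assume m: "m \<in> carrier M"
  have "(\<lambda>v\<in>emod_maps N unit_emod. emod_dual_map M N f v m) = (\<lambda>v\<in>emod_maps N unit_emod. v (f m))"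
    using m by (intro restrict_ext) (simp add: emod_dual_map_def compose_eq)
  then show "(\<lambda>v\<in>emod_maps N unit_emod. emod_dual_map M N f v m) \<in> em_maps (emod_dual N) unit_alg"
    using emod_eval_em[OF N emod_mapsD(1)[OF f m]] by simp
qed

lemma alg_dual_simps [simp]:
  "eone (alg_dual P) = (\<lambda>x\<in>points P. 1)"
  "eplus (alg_dual P) p q = (if \<forall>x\<in>points P. p x + q x \<le> 1 then Some (\<lambda>x\<in>points P. p x + q x) else None)"
  "escale (alg_dual P) r p = (\<lambda>x\<in>points P. r * p x)"
  by (simp_all add: alg_dual_def)

lemma alg_dual_map_emod:
  assumes P: "radon_algebra P" and Q: "radon_algebra Q" and f: "f \<in> em_maps P Q"
  shows "alg_dual_map P Q f \<in> emod_maps (alg_dual Q) (alg_dual P)"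
proof -
  have cl: "compose (points P) q f \<in> em_maps P unit_alg" if "q \<in> em_maps Q unit_alg" for q
    using P radon_algebra.ch_space[OF Q] f that by (rule em_maps_compose)
  interpret Q: effect_module "alg_dual Q" using Q by (rule effect_module_alg_dual)
  note fQ = em_mapsD(2)[OF f]
  have in_Q: "(\<lambda>x\<in>points Q. q x + q' x) \<in> em_maps Q unit_alg"
    if "q \<in> em_maps Q unit_alg" "q' \<in> em_maps Q unit_alg" "\<forall>x\<in>points Q. q x + q' x \<le> 1" for q q'
    using Q.eplus_closed[of q q'] that by simp
  have sc_Q: "(\<lambda>x\<in>points Q. r * q x) \<in> em_maps Q unit_alg"
    if "q \<in> em_maps Q unit_alg" "r \<in> {0..1}" for q r
    using Q.escale_closed[of r q] that by simp
  have one_Q: "(\<lambda>x\<in>points Q. 1) \<in> em_maps Q unit_alg" using Q.eone_closed by simp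
  show ?thesis unfolding emod_maps_def alg_dual_map_def
  proof (clarify, intro conjI ballI allI impI)
    show "(\<lambda>q\<in>carrier (alg_dual Q). compose (points P) q f) \<in> carrier (alg_dual Q) \<rightarrow>\<^sub>E carrier (alg_dual P)"
      using cl by auto
    show "(\<lambda>q\<in>carrier (alg_dual Q). compose (points P) q f) (eone (alg_dual Q)) = eone (alg_dual P)"
      using one_Q fQ by (auto simp: compose_def intro!: restrict_ext)
  next
    fix q q' z assume q: "q \<in> carrier (alg_dual Q)" "q' \<in> carrier (alg_dual Q)" and "eplus (alg_dual Q) q q' = Some z"
    then have le: "\<forall>x\<in>points Q. q x + q' x \<le> 1" and z: "z = (\<lambda>x\<in>points Q. q x + q' x)" by (auto split: if_splits)
    show "eplus (alg_dual P) ((\<lambda>q\<in>carrier (alg_dual Q). compose (points P) q f) q)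
      ((\<lambda>q\<in>carrier (alg_dual Q). compose (points P) q f) q') = Some ((\<lambda>q\<in>carrier (alg_dual Q). compose (points P) q f) z)"
      using q le in_Q[of q q'] fQ z by (auto simp: compose_def intro!: restrict_ext)
  next
    fix r :: real and q assume "r \<in> {0..1}" "q \<in> carrier (alg_dual Q)"
    then show "(\<lambda>q\<in>carrier (alg_dual Q). compose (points P) q f) (escale (alg_dual Q) r q) =
      escale (alg_dual P) r ((\<lambda>q\<in>carrier (alg_dual Q). compose (points P) q f) q)"
      using sc_Q[of q r] fQ by (auto simp: compose_def intro!: restrict_ext)
  qed
qed

lemma alg_dual_map_compose:
  assumes P: "radon_algebra P" and Q: "radon_algebra Q" and S: "radon_algebra S"
    and f: "f \<in> em_maps P Q" and g: "g \<in> em_maps Q S"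
  shows "alg_dual_map P S (compose (points P) g f)
    = compose (carrier (alg_dual S)) (alg_dual_map P Q f) (alg_dual_map Q S g)"
  unfolding compose_def[of "carrier (alg_dual S)"] alg_dual_map_def
proof (rule restrict_ext)
  fix q assume q: "q \<in> carrier (alg_dual S)"
  then have "compose (points Q) q g \<in> em_maps Q unit_alg"
    using em_maps_compose[OF Q radon_algebra.ch_space[OF S] g] by simp
  then show "compose (points P) q (compose (points P) g f) = (\<lambda>q\<in>carrier (alg_dual Q). compose (points P) q f)
       ((\<lambda>q\<in>carrier (alg_dual S). compose (points Q) q g) q)"
    using q em_mapsD(2)[OF f] by (auto simp: compose_def intro!: restrict_ext)
qed

lemma emod_dual_map_compose:
  assumes L: "effect_module L" and M: "effect_module M"
    and f: "f \<in> emod_maps L M" and g: "g \<in> emod_maps M N"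
  shows "emod_dual_map L N (compose (carrier L) g f)
    = compose (points (emod_dual N)) (emod_dual_map L M f) (emod_dual_map M N g)"
  unfolding compose_def[of "points (emod_dual N)"] emod_dual_map_def
proof (rule restrict_ext)
  fix v assume v: "v \<in> points (emod_dual N)"
  then have "compose (carrier M) v g \<in> emod_maps M unit_emod" using emod_maps_compose[OF M g] by simp
  then show "compose (carrier L) v (compose (carrier L) g f) = (\<lambda>v\<in>points (emod_dual M). compose (carrier L) v f)
      ((\<lambda>v\<in>points (emod_dual N). compose (carrier M) v g) v)"
    using v emod_mapsD(1)[OF f] by (auto simp: compose_def intro!: restrict_ext)
qed

lemma compose_id:
  assumes "f \<in> extensional S" shows "compose S f (\<lambda>x\<in>S. x) = f"
  by (rule extensionalityI[of _ S]) (use assms in \<open>auto simp: compose_def\<close>)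

lemma transpose_bij:
  assumes P: "radon_algebra P" and M: "effect_module M"
  shows "bij_betw (transpose_map P M) (em_maps P (emod_dual M)) (emod_maps M (alg_dual P))"
proof (rule bij_betwI[where g = "\<lambda>g. \<lambda>x\<in>points P. \<lambda>m\<in>carrier M. g m x"])
  interpret effect_module M by fact
  note iff = em_maps_emod_dual_iff[OF P M]
  show "transpose_map P M \<in> em_maps P (emod_dual M) \<rightarrow> emod_maps M (alg_dual P)"
  proof
    fix f assume "f \<in> em_maps P (emod_dual M)"
    then have f: "\<And>x. x \<in> points P \<Longrightarrow> f x \<in> emod_maps M unit_emod"
      "\<And>m. m \<in> carrier M \<Longrightarrow> (\<lambda>x\<in>points P. f x m) \<in> em_maps P unit_alg" by (auto simp: iff)
    note D = emod_unitD[OF f(1)]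
    show "transpose_map P M f \<in> emod_maps M (alg_dual P)"
      unfolding emod_maps_def transpose_map_def
    proof (clarify, intro conjI ballI allI impI)
      fix x y z assume xyz: "x \<in> carrier M" "y \<in> carrier M" "eplus M x y = Some z"
      have s: "f w z = f w x + f w y" "f w z \<le> 1" if "w \<in> points P" for w
        using D(4)[OF that xyz] D(1)[OF that eplus_closed[OF xyz]] by auto
      then show "eplus (alg_dual P) ((\<lambda>m\<in>carrier M. \<lambda>x\<in>points P. f x m) x) ((\<lambda>m\<in>carrier M. \<lambda>x\<in>points P. f x m) y) =
         Some ((\<lambda>m\<in>carrier M. \<lambda>x\<in>points P. f x m) z)"
        using xyz eplus_closed[OF xyz] by (auto intro!: restrict_ext)
    next
      show "(\<lambda>m\<in>carrier M. \<lambda>x\<in>points P. f x m) (eone M) = eone (alg_dual P)"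
        using D(3) eone_closed by (auto intro!: restrict_ext)
      fix r :: real and x assume "r \<in> {0..1}" "x \<in> carrier M"
      then show "(\<lambda>m\<in>carrier M. \<lambda>x\<in>points P. f x m) (escale M r x) =
        escale (alg_dual P) r ((\<lambda>m\<in>carrier M. \<lambda>x\<in>points P. f x m) x)"
        using D(5) escale_closed by (auto intro!: restrict_ext)
    qed (use f(2) in auto)
  qed
  show "(\<lambda>g. \<lambda>x\<in>points P. \<lambda>m\<in>carrier M. g m x) \<in> emod_maps M (alg_dual P) \<rightarrow> em_maps P (emod_dual M)"
  proof
    fix g assume g: "g \<in> emod_maps M (alg_dual P)"
    note D = emod_mapsD[OF g]
    have gm: "g m \<in> em_maps P unit_alg" if "m \<in> carrier M" for m using D(1)[OF that] by simp
    show "(\<lambda>x\<in>points P. \<lambda>m\<in>carrier M. g m x) \<in> em_maps P (emod_dual M)"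
      unfolding iff
    proof (intro conjI ballI)
      fix w assume w: "w \<in> points P"
      have "(\<lambda>m\<in>carrier M. g m w) \<in> emod_maps M unit_emod"
      proof (rule emod_unitI[OF M])
        fix x y z assume xyz: "x \<in> carrier M" "y \<in> carrier M" "eplus M x y = Some z"
        have "g z = (\<lambda>w\<in>points P. g x w + g y w)" using D(4)[OF xyz] by (auto split: if_splits)
        then show "(\<lambda>m\<in>carrier M. g m w) z = (\<lambda>m\<in>carrier M. g m w) x + (\<lambda>m\<in>carrier M. g m w) y"
          using xyz eplus_closed[OF xyz] w by simp
      qed (use w em_unitD(2)[OF gm] D eone_closed escale_closed in auto)
      then show "(\<lambda>x\<in>points P. \<lambda>m\<in>carrier M. g m x) w \<in> emod_maps M unit_emod" using w by simp
    next
      fix m assume m: "m \<in> carrier M"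
      have "(\<lambda>x\<in>points P. (\<lambda>x\<in>points P. \<lambda>m\<in>carrier M. g m x) x m) = g m"
        by (rule extensionalityI[of _ "points P"]) (use m em_unitD(3)[OF gm[OF m]] in auto)
      then show "(\<lambda>x\<in>points P. (\<lambda>x\<in>points P. \<lambda>m\<in>carrier M. g m x) x m) \<in> em_maps P unit_alg" using gm[OF m] by simp
    qed simp
  qed
  show "(\<lambda>x\<in>points P. \<lambda>m\<in>carrier M. transpose_map P M f m x) = f" if "f \<in> em_maps P (emod_dual M)" for f
  proof (rule extensionalityI[of _ "points P"])
    fix x assume x: "x \<in> points P"
    have "f x \<in> emod_maps M unit_emod" using that x iff by blast
    then have "f x \<in> extensional (carrier M)" by (rule emod_unitD(2))
    then have "(\<lambda>m\<in>carrier M. transpose_map P M f m x) = f x"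
      by (intro extensionalityI[of _ "carrier M"]) (use x in \<open>simp_all add: transpose_map_def\<close>)
    then show "(\<lambda>x\<in>points P. \<lambda>m\<in>carrier M. transpose_map P M f m x) x = f x" using x by simp
  qed (use that iff in auto)
  show "transpose_map P M (\<lambda>x\<in>points P. \<lambda>m\<in>carrier M. g m x) = g" if g: "g \<in> emod_maps M (alg_dual P)" for g
  proof (rule extensionalityI[of _ "carrier M"])
    fix m assume m: "m \<in> carrier M"
    have "(\<lambda>x\<in>points P. (\<lambda>x\<in>points P. \<lambda>m\<in>carrier M. g m x) x m) = g m"
      by (rule extensionalityI[of _ "points P"]) (use m em_unitD(3)[of "g m" P] emod_mapsD(1)[OF g m] in auto)
    then show "transpose_map P M (\<lambda>x\<in>points P. \<lambda>m\<in>carrier M. g m x) m = g m" using m by (simp add: transpose_map_def)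
  qed (use emod_mapsD(2)[OF g] in \<open>auto simp: transpose_map_def\<close>)
qed

text \<open>Both sides send \<open>m\<close> and \<open>x\<close> to
  \<open>f (h x) (k m)\<close>.\<close>

lemma transpose_natural:
  assumes P: "radon_algebra P" and Q: "radon_algebra Q" and M: "effect_module M" and N: "effect_module N"
    and f: "f \<in> em_maps Q (emod_dual N)" and h: "h \<in> em_maps P Q" and k: "k \<in> emod_maps M N"
  shows "transpose_map P M (compose (points P) (emod_dual_map M N k) (compose (points P) f h))
    = compose (carrier M) (alg_dual_map P Q h) (compose (carrier M) (transpose_map Q N f) k)"
  unfolding transpose_map_def compose_def[of "carrier M"]
proof (rule restrict_ext)
  fix m assume m: "m \<in> carrier M"
  have km: "k m \<in> carrier N" using emod_mapsD(1)[OF k m] .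
  have ev: "(\<lambda>x\<in>points Q. f x (k m)) \<in> em_maps Q unit_alg" and fx: "\<And>x. x \<in> points Q \<Longrightarrow> f x \<in> emod_maps N unit_emod"
    using f km unfolding em_maps_emod_dual_iff[OF Q N] by auto
  show "(\<lambda>x\<in>points P. compose (points P) (emod_dual_map M N k) (compose (points P) f h) x m) =
      alg_dual_map P Q h ((\<lambda>x\<in>carrier M. (\<lambda>m\<in>carrier N. \<lambda>x\<in>points Q. f x m) (k x)) m)"
    using m km ev fx em_mapsD(2)[OF h]
    by (auto simp: alg_dual_map_def emod_dual_map_def compose_def intro!: restrict_ext)
qed


section \<open>Effects and states of a C*-algebra\<close>

lemma effects_simps [simp]:
  "ezero (effects A) = \<zero>\<^bsub>A\<^esub>"
  "eplus (effects A) x y = (if cle A (x \<oplus>\<^bsub>A\<^esub> y) \<one>\<^bsub>A\<^esub> then Some (x \<oplus>\<^bsub>A\<^esub> y) else None)"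
  "eorth (effects A) x = \<one>\<^bsub>A\<^esub> \<ominus>\<^bsub>A\<^esub> x" "escale (effects A) r x = complex_of_real r \<odot>\<^bsub>A\<^esub> x"
  by (simp_all add: effects_def)

context cstar_algebra
begin

abbreviation E :: "'a set" where "E \<equiv> carrier (effects A)"

lemma minus_zero_right [simp]: "x \<in> carrier A \<Longrightarrow> x \<ominus> \<zero> = x"
  by (simp add: minus_eq)

lemma eone_effects [simp]: "eone (effects A) = \<one>"
  by (simp add: eone_def)

lemma effects_iff: "a \<in> E \<longleftrightarrow> nonneg a \<and> nonneg (\<one> \<ominus> a)"
proof -
  have "nonneg a \<Longrightarrow> a \<in> carrier A" by simp
  then show ?thesis by (auto simp: effects_def cle_def positive_iff)
qed

lemma cle_one: "cle A a \<one> \<longleftrightarrow> nonneg (\<one> \<ominus> a)"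
  by (simp add: cle_def positive_iff)

lemma effectD: "a \<in> E \<Longrightarrow> nonneg a" "a \<in> E \<Longrightarrow> nonneg (\<one> \<ominus> a)" "a \<in> E \<Longrightarrow> a \<in> sa" "a \<in> E \<Longrightarrow> a \<in> carrier A"
  by (auto simp: effects_iff)

lemma effect_scale:
  assumes r: "0 \<le> r" "r \<le> 1" and a: "a \<in> E" shows "rscale r a \<in> E"
proof -
  note [simp] = effectD(3)[OF a]
  have "nonneg (rscale (1 - r) \<one> \<oplus> rscale r (\<one> \<ominus> a))"
    using r effectD[OF a] by (intro nonneg_add nonneg_scale) auto
  also have "rscale (1 - r) \<one> \<oplus> rscale r (\<one> \<ominus> a) = \<one> \<ominus> rscale r a" by (simp add: calg)
  finally show ?thesis using r effectD[OF a] by (simp add: effects_iff nonneg_scale)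
qed

lemma effect_mono:
  assumes "a \<in> sa" "nonneg b" "nonneg (\<one> \<ominus> (a \<oplus> b))" shows "nonneg (\<one> \<ominus> a)"
proof -
  have "\<one> \<ominus> a = (\<one> \<ominus> (a \<oplus> b)) \<oplus> b" using assms(1) nonneg_sa[OF assms(2)] by (simp add: calg)
  then show ?thesis using nonneg_add[OF assms(3,2)] by simp
qed

lemma effect_module_effects: "effect_module (effects A)"
proof (intro effect_module.intro effect_algebra.intro effect_module_axioms.intro; simp only: effects_simps eone_effects)
  show "\<zero> \<in> E" by (simp add: effects_iff)
  fix x assume x: "x \<in> E"
  note [simp] = effectD(3)[OF x]
  show "\<one> \<ominus> x \<in> E" using x by (simp add: effects_iff)
  show "(if cle A (\<zero> \<oplus> x) \<one> then Some (\<zero> \<oplus> x) else None) = Some x"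
    using effectD[OF x] by (simp add: cle_one)
  show "x = \<zero>" if "(if cle A (x \<oplus> \<one>) \<one> then Some (x \<oplus> \<one>) else None) \<noteq> None"
  proof -
    \<comment> \<open>If \<open>x + 1\<close> is below 1, then both \<open>x\<close> and
      \<open>-x\<close> are in the cone, which is proper.\<close>
    have "nonneg (\<one> \<ominus> (x \<oplus> \<one>))" using that by (simp add: cle_one split: if_splits)
    also have "\<one> \<ominus> (x \<oplus> \<one>) = \<ominus> x" by (simp add: calg)
    finally show ?thesis by (rule nonneg_proper[OF effectD(1)[OF x]])
  qed
  show "complex_of_real 0 \<odot> x = \<zero>" "complex_of_real 1 \<odot> x = x" by simp_all
  fix r assume r: "r \<in> {0..1::real}"
  show "rscale r x \<in> E" using effect_scale r x by simp
  fix s assume s: "s \<in> {0..1::real}"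
  show "rscale (r * s) x = rscale r (rscale s x)" by simp
  assume rs: "r + s \<le> 1"
  then have "rscale (r + s) x \<in> E" using effect_scale[of "r + s" x] r s x by simp
  moreover have "rscale r x \<oplus> rscale s x = rscale (r + s) x" by (simp add: collect)
  ultimately show "(if cle A (rscale r x \<oplus> rscale s x) \<one> then Some (rscale r x \<oplus> rscale s x) else None) = Some (rscale (r + s) x)"
    using effectD(2) by (simp only: cle_one if_True)
next
  fix x y assume x: "x \<in> E" and y: "y \<in> E"
  note [simp] = effectD(3)[OF x] effectD(3)[OF y]
  show "z \<in> E" if "(if cle A (x \<oplus> y) \<one> then Some (x \<oplus> y) else None) = Some z" for z
    using that effectD[OF x] effectD[OF y] by (auto simp: effects_iff cle_one nonneg_add split: if_splits)
  show "(if cle A (x \<oplus> y) \<one> then Some (x \<oplus> y) else None) = (if cle A (y \<oplus> x) \<one> then Some (y \<oplus> x) else None)"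
    by (simp add: a_comm)
  show "((if cle A (x \<oplus> y) \<one> then Some (x \<oplus> y) else None) = Some \<one>) = (y = \<one> \<ominus> x)"
  proof
    assume "(if cle A (x \<oplus> y) \<one> then Some (x \<oplus> y) else None) = Some \<one>"
    then have "x \<oplus> y = \<one>" by (simp split: if_splits)
    then have "\<one> \<ominus> x = (x \<oplus> y) \<ominus> x" by simp
    also have "\<dots> = y" by (simp add: calg)
    finally show "y = \<one> \<ominus> x" by simp
  next
    assume "y = \<one> \<ominus> x"
    then have "x \<oplus> y = \<one>" by (simp add: calg)
    then show "(if cle A (x \<oplus> y) \<one> then Some (x \<oplus> y) else None) = Some \<one>" by (simp add: cle_one)
  qed
  show "(if cle A (rscale r x \<oplus> rscale r y) \<one> then Some (rscale r x \<oplus> rscale r y) else None) = Some (rscale r z)"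
    if r: "r \<in> {0..1}" and z: "(if cle A (x \<oplus> y) \<one> then Some (x \<oplus> y) else None) = Some z" for r z
  proof -
    have "z = x \<oplus> y" "cle A (x \<oplus> y) \<one>" using z by (auto split: if_splits)
    then have "rscale r (x \<oplus> y) \<in> E" using r effectD(1)[OF x] effectD(1)[OF y]
      by (intro effect_scale) (auto simp: effects_iff cle_one nonneg_add)
    then show ?thesis using effectD(2)[of "rscale r (x \<oplus> y)"] \<open>z = x \<oplus> y\<close> by (simp add: cle_one smult_dist)
  qed
  fix z assume z: "z \<in> E"
  note [simp] = effectD(3)[OF z]
  have xyz: "x \<oplus> y \<oplus> z = x \<oplus> (y \<oplus> z)" by (simp add: a_assoc)
  \<comment> \<open>The omitted summand is in the cone, so either partial sum is below 1 once the
    total is. Hence the two bracketings are defined together.\<close>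
  have 1: "cle A (x \<oplus> y) \<one>" if "cle A (x \<oplus> (y \<oplus> z)) \<one>"
    using effect_mono[of "x \<oplus> y" z] effectD(1)[OF z] that by (simp add: cle_one xyz)
  have 2: "cle A (y \<oplus> z) \<one>" if "cle A (x \<oplus> (y \<oplus> z)) \<one>"
    using effect_mono[of "y \<oplus> z" x] effectD(1)[OF x] that by (simp add: cle_one a_comm)
  show "Option.bind (if cle A (x \<oplus> y) \<one> then Some (x \<oplus> y) else None)
      (\<lambda>s. if cle A (s \<oplus> z) \<one> then Some (s \<oplus> z) else None) =
    Option.bind (if cle A (y \<oplus> z) \<one> then Some (y \<oplus> z) else None)
      (\<lambda>t. if cle A (x \<oplus> t) \<one> then Some (x \<oplus> t) else None)"
    using 1 2 by (simp add: xyz)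
qed simp

lemma state_effect:
  assumes \<phi>: "\<phi> \<in> states" and a: "a \<in> E" shows "Re (\<phi> a) \<in> {0..1}"
  using state_nonneg[OF \<phi> effectD(1)[OF a]] state_nonneg[OF \<phi> effectD(2)[OF a]] effectD(4)[OF a]
  by (simp add: state_minus[OF \<phi>] state_one[OF \<phi>])

lemma state_restrict_emod:
  assumes \<phi>: "\<phi> \<in> states"
  shows "(\<lambda>a\<in>E. Re (\<phi> a)) \<in> emod_maps (effects A) unit_emod"
proof (rule emod_unitI[OF effect_module_effects])
  interpret ef: effect_module "effects A" by (rule effect_module_effects)
  show "(\<lambda>a\<in>E. Re (\<phi> a)) x \<in> {0..1}" if "x \<in> E" for x using state_effect[OF \<phi> that] that by simp
  show "(\<lambda>a\<in>E. Re (\<phi> a)) (eone (effects A)) = 1"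
    using ef.eone_closed state_one[OF \<phi>] by simp
  show "(\<lambda>a\<in>E. Re (\<phi> a)) z = (\<lambda>a\<in>E. Re (\<phi> a)) x + (\<lambda>a\<in>E. Re (\<phi> a)) y"
    if xyz: "x \<in> E" "y \<in> E" "eplus (effects A) x y = Some z" for x y z
    using ef.eplus_closed[OF xyz] xyz effectD(4) state_add[OF \<phi>] by (auto split: if_splits)
  show "(\<lambda>a\<in>E. Re (\<phi> a)) (escale (effects A) r x) = r * (\<lambda>a\<in>E. Re (\<phi> a)) x"
    if "r \<in> {0..1}" "x \<in> E" for r x
    using ef.escale_closed[OF that] that effectD(4) state_smult[OF \<phi>] by simp
qed simp

text \<open>The element and its complement are \<open>(t + a)/(2t)\<close> and
  \<open>(t - a)/(2t)\<close>, and the norm bound puts both numerators in the cone. Every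
  self-adjoint element is thus an affine image of an effect.\<close>

lemma shifted_effect:
  assumes a: "a \<in> sa" and t: "cnorm A a \<le> t" "0 < t"
  shows "rscale (1 / (2 * t)) (a \<oplus> rscale t \<one>) \<in> E" (is "?e \<in> E")
proof -
  have "nonneg (rscale (1 / (2 * t)) (rscale t \<one> \<ominus> \<ominus> a))"
    using a t by (intro nonneg_scale nonneg_norm_diff) auto
  moreover have "nonneg (rscale (1 / (2 * t)) (rscale t \<one> \<ominus> a))"
    using a t by (intro nonneg_scale nonneg_norm_diff) auto
  moreover have "rscale (1 / (2 * t)) (rscale t \<one> \<ominus> \<ominus> a) = ?e"
    using a by (simp add: calg)
  moreover have "rscale (1 / (2 * t)) (rscale t \<one> \<ominus> a) = \<one> \<ominus> ?e"
    using a t by (simp add: calg)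
  ultimately show ?thesis by (simp add: effects_iff)
qed

text \<open>A map \<open>v\<close> on effects is extended to self-adjoint \<open>a\<close> through the effect \<open>(a + t)/(2t)\<close>.\<close>

lemma emod_extend:
  assumes v: "v \<in> emod_maps (effects A) unit_emod"
  shows "\<exists>\<phi>\<in>states. \<forall>a\<in>E. \<phi> a = complex_of_real (v a)"
proof -
  have v_add: "v (x \<oplus> y) = v x + v y" if "x \<in> E" "y \<in> E" "x \<oplus> y \<in> E" for x y
    using emod_unitD(4)[OF v that(1,2)] effectD(2)[OF that(3)] by (simp add: cle_one)
  have v_sc: "v (rscale r x) = r * v x" if "0 \<le> r" "r \<le> 1" "x \<in> E" for r x
    using emod_unitD(5)[OF v _ that(3), of r] that by simp
  have v_one: "v \<one> = 1" using emod_unitD(3)[OF v] by simp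
  have oneE: "\<one> \<in> E" by (simp add: effects_iff)
  define e where "e a t = rscale (1 / (2 * t)) (a \<oplus> rscale t \<one>)" for a t
  \<comment> \<open>Undoes the normalisation: \<open>a = 2 t e - t\<close>, and \<open>v\<close> is
    to send the unit to 1.\<close>
  define w where "w a t = 2 * t * v (e a t) - t" for a t
  have eE: "e a t \<in> E" if "a \<in> sa" "cnorm A a \<le> t" "0 < t" for a t
    unfolding e_def using that by (rule shifted_effect)
  \<comment> \<open>Raising the parameter from \<open>t\<close> to \<open>s\<close> replaces the
    effect by a combination of itself and the unit, with weights \<open>t/s\<close> and
    \<open>(s - t)/(2 s)\<close>. On both summands \<open>v\<close> is known.\<close>
  have w_indep: "w a s = w a t" if a: "a \<in> sa" and t: "cnorm A a \<le> t" "0 < t" and ts: "t \<le> s" for a s t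
  proof -
    have s: "0 < s" using t ts by simp
    have eq: "e a s = rscale (t / s) (e a t) \<oplus> rscale ((s - t) / (2 * s)) \<one>"
    proof -
      have "rscale (t / s) (e a t) \<oplus> rscale ((s - t) / (2 * s)) \<one>
          = rscale (t / s * (1 / (2 * t))) a \<oplus> rscale (t / s * (1 / (2 * t)) * t + (s - t) / (2 * s)) \<one>"
        using a by (simp add: e_def calg algebra_simps)
      also have "t / s * (1 / (2 * t)) = 1 / (2 * s)" using t s by (simp add: field_simps)
      also have "1 / (2 * s) * t + (s - t) / (2 * s) = 1 / (2 * s) * s" using t s by (simp add: field_simps)
      finally show ?thesis using a by (simp add: e_def calg)
    qed
    have "rscale (t / s) (e a t) \<in> E" "rscale ((s - t) / (2 * s)) \<one> \<in> E"
      using s t ts eE[OF a t] oneE by (auto intro!: effect_scale simp del: of_real_divide simp: field_simps)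
    then have "v (e a s) = v (rscale (t / s) (e a t)) + v (rscale ((s - t) / (2 * s)) \<one>)"
      using eE[of a s] a t ts s unfolding eq by (intro v_add) auto
    also have "\<dots> = t / s * v (e a t) + (s - t) / (2 * s)"
      using s t ts eE[OF a t] oneE v_one by (subst (1 2) v_sc) (auto simp: field_simps)
    finally show ?thesis using s t by (simp add: w_def field_simps)
  qed
  \<comment> \<open>The summand 1 keeps the parameter positive when \<open>a\<close> is 0.\<close>
  define g where "g a = w a (cnorm A a + 1)" for a
  have n0: "0 < cnorm A a + 1" if "a \<in> sa" for a using cnorm_nonneg[of a] that by (simp add: add_nonneg_pos)
  have g_w: "g a = w a t" if a: "a \<in> sa" and t: "cnorm A a \<le> t" "0 < t" for a t
    using w_indep[OF a t, of "max t (cnorm A a + 1)"] w_indep[OF a _ n0[OF a], of "max t (cnorm A a + 1)"]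
    by (simp add: g_def)
  have g_add: "g (a \<oplus> b) = g a + g b" if a: "a \<in> sa" and b: "b \<in> sa" for a b
  proof -
    define T where "T = cnorm A a + cnorm A b + 1"
    have na: "0 \<le> cnorm A a" and nb: "0 \<le> cnorm A b" using a b by auto
    then have T: "cnorm A a \<le> T" "cnorm A b \<le> T" "0 < T" by (auto simp: T_def)
    have ab: "a \<oplus> b \<in> sa" using a b by simp
    have "cnorm A (a \<oplus> b) \<le> cnorm A a + cnorm A b" using a b by (simp add: cnorm_add)
    moreover have "s \<le> 2 * (r + t + 1)" if "s \<le> r + t" "0 \<le> r" "0 \<le> t" for r s t :: real using that by simp
    ultimately have T2: "cnorm A (a \<oplus> b) \<le> 2 * T" unfolding T_def using na nb by blast
    \<comment> \<open>With a common parameter \<open>T\<close> for \<open>a\<close> and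
      \<open>b\<close>, doubling it for the sum makes the effect of the sum the midpoint of the two
      effects.\<close>
    have eq: "e (a \<oplus> b) (2 * T) = rscale (1/2) (e a T) \<oplus> rscale (1/2) (e b T)"
      using a b T by (simp add: e_def calg)
    have "rscale (1/2) (e a T) \<in> E" "rscale (1/2) (e b T) \<in> E"
      using eE a b T by (auto intro!: effect_scale simp del: of_real_divide)
    then have "v (e (a \<oplus> b) (2 * T)) = v (rscale (1/2) (e a T)) + v (rscale (1/2) (e b T))"
      using eE[OF ab T2] T unfolding eq by (intro v_add) auto
    also have "\<dots> = (v (e a T) + v (e b T)) / 2"
      using eE a b T by (subst (1 2) v_sc) (auto simp: field_simps)
    finally have vv: "v (e (a \<oplus> b) (2 * T)) = (v (e a T) + v (e b T)) / 2" .
    have T2pos: "0 < 2 * T" using T by simp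
    show ?thesis
      unfolding g_w[OF ab T2 T2pos] g_w[OF a T(1,3)] g_w[OF b T(2,3)] w_def vv by (simp add: field_simps)
  qed
  have g0: "g \<zero> = 0" using g_add[of "\<zero>" "\<zero>"] by simp
  \<comment> \<open>Scaling the parameter along with \<open>a\<close> leaves the normalised effect
    unchanged; \<open>g_w\<close> permits this parameter.\<close>
  have g_pos_sc: "g (rscale r a) = r * g a" if r: "0 < r" and a: "a \<in> sa" for r a
  proof -
    have n: "cnorm A (rscale r a) \<le> r * (cnorm A a + 1)" using r a by (simp add: cnorm_smult algebra_simps)
    have ee: "e (rscale r a) (r * (cnorm A a + 1)) = e a (cnorm A a + 1)"
    proof -
      have "1 / (2 * (r * (cnorm A a + 1))) * r = 1 / (2 * (cnorm A a + 1))" using r by simp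
      then have *: "complex_of_real (1 / (2 * (r * (cnorm A a + 1)))) * complex_of_real r = complex_of_real (1 / (2 * (cnorm A a + 1)))"
        by (metis of_real_mult)
      have "rscale r a \<oplus> rscale (r * (cnorm A a + 1)) \<one> = rscale r (a \<oplus> rscale (cnorm A a + 1) \<one>)"
        using a by (simp add: smult_dist)
      then show ?thesis using a by (simp add: e_def * del: of_real_divide of_real_mult of_real_add)
    qed
    have "0 < r * (cnorm A a + 1)" using r n0[OF a] by (rule mult_pos_pos)
    from g_w[OF sa_smult[OF a] n this] show ?thesis
      by (simp only: g_def[of a] w_def ee) (simp add: algebra_simps)
  qed
  have g_sc: "g (rscale r a) = r * g a" if a: "a \<in> sa" for r a
  proof -
    consider "r > 0" | "r = 0" | "r < 0" by linarith
    then show ?thesis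
    proof cases
      case 3
      have "rscale r a \<oplus> rscale (- r) a = \<zero>" using a by (simp add: collect)
      then have "g (rscale r a) + g (rscale (- r) a) = 0" using g_add[of "rscale r a" "rscale (- r) a"] g0 a
        by (simp del: of_real_minus)
      then show ?thesis using g_pos_sc[of "- r" a] 3 a by (simp del: of_real_minus)
    qed (use g_pos_sc a g0 in auto)
  qed
  \<comment> \<open>For \<open>a\<close> in the cone the unshifted \<open>a/(2T)\<close> is already
    an effect and the shift contributes exactly one half. This gives positivity of \<open>g\<close>
    and its agreement with \<open>v\<close> on effects.\<close>
  have g_nonneg: "g a = 2 * T * v (rscale (1 / (2 * T)) a)" "rscale (1 / (2 * T)) a \<in> E"
    if a: "nonneg a" and T: "cnorm A a \<le> T" "0 < T" for a T
  proof -
    have "nonneg (\<one> \<ominus> rscale (1 / (2 * T)) a)"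
    proof -
      have "nonneg (rscale (1 / (2 * T)) (rscale T \<one> \<ominus> a) \<oplus> rscale (1 / 2) \<one>)"
        using a T by (intro nonneg_add nonneg_scale nonneg_norm_diff) auto
      also have "rscale (1 / (2 * T)) (rscale T \<one> \<ominus> a) \<oplus> rscale (1 / 2) \<one> = \<one> \<ominus> rscale (1 / (2 * T)) a"
        using a T by (simp add: calg)
      finally show ?thesis .
    qed
    then show aE: "rscale (1 / (2 * T)) a \<in> E"
      using a T by (simp add: effects_iff nonneg_scale del: of_real_divide of_real_mult)
    have eq: "e a T = rscale (1 / (2 * T)) a \<oplus> rscale (1/2) \<one>"
      using a T by (simp add: e_def calg)
    have hE: "rscale (1/2) \<one> \<in> E" using effect_scale[OF _ _ oneE, of "1/2"] by simp
    have "v (e a T) = v (rscale (1 / (2 * T)) a) + v (rscale (1/2) \<one>)"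
      using aE hE eE[OF _ T] a unfolding eq by (intro v_add) auto
    also have "v (rscale (1/2) \<one>) = 1/2" using v_sc[OF _ _ oneE, of "1/2"] v_one by simp
    finally show "g a = 2 * T * v (rscale (1 / (2 * T)) a)"
      using g_w[OF _ T] a T by (simp add: w_def algebra_simps)
  qed
  have g_pos: "0 \<le> g a" if a: "nonneg a" for a
  proof -
    have n: "cnorm A a \<le> cnorm A a + 1" by simp
    have "0 \<le> v (rscale (1 / (2 * (cnorm A a + 1))) a)"
      using emod_unitD(1)[OF v g_nonneg(2)[OF a n n0]] a by simp
    then show ?thesis using g_nonneg(1)[OF a n n0] n0[of a] a by simp
  qed
  have g_E: "g a = v a" if a: "a \<in> E" for a
  proof -
    have n: "cnorm A a \<le> cnorm A a + 1" by simp
    have p: "1 \<le> cnorm A a + 1" using effectD(4)[OF a] by simp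
    then have "v (rscale (1 / (2 * (cnorm A a + 1))) a) = 1 / (2 * (cnorm A a + 1)) * v a"
      using a by (intro v_sc) auto
    then show ?thesis using g_nonneg(1)[OF effectD(1)[OF a] n] p by simp
  qed
  have "g \<one> = 1" using g_E[OF oneE] v_one by simp
  then obtain \<phi> where "\<phi> \<in> states" "\<forall>a\<in>sa. \<phi> a = complex_of_real (g a)"
    using state_extend[OF g_add g_sc g_pos] by blast
  then show ?thesis using g_E effectD(3) by (intro bexI[of _ \<phi>]) auto
qed

lemma states_eqI_sa:
  assumes "\<phi> \<in> states" "\<psi> \<in> states" "\<And>a. a \<in> sa \<Longrightarrow> Re (\<phi> a) = Re (\<psi> a)"
  shows "\<phi> = \<psi>"
proof (rule pu_maps_eqI[OF assms(1,2)])
  fix x assume x: "x \<in> carrier A"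
  have sa: "\<phi> a = \<psi> a" if "a \<in> sa" for a
    using state_sa(1)[OF assms(1) that] state_sa(1)[OF assms(2) that] assms(3)[OF that] by (simp add: complex_eq_iff)
  show "\<phi> x = \<psi> x"
    using x sa[of "re_part x"] sa[of "im_part x"]
    by (subst (1 2) re_im[OF x]) (simp add: state_add[OF assms(1)] state_add[OF assms(2)] state_smult[OF assms(1)] state_smult[OF assms(2)])
qed

text \<open>A state's value at self-adjoint \<open>a\<close> can be recovered from its value at the
  effect \<open>(a + t)/(2t)\<close>.\<close>

lemma states_eqI_effects:
  assumes "\<phi> \<in> states" "\<psi> \<in> states" "\<And>a. a \<in> E \<Longrightarrow> Re (\<phi> a) = Re (\<psi> a)"
  shows "\<phi> = \<psi>"
proof (rule states_eqI_sa[OF assms(1,2)])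
  fix a assume a: "a \<in> sa"
  define t where "t = cnorm A a + 1"
  have t: "0 < t" "cnorm A a \<le> t" using cnorm_nonneg[of a] a by (auto simp: t_def add_nonneg_pos)
  define b where "b = rscale (1 / (2 * t)) (a \<oplus> rscale t \<one>)"
  have "b \<in> E" unfolding b_def using a t(2,1) by (rule shifted_effect)
  then have "Re (\<phi> b) = Re (\<psi> b)" by (rule assms(3))
  moreover have "Re (\<phi> b) = (Re (\<phi> a) + t) / (2 * t)" if "\<phi> \<in> states" for \<phi>
    using a that by (simp add: b_def state_smult[OF that] state_add[OF that] state_one[OF that] del: of_real_divide)
  ultimately show "Re (\<phi> a) = Re (\<psi> a)" using assms t by simp
qed

text \<open>A state is real at a self-adjoint \<open>a\<close>, so the coordinate function is the
  \<open>cplx\<close> of its real part.\<close>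

lemma mean_eval_sa:
  assumes a: "a \<in> sa" and \<omega>: "\<omega> \<in> pu_maps (cfun (stat A)) complex_cstar"
  shows "Re (barycentre A \<omega> a) = mean (stat A) \<omega> (\<lambda>\<phi>. Re (\<phi> a))"
proof -
  have "(\<lambda>\<phi>\<in>states. \<phi> a) = cplx states (\<lambda>\<phi>. Re (\<phi> a))"
    unfolding cplx_def by (rule restrict_ext) (simp add: complex_eq_iff state_sa(1)[OF _ a])
  then show ?thesis using a by (simp add: barycentre_def mean_def)
qed

lemma continuous_eval_Re:
  "a \<in> carrier A \<Longrightarrow> continuous_map (stat A) euclideanreal (\<lambda>\<phi>. Re (\<phi> a))"
  by (intro continuous_map_euclidean_compose[where g = Re] continuous_map_stat_eval) (auto intro: continuous_intros)

lemma effect_em: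
  assumes a: "a \<in> E"
  shows "(\<lambda>\<phi>\<in>states. Re (\<phi> a)) \<in> em_maps (stat_alg A) unit_alg"
  using em_unitI[OF radon_algebra_stat[OF cstar_algebra_axioms], of "\<lambda>\<phi>. Re (\<phi> a)"]
    continuous_eval_Re[OF effectD(4)[OF a]] state_effect[OF _ a] mean_eval_sa[OF effectD(3)[OF a]]
  by (simp add: act_stat_alg)

lemma cstar_state_iso_em: "cstar_state_iso A \<in> em_maps (stat_alg A) (emod_dual (effects A))"
  unfolding em_maps_emod_dual_iff[OF radon_algebra_stat[OF cstar_algebra_axioms] effect_module_effects]
proof (intro conjI ballI)
  show "cstar_state_iso A \<in> extensional (points (stat_alg A))" by (simp add: cstar_state_iso_def)
  show "cstar_state_iso A \<phi> \<in> emod_maps (effects A) unit_emod" if "\<phi> \<in> points (stat_alg A)" for \<phi>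
    using state_restrict_emod that by (simp add: cstar_state_iso_def)
  fix a assume a: "a \<in> E"
  have "(\<lambda>\<phi>\<in>points (stat_alg A). cstar_state_iso A \<phi> a) = (\<lambda>\<phi>\<in>states. Re (\<phi> a))"
    unfolding cstar_state_iso_def using a by (auto intro!: restrict_ext)
  then show "(\<lambda>\<phi>\<in>points (stat_alg A). cstar_state_iso A \<phi> a) \<in> em_maps (stat_alg A) unit_alg"
    using effect_em[OF a] by simp
qed

lemma cstar_state_iso_bij: "bij_betw (cstar_state_iso A) states (emod_maps (effects A) unit_emod)"
  unfolding bij_betw_def
proof
  show "inj_on (cstar_state_iso A) states"
  proof (rule inj_onI)
    fix \<phi> \<psi> assume \<phi>: "\<phi> \<in> states" and \<psi>: "\<psi> \<in> states" and eq: "cstar_state_iso A \<phi> = cstar_state_iso A \<psi>"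
    have "Re (\<phi> a) = Re (\<psi> a)" if "a \<in> E" for a
      using fun_cong[OF eq, of a] that \<phi> \<psi> by (simp add: cstar_state_iso_def)
    then show "\<phi> = \<psi>" by (rule states_eqI_effects[OF \<phi> \<psi>])
  qed
  show "cstar_state_iso A ` states = emod_maps (effects A) unit_emod"
  proof (intro equalityI subsetI)
    fix v assume v: "v \<in> emod_maps (effects A) unit_emod"
    obtain \<phi> where \<phi>: "\<phi> \<in> states" "\<forall>a\<in>E. \<phi> a = complex_of_real (v a)" using emod_extend[OF v] by blast
    have "cstar_state_iso A \<phi> = v"
      by (rule extensionalityI[of _ E]) (use \<phi> emod_unitD(2)[OF v] in \<open>simp_all add: cstar_state_iso_def\<close>)
    then show "v \<in> cstar_state_iso A ` states" using \<phi>(1) by blast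
  qed (use state_restrict_emod in \<open>auto simp: cstar_state_iso_def\<close>)
qed

lemma cstar_state_em_iso: "em_iso (stat_alg A) (emod_dual (effects A)) (cstar_state_iso A)"
  using cstar_state_iso_bij
  by (intro em_isoI radon_algebra_stat cstar_algebra_axioms radon_algebra_emod_dual effect_module_effects cstar_state_iso_em) simp

end


section \<open>Affine continuous functions are uniformly approximated by effects\<close>

text \<open>Specialises \<open>state_extend\<close> to C(X), with the functional given on real
  functions instead of on self-adjoint complex ones.\<close>

lemma state_of_functional:
  assumes X: "ch_space X"
    and add: "\<And>p q. continuous_map X euclideanreal p \<Longrightarrow> continuous_map X euclideanreal q \<Longrightarrow> F (\<lambda>x. p x + q x) = F p + F q"
    and scale: "\<And>r p. continuous_map X euclideanreal p \<Longrightarrow> F (\<lambda>x. r * p x) = r * F p"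
    and pos: "\<And>p. continuous_map X euclideanreal p \<Longrightarrow> (\<And>x. x \<in> topspace X \<Longrightarrow> 0 \<le> p x) \<Longrightarrow> 0 \<le> F p"
    and one: "F (\<lambda>x. 1) = (1::real)"
  shows "\<exists>h\<in>pu_maps (cfun X) complex_cstar. \<forall>p. continuous_map X euclideanreal p \<longrightarrow> mean X h p = F p"
proof -
  interpret C: cstar_algebra "cfun X" using X by (rule cfun_cstar)
  \<comment> \<open>The functional takes functions on the whole type. Positivity, applied to
    differences that vanish on \<open>topspace X\<close>, makes it depend only on values
    there.\<close>
  have cong: "F p = F q" if "continuous_map X euclideanreal p" "continuous_map X euclideanreal q"
    "\<And>x. x \<in> topspace X \<Longrightarrow> p x = q x" for p q
  proof -
    have "F p \<le> F q" if c: "continuous_map X euclideanreal p" "continuous_map X euclideanreal q"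
      and eq: "\<And>x. x \<in> topspace X \<Longrightarrow> p x = q x" for p q
    proof -
      have c': "continuous_map X euclideanreal (\<lambda>x. -1 * p x)" using c by (intro continuous_map_real_mult_left)
      have "0 \<le> F (\<lambda>x. q x + -1 * p x)"
        using eq by (intro pos continuous_map_add c c') simp
      then show ?thesis using add[OF c(2) c'] scale[OF c(1), of "-1"] by simp
    qed
    from this[OF that] this[OF that(2,1)] that(3) show ?thesis by (simp add: order_antisym)
  qed
  define g where "g v = F (\<lambda>x. Re (v x))" for v :: "'a \<Rightarrow> complex"
  have cont: "continuous_map X euclideanreal (\<lambda>x. Re (v x))" if "v \<in> C.sa" for v
    using C.sa_carrier[OF that] ch_mapsD[of v X euclidean]
    by (intro continuous_map_euclidean_compose[where g = Re]) (auto intro: continuous_intros)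
  have "\<exists>h\<in>pu_maps (cfun X) complex_cstar. \<forall>v\<in>C.sa. h v = complex_of_real (g v)"
  proof (rule C.state_extend)
    fix v w assume v: "v \<in> C.sa" and w: "w \<in> C.sa"
    have "g (v \<oplus>\<^bsub>cfun X\<^esub> w) = F (\<lambda>x. Re (v x) + Re (w x))"
      unfolding g_def by (rule cong) (use cont[OF C.sa_add[OF v w]] cont[OF v] cont[OF w] in \<open>simp_all add: continuous_map_add\<close>)
    then show "g (v \<oplus>\<^bsub>cfun X\<^esub> w) = g v + g w" using add[OF cont[OF v] cont[OF w]] by (simp add: g_def)
  next
    fix r v assume v: "v \<in> C.sa"
    have "g (complex_of_real r \<odot>\<^bsub>cfun X\<^esub> v) = F (\<lambda>x. r * Re (v x))"
      unfolding g_def by (rule cong) (use cont[OF C.sa_smult[OF v, of r]] cont[OF v] in \<open>simp_all add: continuous_map_real_mult_left\<close>)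
    then show "g (complex_of_real r \<odot>\<^bsub>cfun X\<^esub> v) = r * g v" using scale[OF cont[OF v]] by (simp add: g_def)
  next
    fix v assume v: "C.nonneg v"
    then have "positive (cfun X) v" by (simp add: C.positive_iff)
    then have "\<And>x. x \<in> topspace X \<Longrightarrow> 0 \<le> Re (v x)" by (simp add: positive_cfun)
    then show "0 \<le> g v" unfolding g_def using cont[OF C.nonneg_sa[OF v]] by (intro pos)
  next
    have "g \<one>\<^bsub>cfun X\<^esub> = F (\<lambda>x. 1)"
      unfolding g_def by (rule cong) (use cont[OF C.sa_one] in simp_all)
    then show "g \<one>\<^bsub>cfun X\<^esub> = 1" using one by simp
  qed
  then obtain h where h: "h \<in> pu_maps (cfun X) complex_cstar" "\<forall>v\<in>C.sa. h v = complex_of_real (g v)" by blast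
  have "mean X h p = F p" if p: "continuous_map X euclideanreal p" for p
  proof -
    have sa: "cplx (topspace X) p \<in> C.sa"
    proof (rule C.saI)
      show "star (cfun X) (cplx (topspace X) p) = cplx (topspace X) p"
        by (auto simp: cplx_def intro!: restrict_ext)
    qed (use p in simp)
    have "g (cplx (topspace X) p) = F p"
      unfolding g_def by (rule cong) (use cont[OF sa] p in \<open>simp_all add: cplx_def\<close>)
    then show ?thesis using h(2) sa by (simp add: mean_def)
  qed
  then show ?thesis using h(1) by blast
qed

text \<open>If no \<open>e \<in> E\<close> is close to \<open>f\<close>, then Hahn-Banach on \<open>C(X) \<times> C(X)\<close>, applied to the sublinear
  functional \<open>(g\<^sub>1, g\<^sub>2) \<mapsto> inf\<^sub>e max (sup (g\<^sub>1 + e)) (sup (g\<^sub>2 - e))\<close> at \<open>(f, -f)\<close>, yields two states that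
  agree on \<open>E\<close> but not on \<open>f\<close>.\<close>

lemma uniform_approximation:
  fixes X :: "'x topology" and f :: "'x \<Rightarrow> real"
  assumes X: "ch_space X"
    and cont: "\<And>e. e \<in> E \<Longrightarrow> continuous_map X euclideanreal e"
    and add: "\<And>e e'. e \<in> E \<Longrightarrow> e' \<in> E \<Longrightarrow> (\<lambda>x. e x + e' x) \<in> E"
    and scale: "\<And>r e. e \<in> E \<Longrightarrow> (\<lambda>x. r * e x) \<in> E"
    and one: "(\<lambda>x. 1) \<in> E"
    and f: "continuous_map X euclideanreal f"
    and sep: "\<And>h k. h \<in> pu_maps (cfun X) complex_cstar \<Longrightarrow> k \<in> pu_maps (cfun X) complex_cstar \<Longrightarrow>
      (\<And>e. e \<in> E \<Longrightarrow> mean X h e = mean X k e) \<Longrightarrow> mean X h f = mean X k f"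
    and eps: "0 < \<epsilon>"
  shows "\<exists>e\<in>E. \<forall>x\<in>topspace X. \<bar>f x - e x\<bar> \<le> \<epsilon>"
proof (cases "topspace X = {}")
  case True then show ?thesis using one by auto
next
  case False
  then obtain x0 where x0: "x0 \<in> topspace X" by blast
  define V where "V = {u :: ('x \<Rightarrow> real) \<times> ('x \<Rightarrow> real). continuous_map X euclideanreal (fst u) \<and> continuous_map X euclideanreal (snd u)}"
  define pl where "pl u w = ((\<lambda>x. fst u x + fst w x), (\<lambda>x. snd u x + snd w x))" for u w :: "('x \<Rightarrow> real) \<times> ('x \<Rightarrow> real)"
  define sc where "sc r u = ((\<lambda>x. r * fst u x), (\<lambda>x. r * snd u x))" for r and u :: "('x \<Rightarrow> real) \<times> ('x \<Rightarrow> real)"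
  define z :: "('x \<Rightarrow> real) \<times> ('x \<Rightarrow> real)" where "z = ((\<lambda>x. 0), (\<lambda>x. 0))"
  interpret rv: real_vec V pl sc z
    by unfold_locales (auto simp: V_def pl_def sc_def z_def algebra_simps intro: continuous_map_add continuous_map_real_mult_left)
  define U where "U u = {t. \<exists>e\<in>E. \<forall>x\<in>topspace X. fst u x + e x \<le> t \<and> snd u x - e x \<le> t}" for u
  define p where "p u = Inf (U u)" for u
  have zeroE: "(\<lambda>x. 0) \<in> E" using scale[OF one, of 0] by simp
  \<comment> \<open>Adding the two inequalities at \<open>x0\<close> eliminates \<open>e\<close>.
    This needs a point, hence the separate case of the empty space.\<close>
  have lower: "(fst u x0 + snd u x0) / 2 \<le> t" if "t \<in> U u" for u t
    using that x0 by (fastforce simp: U_def)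
  have bdd: "bdd_below (U u)" for u using lower by (rule bdd_belowI)
  have upper: "U u \<noteq> {}" if "u \<in> V" for u
  proof -
    have bnd: "\<exists>B. \<forall>x\<in>topspace X. g x \<le> B" if "continuous_map X euclideanreal g" for g
    proof -
      have "compactin euclideanreal (g ` topspace X)"
        using X that by (intro image_compactin) (auto simp: ch_space_def compact_space_def)
      then have "bounded (g ` topspace X)" by (simp add: compact_imp_bounded)
      then show ?thesis by (force simp: bounded_iff abs_le_iff)
    qed
    have c: "continuous_map X euclideanreal (fst u)" "continuous_map X euclideanreal (snd u)"
      using that by (auto simp: V_def)
    obtain B B' where "\<forall>x\<in>topspace X. fst u x \<le> B" "\<forall>x\<in>topspace X. snd u x \<le> B'"
      using bnd[OF c(1)] bnd[OF c(2)] by blast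
    then have "max B B' \<in> U u" unfolding U_def using zeroE by (auto intro!: bexI[of _ "\<lambda>x. 0"] simp: le_max_iff_disj)
    then show ?thesis by blast
  qed
  have p_le: "p u \<le> t" if "e \<in> E" "\<And>x. x \<in> topspace X \<Longrightarrow> fst u x + e x \<le> t \<and> snd u x - e x \<le> t" for u t e
    unfolding p_def using that by (intro cInf_lower bdd) (auto simp: U_def)
  have p_ge: "b \<le> p u" if "u \<in> V" "\<And>t e. e \<in> E \<Longrightarrow> (\<And>x. x \<in> topspace X \<Longrightarrow> fst u x + e x \<le> t \<and> snd u x - e x \<le> t) \<Longrightarrow> b \<le> t" for b u
    unfolding p_def using upper[OF that(1)] that(2) by (intro cInf_greatest) (auto simp: U_def)
  have sub: "rv.sublinear p"
  proof (rule rv.sublinearI)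
    fix u w assume u: "u \<in> V" and w: "w \<in> V"
    have "p (pl u w) - t \<le> s" if "e \<in> E" "\<And>x. x \<in> topspace X \<Longrightarrow> fst u x + e x \<le> t \<and> snd u x - e x \<le> t"
      "e' \<in> E" "\<And>x. x \<in> topspace X \<Longrightarrow> fst w x + e' x \<le> s \<and> snd w x - e' x \<le> s" for t s e e'
    proof -
      have "p (pl u w) \<le> t + s"
      proof (rule p_le[OF add[OF that(1,3)]])
        show "fst (pl u w) x + (e x + e' x) \<le> t + s \<and> snd (pl u w) x - (e x + e' x) \<le> t + s" if "x \<in> topspace X" for x
          using \<open>\<And>x. x \<in> topspace X \<Longrightarrow> fst u x + e x \<le> t \<and> snd u x - e x \<le> t\<close>[OF that]
            \<open>\<And>x. x \<in> topspace X \<Longrightarrow> fst w x + e' x \<le> s \<and> snd w x - e' x \<le> s\<close>[OF that] by (simp add: pl_def)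
      qed
      then show ?thesis by simp
    qed
    then have "p (pl u w) - t \<le> p w" if "e \<in> E" "\<And>x. x \<in> topspace X \<Longrightarrow> fst u x + e x \<le> t \<and> snd u x - e x \<le> t" for t e
      using that by (intro p_ge[OF w]) blast
    then have "p (pl u w) - p w \<le> t" if "e \<in> E" "\<And>x. x \<in> topspace X \<Longrightarrow> fst u x + e x \<le> t \<and> snd u x - e x \<le> t" for t e
      using that by fastforce
    then have "p (pl u w) - p w \<le> p u" by (rule p_ge[OF u])
    then show "p (pl u w) \<le> p u + p w" by simp
  next
    fix r u assume r: "(0::real) < r" and u: "u \<in> V"
    have "p (sc r u) / r \<le> t" if e: "e \<in> E" "\<And>x. x \<in> topspace X \<Longrightarrow> fst u x + e x \<le> t \<and> snd u x - e x \<le> t" for t e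
    proof -
      have "p (sc r u) \<le> r * t"
      proof (rule p_le[OF scale[OF e(1), of r]])
        show "fst (sc r u) x + r * e x \<le> r * t \<and> snd (sc r u) x - r * e x \<le> r * t" if "x \<in> topspace X" for x
          using e(2)[OF that] r by (simp add: sc_def distrib_left[symmetric] right_diff_distrib[symmetric])
      qed
      then show ?thesis using r by (simp add: field_simps)
    qed
    then have "p (sc r u) / r \<le> p u" by (rule p_ge[OF u])
    then show "p (sc r u) \<le> r * p u" using r by (simp add: field_simps)
  next
    have "p z \<le> 0" by (rule p_le[OF zeroE]) (simp add: z_def)
    moreover have "0 \<le> p z"
    proof (rule p_ge)
      fix t e assume "e \<in> E" "\<And>x. x \<in> topspace X \<Longrightarrow> fst z x + e x \<le> t \<and> snd z x - e x \<le> t"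
      from this(2)[OF x0] show "0 \<le> t" by (simp add: z_def)
    qed simp
    ultimately show "p z = 0" by simp
  qed
  have fV: "(f, \<lambda>x. -1 * f x) \<in> V" unfolding V_def using f continuous_map_real_mult_left[OF f, of "-1"] by simp
  obtain F where F_add: "\<And>u w. u \<in> V \<Longrightarrow> w \<in> V \<Longrightarrow> F (pl u w) = F u + F w"
    and F_sc: "\<And>r u. u \<in> V \<Longrightarrow> F (sc r u) = r * F u"
    and F_le: "\<And>u. u \<in> V \<Longrightarrow> F u \<le> p u" and F_f: "F (f, \<lambda>x. -1 * f x) = p (f, \<lambda>x. -1 * f x)"
    by (rule rv.hahn_banach[OF sub fV]) (rule that)
  define F1 where "F1 g = F (g, \<lambda>x. 0)" for g
  define F2 where "F2 g = F (\<lambda>x. 0, g)" for g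
  have split: "F (g, k) = F1 g + F2 k" if "continuous_map X euclideanreal g" "continuous_map X euclideanreal k" for g k
    using F_add[of "(g, \<lambda>x. 0)" "(\<lambda>x. 0, k)"] that by (simp add: V_def pl_def F1_def F2_def)
  have add12: "F1 (\<lambda>x. g x + k x) = F1 g + F1 k" "F2 (\<lambda>x. g x + k x) = F2 g + F2 k"
    if "continuous_map X euclideanreal g" "continuous_map X euclideanreal k" for g k
    using F_add[of "(g, \<lambda>x. 0)" "(k, \<lambda>x. 0)"] F_add[of "(\<lambda>x. 0, g)" "(\<lambda>x. 0, k)"] that
    by (simp_all add: V_def pl_def F1_def F2_def)
  have sc12: "F1 (\<lambda>x. r * g x) = r * F1 g" "F2 (\<lambda>x. r * g x) = r * F2 g" if "continuous_map X euclideanreal g" for g r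
    using F_sc[of "(g, \<lambda>x. 0)" r] F_sc[of "(\<lambda>x. 0, g)" r] that by (simp_all add: V_def sc_def F1_def F2_def)
  \<comment> \<open>The choice \<open>e = 0\<close> shows that \<open>p\<close> is at most 0 at a
    pair with nonpositive entries.\<close>
  have pos12: "0 \<le> F1 g" "0 \<le> F2 g" if c: "continuous_map X euclideanreal g" and g: "\<And>x. x \<in> topspace X \<Longrightarrow> 0 \<le> g x" for g
  proof -
    have c': "continuous_map X euclideanreal (\<lambda>x. -1 * g x)" using c by (rule continuous_map_real_mult_left)
    have "p (\<lambda>x. -1 * g x, \<lambda>x. 0) \<le> 0" "p (\<lambda>x. 0, \<lambda>x. -1 * g x) \<le> 0"
      by (rule p_le[OF zeroE]; use g in simp)+
    then have "F1 (\<lambda>x. -1 * g x) \<le> 0" "F2 (\<lambda>x. -1 * g x) \<le> 0"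
      using F_le[of "(\<lambda>x. -1 * g x, \<lambda>x. 0)"] F_le[of "(\<lambda>x. 0, \<lambda>x. -1 * g x)"] c' by (simp_all add: V_def F1_def F2_def)
    then show "0 \<le> F1 g" "0 \<le> F2 g" using sc12[OF c, of "-1"] by simp_all
  qed
  \<comment> \<open>The witness \<open>-e\<close> makes both entries of \<open>(e, -e)\<close>
    vanish, so \<open>F1 e <= F2 e\<close>. The same for \<open>-e\<close> gives equality.\<close>
  have agree: "F1 e = F2 e" if e: "e \<in> E" for e
  proof -
    have "F1 e \<le> F2 e" if e: "e \<in> E" for e
    proof -
      have c': "continuous_map X euclideanreal (\<lambda>x. -1 * e x)" using cont[OF e] by (rule continuous_map_real_mult_left)
      have "p (e, \<lambda>x. -1 * e x) \<le> 0" by (rule p_le[OF scale[OF e, of "-1"]]) simp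
      then have "F (e, \<lambda>x. -1 * e x) \<le> 0" using F_le[of "(e, \<lambda>x. -1 * e x)"] cont[OF e] c' by (simp add: V_def)
      then show ?thesis using split[OF cont[OF e] c'] sc12(2)[OF cont[OF e], of "-1"] by simp
    qed
    from this[OF e] this[OF scale[OF e, of "-1"]] show ?thesis
      using sc12[OF cont[OF e], of "-1"] by simp
  qed
  \<comment> \<open>The value of \<open>F\<close> at \<open>(1, 1)\<close> is 1, and the two parts
    agree on constants. Doubling them therefore yields states.\<close>
  have half: "F1 (\<lambda>x. 1) = 1/2" "F2 (\<lambda>x. 1) = 1/2"
  proof -
    have V1: "(\<lambda>x. 1, \<lambda>x. 1) \<in> V" by (simp add: V_def)
    have "p (\<lambda>x. 1, \<lambda>x. 1) \<le> 1" "p (sc (-1) (\<lambda>x. 1, \<lambda>x. 1)) \<le> -1"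
      by (rule p_le[OF zeroE]; simp add: sc_def)+
    then have "F (\<lambda>x. 1, \<lambda>x. 1) = 1"
      using F_le[OF V1] F_le[OF rv.sc_closed[OF V1, of "-1"]] F_sc[OF V1, of "-1"] by simp
    then have "F1 (\<lambda>x. 1) + F2 (\<lambda>x. 1) = 1" using split[of "\<lambda>x. 1" "\<lambda>x. 1"] by simp
    then show "F1 (\<lambda>x. 1) = 1/2" "F2 (\<lambda>x. 1) = 1/2" using agree[OF one] by simp_all
  qed
  obtain h where h: "h \<in> pu_maps (cfun X) complex_cstar" "\<And>g. continuous_map X euclideanreal g \<Longrightarrow> mean X h g = 2 * F1 g"
    using state_of_functional[OF X, of "\<lambda>g. 2 * F1 g"] add12(1) sc12(1) pos12(1) half(1) by (auto simp: algebra_simps)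
  obtain k where k: "k \<in> pu_maps (cfun X) complex_cstar" "\<And>g. continuous_map X euclideanreal g \<Longrightarrow> mean X k g = 2 * F2 g"
    using state_of_functional[OF X, of "\<lambda>g. 2 * F2 g"] add12(2) sc12(2) pos12(2) half(2) by (auto simp: algebra_simps)
  have "mean X h f = mean X k f"
    by (rule sep[OF h(1) k(1)]) (simp add: h(2) k(2) cont agree)
  then have "F1 f = F2 f" using h(2)[OF f] k(2)[OF f] by simp
  \<comment> \<open>By the choice of \<open>F\<close> this value is
    \<open>F1 f - F2 f\<close>.\<close>
  then have "p (f, \<lambda>x. -1 * f x) = 0"
    using F_f split[OF f continuous_map_real_mult_left[OF f, of "-1"]] sc12(2)[OF f, of "-1"] by simp
  then have "Inf (U (f, \<lambda>x. -1 * f x)) < \<epsilon>" using eps by (simp add: p_def)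
  then obtain t where "t \<in> U (f, \<lambda>x. -1 * f x)" "t < \<epsilon>"
    using cInf_lessD[OF upper[OF fV]] by blast
  then obtain e where e: "e \<in> E" "\<And>x. x \<in> topspace X \<Longrightarrow> f x + e x \<le> t \<and> -1 * f x - e x \<le> t"
    by (auto simp: U_def)
  \<comment> \<open>The two inequalities bound \<open>f + e\<close> and its negative, so the
    approximant is \<open>-e\<close>.\<close>
  have cl: "\<bar>f x - -1 * e x\<bar> \<le> \<epsilon>" if "x \<in> topspace X" for x
    using e(2)[OF that] \<open>t < \<epsilon>\<close> by (auto simp: abs_le_iff)
  show ?thesis by (rule bexI[OF _ scale[OF e(1), of "-1"]]) (rule ballI, rule cl)
qed


context cstar_algebra
begin

lemma em_unit_approximation:
  assumes f: "f \<in> em_maps (stat_alg A) unit_alg" and eps: "0 < \<epsilon>"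
  shows "\<exists>a\<in>sa. \<forall>\<phi>\<in>states. \<bar>f \<phi> - Re (\<phi> a)\<bar> \<le> \<epsilon>"
proof -
  \<comment> \<open>Members only have to agree with an evaluation on the states, so the set is
    closed under unrestricted pointwise operations.\<close>
  let ?G = "{g. continuous_map (stat A) euclideanreal g \<and> (\<exists>a\<in>sa. \<forall>\<phi>\<in>states. g \<phi> = Re (\<phi> a))}"
  have "\<exists>e\<in>?G. \<forall>\<phi>\<in>topspace (stat A). \<bar>f \<phi> - e \<phi>\<bar> \<le> \<epsilon>"
  proof (rule uniform_approximation)
    show "ch_space (stat A)" by (rule ch_space_stat)
    show "continuous_map (stat A) euclideanreal f" using em_unitD(1)[OF f] by simp
    show "(\<lambda>\<phi>. e \<phi> + e' \<phi>) \<in> ?G" if e: "e \<in> ?G" "e' \<in> ?G" for e e'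
    proof -
      obtain a b where "a \<in> sa" "\<forall>\<phi>\<in>states. e \<phi> = Re (\<phi> a)" "b \<in> sa" "\<forall>\<phi>\<in>states. e' \<phi> = Re (\<phi> b)"
        using e by auto
      then have "\<exists>c\<in>sa. \<forall>\<phi>\<in>states. e \<phi> + e' \<phi> = Re (\<phi> c)"
        by (intro bexI[of _ "a \<oplus> b"]) (auto simp: state_add)
      then show ?thesis using e by (simp add: continuous_map_add)
    qed
    show "(\<lambda>\<phi>. r * e \<phi>) \<in> ?G" if e: "e \<in> ?G" for r e
    proof -
      obtain a where "a \<in> sa" "\<forall>\<phi>\<in>states. e \<phi> = Re (\<phi> a)" using e by auto
      then have "\<exists>c\<in>sa. \<forall>\<phi>\<in>states. r * e \<phi> = Re (\<phi> c)"
        by (intro bexI[of _ "rscale r a"]) (auto simp: state_smult)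
      then show ?thesis using e by (simp add: continuous_map_real_mult_left)
    qed
    have "\<exists>c\<in>sa. \<forall>\<phi>\<in>states. 1 = Re (\<phi> c)" by (intro bexI[of _ \<one>]) (auto simp: state_one)
    then show "(\<lambda>\<phi>. 1) \<in> ?G" by simp
    fix h k assume h: "h \<in> pu_maps (cfun (stat A)) complex_cstar" and k: "k \<in> pu_maps (cfun (stat A)) complex_cstar"
      and eq: "\<And>e. e \<in> ?G \<Longrightarrow> mean (stat A) h e = mean (stat A) k e"
    \<comment> \<open>The members of \<open>?G\<close> include all evaluations at self-adjoint
      elements, and these separate states. The mean of \<open>f\<close> is its value at the
      barycentre.\<close>
    have "barycentre A h = barycentre A k"
    proof (rule states_eqI_sa[OF barycentre_closed[OF cstar_algebra_axioms h] barycentre_closed[OF cstar_algebra_axioms k]])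
      fix a assume a: "a \<in> sa"
      have "(\<lambda>\<phi>. Re (\<phi> a)) \<in> ?G" using a continuous_eval_Re[OF sa_carrier[OF a]] by auto
      then show "Re (barycentre A h a) = Re (barycentre A k a)"
        using eq mean_eval_sa[OF a h] mean_eval_sa[OF a k] by simp
    qed
    then show "mean (stat A) h f = mean (stat A) k f"
      using em_unitD(4)[OF f, of h] em_unitD(4)[OF f, of k] h k by (simp add: act_stat_alg)
  qed (use eps in auto)
  then obtain e a where "\<forall>\<phi>\<in>states. \<bar>f \<phi> - e \<phi>\<bar> \<le> \<epsilon>" "a \<in> sa" "\<forall>\<phi>\<in>states. e \<phi> = Re (\<phi> a)" by auto
  then show ?thesis by (intro bexI[of _ a]) auto
qed

text \<open>By \<open>cnorm_le_states\<close> the approximants form a Cauchy sequence in the norm.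
  The limit has the values of \<open>f\<close>, and since these lie in \<open>{0..1}\<close> and
  states detect the order, it is an effect.\<close>

lemma em_unit_is_effect:
  assumes f: "f \<in> em_maps (stat_alg A) unit_alg"
  shows "\<exists>a\<in>E. \<forall>\<phi>\<in>states. f \<phi> = Re (\<phi> a)"
proof -
  have "\<forall>n. \<exists>a. a \<in> sa \<and> (\<forall>\<phi>\<in>states. \<bar>f \<phi> - Re (\<phi> a)\<bar> \<le> inverse (real (Suc n)))"
    using em_unit_approximation[OF f] by (metis inverse_positive_iff_positive of_nat_0_less_iff zero_less_Suc)
  from choice[OF this] obtain a where a: "\<And>n. a n \<in> sa"
    and close: "\<And>n \<phi>. \<phi> \<in> states \<Longrightarrow> \<bar>f \<phi> - Re (\<phi> (a n))\<bar> \<le> inverse (real (Suc n))" by blast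
  have diff: "cnorm A (a m \<ominus> a n) \<le> inverse (real (Suc m)) + inverse (real (Suc n))" for m n
  proof (rule cnorm_le_states)
    fix \<phi> assume \<phi>: "\<phi> \<in> states"
    show "\<bar>Re (\<phi> (a m \<ominus> a n))\<bar> \<le> inverse (real (Suc m)) + inverse (real (Suc n))"
      using close[OF \<phi>, of m] close[OF \<phi>, of n] a by (simp add: state_minus[OF \<phi>] abs_le_iff)
  qed (use a in \<open>simp_all add: add_nonneg_nonneg\<close>)
  have "\<exists>l\<in>carrier A. (\<lambda>n. cnorm A (a n \<ominus> l)) \<longlonglongrightarrow> 0"
  proof (rule complete)
    fix e :: real assume "0 < e"
    then obtain N where N: "inverse (real (Suc N)) < e / 2" using reals_Archimedean[of "e/2"] by auto
    have small: "inverse (real (Suc n)) < e / 2" if "n \<ge> N" for n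
      using N that by (meson le_imp_inverse_le le_less_trans of_nat_0_less_iff of_nat_le_iff Suc_le_mono zero_less_Suc)
    have "cnorm A (a m \<ominus> a n) < e" if "m \<ge> N" "n \<ge> N" for m n
      using diff[of m n] small[OF that(1)] small[OF that(2)] by simp
    then show "\<exists>N. \<forall>m\<ge>N. \<forall>n\<ge>N. cnorm A (a m \<ominus> a n) < e" by blast
  qed (use a in simp)
  then obtain l where l: "conv a l" using a by (auto simp: conv_def)
  then have lc: "l \<in> carrier A" by (simp add: conv_def)
  have "conv (\<lambda>n. star A (a n)) (star A l)" using l by (rule conv_star)
  then have "conv a (star A l)" using a by simp
  then have "star A l = l" using l by (rule conv_unique)
  with lc have ls: "l \<in> sa" by (rule saI)
  have val: "f \<phi> = Re (\<phi> l)" if \<phi>: "\<phi> \<in> states" for \<phi>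
  proof -
    have "(\<lambda>n. Re (\<phi> (a n))) \<longlonglongrightarrow> f \<phi>"
    proof (rule LIM_zero_cancel, rule Lim_null_comparison)
      show "(\<lambda>n. inverse (real (Suc n))) \<longlonglongrightarrow> 0" by (rule LIMSEQ_inverse_real_of_nat)
      show "\<forall>\<^sub>F n in sequentially. norm (Re (\<phi> (a n)) - f \<phi>) \<le> inverse (real (Suc n))"
        using close[OF \<phi>] by (simp add: abs_minus_commute)
    qed
    moreover have "(\<lambda>n. Re (\<phi> (a n))) \<longlonglongrightarrow> Re (\<phi> l)"
    proof (rule LIM_zero_cancel, rule Lim_null_comparison)
      show "(\<lambda>n. cnorm A (a n \<ominus> l)) \<longlonglongrightarrow> 0" using l by (simp add: conv_def)
      show "\<forall>\<^sub>F n in sequentially. norm (Re (\<phi> (a n)) - Re (\<phi> l)) \<le> cnorm A (a n \<ominus> l)"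
        using state_sa(2)[OF \<phi> sa_minus[OF a ls]] a ls by (simp add: state_minus[OF \<phi>])
    qed
    ultimately show ?thesis by (rule LIMSEQ_unique)
  qed
  have "0 \<le> Re (\<phi> l)" "Re (\<phi> l) \<le> 1" if "\<phi> \<in> states" for \<phi>
    using em_unitD(2)[OF f, of \<phi>] val[OF that] that by auto
  then have "l \<in> E"
    using ls by (auto simp: effects_iff nonneg_iff_states state_minus state_one)
  then show ?thesis using val by blast
qed

text \<open>This and \<open>transpose_bij\<close> show that the predicate map is an effect module
  map.\<close>

lemma cstar_pred_iso_eq: "cstar_pred_iso A = transpose_map (stat_alg A) (effects A) (cstar_state_iso A)"
  by (auto simp: cstar_pred_iso_def transpose_map_def cstar_state_iso_def intro!: restrict_ext)

lemma cstar_pred_iso_emod: "cstar_pred_iso A \<in> emod_maps (effects A) (alg_dual (stat_alg A))"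
  using transpose_bij[OF radon_algebra_stat[OF cstar_algebra_axioms] effect_module_effects] cstar_state_iso_em
  unfolding cstar_pred_iso_eq by (rule bij_betwE[THEN bspec])

lemma cstar_pred_iso_bij: "bij_betw (cstar_pred_iso A) E (em_maps (stat_alg A) unit_alg)"
  unfolding bij_betw_def
proof
  show "inj_on (cstar_pred_iso A) E"
  proof (rule inj_onI)
    fix a b assume a: "a \<in> E" and b: "b \<in> E" and eq: "cstar_pred_iso A a = cstar_pred_iso A b"
    have "Re (\<phi> a) = Re (\<phi> b)" if "\<phi> \<in> states" for \<phi>
      using fun_cong[OF eq, of \<phi>] that a b by (simp add: cstar_pred_iso_def)
    then show "a = b" using a b effectD(3) by (intro states_eq_imp_eq) auto
  qed
  show "cstar_pred_iso A ` E = em_maps (stat_alg A) unit_alg"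
  proof (intro equalityI subsetI)
    fix f assume f: "f \<in> em_maps (stat_alg A) unit_alg"
    obtain a where a: "a \<in> E" "\<forall>\<phi>\<in>states. f \<phi> = Re (\<phi> a)" using em_unit_is_effect[OF f] by blast
    have "cstar_pred_iso A a = f"
      by (rule extensionalityI[of _ states]) (use a em_unitD(3)[OF f] in \<open>simp_all add: cstar_pred_iso_def\<close>)
    then show "f \<in> cstar_pred_iso A ` E" using a(1) by blast
  qed (use effect_em in \<open>auto simp: cstar_pred_iso_def\<close>)
qed

end

text \<open>A bijective morphism can fail to be invertible, because the inverse must carry defined
  sums to defined sums; \<open>reflect\<close> supplies this.\<close>

lemma emod_isoI:
  assumes M: "effect_module M" and f: "f \<in> emod_maps M N" and bij: "bij_betw f (carrier M) (carrier N)"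
    and reflect: "\<And>x y. x \<in> carrier M \<Longrightarrow> y \<in> carrier M \<Longrightarrow> eplus N (f x) (f y) \<noteq> None \<Longrightarrow> eplus M x y \<noteq> None"
  shows "emod_iso M N f"
proof -
  interpret effect_module M by fact
  note fD = emod_mapsD[OF f]
  define g where "g = (\<lambda>y\<in>carrier N. inv_into (carrier M) f y)"
  have gf: "g (f x) = x" if "x \<in> carrier M" for x
    using that bij fD(1) by (simp add: g_def bij_betw_inv_into_left)
  have fg: "f (g y) = y" and gM: "g y \<in> carrier M" if "y \<in> carrier N" for y
    using that bij bij_betw_imp_surj_on[OF bij] by (auto simp: g_def bij_betw_inv_into_right inv_into_into)
  have "g \<in> emod_maps N M" unfolding emod_maps_def
  proof (clarify, intro conjI ballI allI impI)
    show "g \<in> carrier N \<rightarrow>\<^sub>E carrier M" using gM by (auto simp: g_def)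
    show "g (eone N) = eone M" using gf[OF eone_closed] fD(3) by simp
  next
    fix u w z assume uw: "u \<in> carrier N" "w \<in> carrier N" "eplus N u w = Some z"
    then obtain z' where z': "eplus M (g u) (g w) = Some z'"
      using reflect[OF gM gM, of u w] fg by auto
    have "f z' = z" using fD(4)[OF gM gM z'] uw fg by simp
    then show "eplus M (g u) (g w) = Some (g z)"
      using gf[OF eplus_closed[OF gM gM z']] z' uw by simp
  next
    fix r :: real and y assume ry: "r \<in> {0..1}" "y \<in> carrier N"
    have "f (escale M r (g y)) = escale N r y" using fD(5)[OF ry(1) gM[OF ry(2)]] fg[OF ry(2)] by simp
    then show "g (escale N r y) = escale M r (g y)"
      using gf[OF escale_closed[OF ry(1) gM[OF ry(2)]]] by simp
  qed
  moreover have "compose (carrier M) g f = (\<lambda>x\<in>carrier M. x)" "compose (carrier N) f g = (\<lambda>y\<in>carrier N. y)"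
    using fg gf by (auto simp: compose_def intro!: restrict_ext)
  ultimately show ?thesis using f by (auto simp: emod_iso_def)
qed

text \<open>States detect whether \<open>1 - (x + y)\<close> is in the cone, so a sum defined
  pointwise on states is defined in \<open>A\<close>.\<close>

lemma (in cstar_algebra) cstar_pred_emod_iso: "emod_iso (effects A) (alg_dual (stat_alg A)) (cstar_pred_iso A)"
proof (rule emod_isoI)
  fix x y assume x: "x \<in> E" and y: "y \<in> E"
    and "eplus (alg_dual (stat_alg A)) (cstar_pred_iso A x) (cstar_pred_iso A y) \<noteq> None"
  then have "\<forall>\<phi>\<in>states. Re (\<phi> x) + Re (\<phi> y) \<le> 1"
    by (auto simp: cstar_pred_iso_def split: if_splits)
  then have "nonneg (\<one> \<ominus> (x \<oplus> y))"
    using effectD(3)[OF x] effectD(3)[OF y] by (simp add: nonneg_iff_states state_minus state_one state_add)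
  then show "eplus (effects A) x y \<noteq> None" by (simp add: cle_one)
qed (use effect_module_effects cstar_pred_iso_emod cstar_pred_iso_bij in simp_all)

section \<open>Functoriality and naturality for the C*-triangle\<close>

lemma pu_maps_minus:
  assumes A: "cstar_algebra A" and B: "cstar_algebra B" and f: "f \<in> pu_maps A B" and "x \<in> carrier A" "y \<in> carrier A"
  shows "f (x \<ominus>\<^bsub>A\<^esub> y) = f x \<ominus>\<^bsub>B\<^esub> f y"
proof -
  interpret A: cstar_algebra A by fact
  interpret B: cstar_algebra B by fact
  show ?thesis using assms pu_mapsD[OF f] by (simp add: A.minus_eq_smult B.minus_eq_smult)
qed

lemma effects_map_emod:
  assumes A: "cstar_algebra A" and B: "cstar_algebra B" and f: "f \<in> pu_maps A B"
  shows "effects_map A f \<in> emod_maps (effects A) (effects B)"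
proof -
  interpret A: cstar_algebra A by fact
  interpret B: cstar_algebra B by fact
  interpret eA: effect_module "effects A" by (rule A.effect_module_effects)
  note D = pu_mapsD[OF f]
  have nn: "B.nonneg (f x)" if "A.nonneg x" for x using D(4)[of x] that by (simp add: A.positive_iff B.positive_iff)
  have one: "B.nonneg (\<one>\<^bsub>B\<^esub> \<ominus>\<^bsub>B\<^esub> f x)" if "x \<in> carrier A" "A.nonneg (\<one>\<^bsub>A\<^esub> \<ominus>\<^bsub>A\<^esub> x)" for x
    using nn[OF that(2)] pu_maps_minus[OF A B f, of "\<one>\<^bsub>A\<^esub>" x] that D(5) by simp
  show ?thesis unfolding emod_maps_def effects_map_def
  proof (clarify, intro conjI ballI allI impI)
    show "restrict f A.E \<in> A.E \<rightarrow>\<^sub>E B.E"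
      using nn one A.effectD(4) by (auto simp: A.effects_iff B.effects_iff)
    show "restrict f A.E (eone (effects A)) = eone (effects B)" using eA.eone_closed D(5) by simp
  next
    fix x y z assume xyz: "x \<in> A.E" "y \<in> A.E" "eplus (effects A) x y = Some z"
    have z: "z = x \<oplus>\<^bsub>A\<^esub> y" "z \<in> A.E" using xyz eA.eplus_closed[OF xyz] by (auto split: if_splits)
    have "f z = f x \<oplus>\<^bsub>B\<^esub> f y" using D(2)[of x y] xyz A.effectD(4) z by simp
    moreover have "B.nonneg (\<one>\<^bsub>B\<^esub> \<ominus>\<^bsub>B\<^esub> f z)" using one[of z] A.effectD[OF z(2)] by simp
    ultimately show "eplus (effects B) (restrict f A.E x) (restrict f A.E y) = Some (restrict f A.E z)"
      using xyz z(2) by (simp add: B.cle_one)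
  next
    fix r :: real and x assume rx: "r \<in> {0..1}" "x \<in> A.E"
    then show "restrict f A.E (escale (effects A) r x) = escale (effects B) r (restrict f A.E x)"
      using eA.escale_closed[OF rx] D(3)[of x] A.effectD(4) by simp
  qed
qed

lemma effects_map_compose:
  assumes A: "cstar_algebra A" and B: "cstar_algebra B" and f: "f \<in> pu_maps A B"
  shows "effects_map A (compose (carrier A) g f) = compose (carrier (effects A)) (effects_map B g) (effects_map A f)"
proof -
  interpret A: cstar_algebra A by fact
  have "f x \<in> carrier (effects B)" if "x \<in> A.E" for x
    using emod_mapsD(1)[OF effects_map_emod[OF A B f] that] that by (simp add: effects_map_def)
  then show ?thesis using A.effectD(4)
    by (auto simp: effects_map_def compose_def intro!: restrict_ext)
qed

lemma stat_map_closed: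
  assumes A: "cstar_algebra A" and f: "f \<in> pu_maps A B" and "\<phi> \<in> pu_maps B complex_cstar"
  shows "stat_map A B f \<phi> \<in> pu_maps A complex_cstar"
  using pu_maps_compose[OF A f assms(3)] assms(3) by (simp add: stat_map_def)

lemma stat_map_em:
  assumes A: "cstar_algebra A" and B: "cstar_algebra B" and f: "f \<in> pu_maps A B"
  shows "stat_map A B f \<in> em_maps (stat_alg B) (stat_alg A)"
  unfolding em_maps_def
proof (clarify, intro conjI ballI)
  interpret B: cstar_algebra B by fact
  have app: "stat_map A B f \<phi> a = \<phi> (f a)" if "\<phi> \<in> pu_maps B complex_cstar" "a \<in> carrier A" for \<phi> a
    using that by (simp add: stat_map_def compose_eq)
  have "continuous_map (stat B) (stat A) (stat_map A B f)"
  proof (rule continuous_map_into_stat)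
    fix a assume a: "a \<in> carrier A"
    have "continuous_map (stat B) euclidean (\<lambda>\<phi>. \<phi> (f a))"
      using pu_mapsD(1)[OF f a] by (rule continuous_map_stat_eval)
    then show "continuous_map (stat B) euclidean (\<lambda>\<phi>. stat_map A B f \<phi> a)"
      by (rule continuous_map_eq) (use app a in simp)
  qed (use stat_map_closed[OF A f] in simp)
  from ch_mapsI[OF this] show ch: "stat_map A B f \<in> ch_maps (alg_space (stat_alg B)) (alg_space (stat_alg A))"
    by (simp add: stat_map_def)
  fix \<omega> assume "\<omega> \<in> topspace (radon (alg_space (stat_alg B)))"
  then have \<omega>: "\<omega> \<in> pu_maps (cfun (stat B)) complex_cstar" by simp
  have rm: "radon_map (stat B) (stat A) (stat_map A B f) \<omega> \<in> pu_maps (cfun (stat A)) complex_cstar"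
    using cstar_algebra.ch_space_stat[OF A] ch \<omega> by (intro radon_map_closed) simp_all
  have bB: "barycentre B \<omega> \<in> pu_maps B complex_cstar" using B \<omega> by (rule barycentre_closed)
  have "stat_map A B f (barycentre B \<omega>) = barycentre A (radon_map (stat B) (stat A) (stat_map A B f) \<omega>)"
  proof (rule pu_maps_eqI[OF stat_map_closed[OF A f bB] barycentre_closed[OF A rm]])
    fix a assume a: "a \<in> carrier A"
    have "compose (topspace (stat B)) (\<lambda>\<phi>\<in>pu_maps A complex_cstar. \<phi> a) (stat_map A B f) = (\<lambda>\<phi>\<in>pu_maps B complex_cstar. \<phi> (f a))"
      unfolding compose_def topspace_stat
      by (rule restrict_ext) (use app[OF _ a] stat_map_closed[OF A f] in simp)
    then show "stat_map A B f (barycentre B \<omega>) a = barycentre A (radon_map (stat B) (stat A) (stat_map A B f) \<omega>) a"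
      using app[OF bB a] pu_mapsD(1)[OF f a] a \<omega> eval_closed[OF a] by (simp add: barycentre_def radon_map_def)
  qed
  then show "stat_map A B f (act (stat_alg B) \<omega>) =
      act (stat_alg A) (radon_map (alg_space (stat_alg B)) (alg_space (stat_alg A)) (stat_map A B f) \<omega>)"
    using \<omega> rm by (simp add: act_stat_alg)
qed

lemma stat_map_compose:
  assumes A: "cstar_algebra A" and B: "cstar_algebra B" and f: "f \<in> pu_maps A B" and g: "g \<in> pu_maps B C"
  shows "stat_map A C (compose (carrier A) g f) = compose (points (stat_alg C)) (stat_map A B f) (stat_map B C g)"
  unfolding compose_def[of "topspace (stat C)"] stat_map_def space_stat_alg
proof (rule restrict_ext)
  fix \<phi> assume "\<phi> \<in> topspace (stat C)"
  then have "compose (carrier B) \<phi> g \<in> pu_maps B complex_cstar" using pu_maps_compose[OF B g] by simp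
  then show "compose (carrier A) \<phi> (compose (carrier A) g f) =
      (\<lambda>\<phi>\<in>topspace (stat B). compose (carrier A) \<phi> f) ((\<lambda>\<phi>\<in>topspace (stat C). compose (carrier B) \<phi> g) \<phi>)"
    using \<open>\<phi> \<in> topspace (stat C)\<close> pu_mapsD(1)[OF f] by (auto simp: compose_def intro!: restrict_ext)
qed

lemma stat_map_id:
  "stat_map A A (\<lambda>a\<in>carrier A. a) = (\<lambda>\<phi>\<in>pu_maps A complex_cstar. \<phi>)"
  unfolding stat_map_def topspace_stat
  by (rule restrict_ext) (simp add: compose_id pu_mapsD(6))

text \<open>Both composites send \<phi> to the map taking \<open>a\<close> to
  \<open>Re (\<phi> (f a))\<close>; the predicate version is the same formula with \<open>a\<close>
  fixed first.\<close>

lemma cstar_state_natural: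
  assumes A: "cstar_algebra A" and B: "cstar_algebra B" and f: "f \<in> pu_maps A B"
  shows "compose (points (stat_alg B)) (emod_dual_map (effects A) (effects B) (effects_map A f)) (cstar_state_iso B)
    = compose (points (stat_alg B)) (cstar_state_iso A) (stat_map A B f)"
  unfolding compose_def[of "points (stat_alg B)"]
proof (rule restrict_ext)
  interpret A: cstar_algebra A by fact
  fix \<phi> assume "\<phi> \<in> points (stat_alg B)"
  then have \<phi>: "\<phi> \<in> pu_maps B complex_cstar" by simp
  have fE: "f a \<in> carrier (effects B)" if "a \<in> A.E" for a
    using emod_mapsD(1)[OF effects_map_emod[OF A B f] that] that by (simp add: effects_map_def)
  show "emod_dual_map (effects A) (effects B) (effects_map A f) (cstar_state_iso B \<phi>) = cstar_state_iso A (stat_map A B f \<phi>)"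
    using \<phi> cstar_algebra.state_restrict_emod[OF B \<phi>] stat_map_closed[OF A f \<phi>] fE A.effectD(4)
    by (auto simp: emod_dual_map_def cstar_state_iso_def effects_map_def compose_def stat_map_def intro!: restrict_ext)
qed

lemma cstar_pred_natural:
  assumes A: "cstar_algebra A" and B: "cstar_algebra B" and f: "f \<in> pu_maps A B"
  shows "compose (carrier (effects A)) (alg_dual_map (stat_alg B) (stat_alg A) (stat_map A B f)) (cstar_pred_iso A)
    = compose (carrier (effects A)) (cstar_pred_iso B) (effects_map A f)"
  unfolding compose_def[of "carrier (effects A)"]
proof (rule restrict_ext)
  interpret A: cstar_algebra A by fact
  fix a assume a: "a \<in> A.E"
  have fE: "f a \<in> carrier (effects B)"
    using emod_mapsD(1)[OF effects_map_emod[OF A B f] a] a by (simp add: effects_map_def)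
  show "alg_dual_map (stat_alg B) (stat_alg A) (stat_map A B f) (cstar_pred_iso A a) = cstar_pred_iso B (effects_map A f a)"
    using a fE A.effect_em[OF a] stat_map_closed[OF A f] A.effectD(4)[OF a]
    by (auto simp: alg_dual_map_def cstar_pred_iso_def effects_map_def compose_def stat_map_def intro!: restrict_ext)
qed


section \<open>The Kleisli category\<close>

lemma carrier_cont_pred [simp]: "carrier (cont_pred X) = ch_maps X (top_of_set {0..1})"
  by (simp add: cont_pred_def)

lemma cont_pred_simps [simp]:
  "eone (cont_pred X) = (\<lambda>x\<in>topspace X. 1)"
  "eplus (cont_pred X) p q =
    (if \<forall>x\<in>topspace X. p x + q x \<le> 1 then Some (\<lambda>x\<in>topspace X. p x + q x) else None)"
  "escale (cont_pred X) r p = (\<lambda>x\<in>topspace X. r * p x)"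
  by (simp_all add: cont_pred_def)

lemma unit_mapD:
  assumes "p \<in> ch_maps X (top_of_set {0..1::real})"
  shows "continuous_map X euclideanreal p" "x \<in> topspace X \<Longrightarrow> 0 \<le> p x" "x \<in> topspace X \<Longrightarrow> p x \<le> 1"
    "p \<in> extensional (topspace X)"
  using assms by (auto simp: unit_map_iff)

lemma kl_mapsD:
  assumes "f \<in> kl_maps X Y"
  shows "f \<in> ch_maps X (radon Y)" "x \<in> topspace X \<Longrightarrow> f x \<in> pu_maps (cfun Y) complex_cstar"
  using assms ch_maps_closed[of f X "radon Y"] by (simp_all add: kl_maps_def)

lemma cont_pred_map_eq:
  "cont_pred_map X Y f = (\<lambda>p\<in>ch_maps Y (top_of_set {0..1}). \<lambda>x\<in>topspace X. mean Y (f x) p)"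
  by (simp add: cont_pred_map_def mean_def)

lemma continuous_mean_kl:
  assumes "f \<in> kl_maps X Y" "continuous_map Y euclideanreal p"
  shows "continuous_map X euclideanreal (\<lambda>x. mean Y (f x) p)"
  using continuous_map_compose[OF ch_mapsD[OF kl_mapsD(1)[OF assms(1)]] continuous_mean[OF assms(2)]]
  by (simp add: o_def)

lemma cont_pred_map_closed:
  assumes Y: "ch_space Y" and f: "f \<in> kl_maps X Y" and p: "p \<in> ch_maps Y (top_of_set {0..1})"
  shows "(\<lambda>x\<in>topspace X. mean Y (f x) p) \<in> ch_maps X (top_of_set {0..1})"
  using continuous_mean_kl[OF f unit_mapD(1)[OF p]] mean_unit_interval[OF Y kl_mapsD(2)[OF f] unit_mapD(1)[OF p]] unit_mapD(2,3)[OF p]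
  by (auto simp: unit_map_iff intro: continuous_map_restrict)

lemma cont_pred_map_emod:
  assumes Y: "ch_space Y" and f: "f \<in> kl_maps X Y"
  shows "cont_pred_map X Y f \<in> emod_maps (cont_pred Y) (cont_pred X)"
  unfolding emod_maps_def
proof (clarify, intro conjI ballI allI impI)
  interpret Y: effect_module "cont_pred Y" by (rule effect_module_cont_pred)
  note st = kl_mapsD(2)[OF f]
  show "cont_pred_map X Y f \<in> carrier (cont_pred Y) \<rightarrow>\<^sub>E carrier (cont_pred X)"
    using cont_pred_map_closed[OF Y f] by (auto simp: cont_pred_map_eq)
  have "mean Y (f x) (\<lambda>y\<in>topspace Y. 1) = 1" if "x \<in> topspace X" for x
    using mean_one[OF Y st[OF that]] mean_cong[of Y "\<lambda>y\<in>topspace Y. 1" "\<lambda>y. 1"] by simp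
  then show "cont_pred_map X Y f (eone (cont_pred Y)) = eone (cont_pred X)"
    using Y.eone_closed by (auto simp: cont_pred_map_eq intro!: restrict_ext)
next
  interpret Y: effect_module "cont_pred Y" by (rule effect_module_cont_pred)
  interpret X: effect_module "cont_pred X" by (rule effect_module_cont_pred)
  note st = kl_mapsD(2)[OF f]
  fix p q z assume p: "p \<in> carrier (cont_pred Y)" and q: "q \<in> carrier (cont_pred Y)" and z: "eplus (cont_pred Y) p q = Some z"
  have zc: "z \<in> ch_maps Y (top_of_set {0..1})" using Y.eplus_closed[OF p q z] by simp
  have zeq: "z = (\<lambda>y\<in>topspace Y. p y + q y)" using z by (simp split: if_splits)
  have "mean Y (f x) z = mean Y (f x) p + mean Y (f x) q" if "x \<in> topspace X" for x
    using mean_add[OF Y st[OF that] unit_mapD(1) unit_mapD(1), of p q] p q mean_cong[of Y z "\<lambda>y. p y + q y"] zeq by simp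
  moreover have "mean Y (f x) z \<le> 1" if "x \<in> topspace X" for x
    using unit_mapD(3)[OF cont_pred_map_closed[OF Y f zc] that] that by simp
  ultimately show "eplus (cont_pred X) (cont_pred_map X Y f p) (cont_pred_map X Y f q) = Some (cont_pred_map X Y f z)"
    using p q zc by (auto simp: cont_pred_map_eq intro!: restrict_ext)
next
  interpret Y: effect_module "cont_pred Y" by (rule effect_module_cont_pred)
  note st = kl_mapsD(2)[OF f]
  fix r :: real and p assume r: "r \<in> {0..1}" and p: "p \<in> carrier (cont_pred Y)"
  have rp: "(\<lambda>y\<in>topspace Y. r * p y) \<in> ch_maps Y (top_of_set {0..1})" using Y.escale_closed[OF r p] by simp
  have "mean Y (f x) (\<lambda>y\<in>topspace Y. r * p y) = r * mean Y (f x) p" if "x \<in> topspace X" for x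
    using mean_cmul[OF Y st[OF that] unit_mapD(1), of p r] p mean_cong[of Y "\<lambda>y\<in>topspace Y. r * p y" "\<lambda>y. r * p y"] by simp
  then show "cont_pred_map X Y f (escale (cont_pred Y) r p) = escale (cont_pred X) r (cont_pred_map X Y f p)"
    using p rp by (auto simp: cont_pred_map_eq intro!: restrict_ext)
qed

lemma cont_pred_map_id: "cont_pred_map X X (radon_eta X) = (\<lambda>p\<in>carrier (cont_pred X). p)"
  unfolding cont_pred_map_eq carrier_cont_pred
proof (rule restrict_ext)
  fix p assume p: "p \<in> ch_maps X (top_of_set {0..1::real})"
  show "(\<lambda>x\<in>topspace X. mean X (radon_eta X x) p) = p"
    by (rule extensionalityI[of _ "topspace X"]) (use unit_mapD[OF p] in \<open>simp_all add: mean_eta\<close>)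
qed

text \<open>Functoriality of the comparison functor is inherited from \<open>Stat\<close> through
  this identification.\<close>

lemma comparison_map_eq:
  assumes Y: "ch_space Y" and f: "f \<in> kl_maps X Y"
  shows "comparison_map X Y f = stat_map (cfun Y) (cfun X) (kl_dual X Y f)"
  unfolding comparison_map_def stat_map_def compose_def[of "topspace (radon X)"] radon_def[symmetric]
proof (rule restrict_ext)
  note fch = kl_mapsD(1)[OF f]
  fix h assume "h \<in> topspace (radon X)"
  then have h: "h \<in> pu_maps (cfun X) complex_cstar" by simp
  have rm: "radon_map X (radon Y) f h \<in> pu_maps (cfun (radon Y)) complex_cstar"
    using ch_space_radon[OF Y] fch h by (rule radon_map_closed)
  show "radon_mu Y (radon_map X (radon Y) f h) = compose (carrier (cfun Y)) h (kl_dual X Y f)"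
    unfolding radon_mu_eq[OF rm] barycentre_def compose_def[of "carrier (cfun Y)"]
  proof (rule restrict_ext)
    fix v assume v: "v \<in> carrier (cfun Y)"
    have "compose (topspace X) (\<lambda>\<phi>\<in>pu_maps (cfun Y) complex_cstar. \<phi> v) f = kl_dual X Y f v"
      using v kl_mapsD(2)[OF f] by (auto simp: compose_def kl_dual_def intro!: restrict_ext)
    then show "radon_map X (radon Y) f h (\<lambda>\<phi>\<in>pu_maps (cfun Y) complex_cstar. \<phi> v) = h (kl_dual X Y f v)"
      using h eval_closed[OF v] by (simp add: radon_map_def radon_def[symmetric])
  qed
qed

lemma comparison_map_ch:
  assumes X: "ch_space X" and Y: "ch_space Y" and f: "f \<in> kl_maps X Y"
  shows "comparison_map X Y f \<in> em_maps (comparison X) (comparison Y)"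
    "comparison_map X Y f \<in> ch_maps (radon X) (radon Y)"
proof -
  show em: "comparison_map X Y f \<in> em_maps (comparison X) (comparison Y)"
    unfolding comparison_eq comparison_map_eq[OF Y f]
    by (intro stat_map_em cfun_cstar X Y kl_dual_pu kl_mapsD(1)[OF f])
  show "comparison_map X Y f \<in> ch_maps (radon X) (radon Y)"
    using em_mapsD(1)[OF em] by (simp add: comparison_def)
qed

lemma points_comparison [simp]: "points (comparison X) = pu_maps (cfun X) complex_cstar"
  by (simp add: comparison_def)

lemma space_comparison [simp]: "alg_space (comparison X) = radon X"
  by (simp add: comparison_def)

lemma comparison_map_id: 
  assumes "ch_space X"
  shows "comparison_map X X (radon_eta X) = (\<lambda>h\<in>points (comparison X). h)"
proof -
  have "kl_dual X X (radon_eta X) = (\<lambda>v\<in>carrier (cfun X). v)"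
    unfolding kl_dual_def cfun_simps(1)
  proof (rule restrict_ext)
    fix v assume v: "v \<in> ch_maps X (euclidean :: complex topology)"
    show "(\<lambda>x\<in>topspace X. radon_eta X x v) = v"
      by (rule cfun_eqI[OF v, symmetric]) (simp add: radon_eta_def v)
  qed
  moreover have "radon_eta X \<in> kl_maps X X" using radon_eta_ch[OF assms] by (simp add: kl_maps_def)
  ultimately show ?thesis using comparison_map_eq[OF assms, of "radon_eta X" X] stat_map_id[of "cfun X"] by simp
qed

text \<open>The comparison map is the Kleisli extension of \<open>g\<close>, so facts about
  composition reduce to facts about \<open>comparison_map\<close>.\<close>

lemma kl_comp_eq: 
  assumes f: "f \<in> kl_maps X Y"
  shows "kl_comp X Y Z g f = compose (topspace X) (comparison_map Y Z g) f"
  unfolding kl_comp_def compose_def[of "topspace X"]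
  by (rule restrict_ext) (use kl_mapsD(2)[OF f] in \<open>simp add: comparison_map_def compose_eq\<close>)

lemma kl_comp_closed:
  assumes Y: "ch_space Y" and Z: "ch_space Z" and f: "f \<in> kl_maps X Y" and g: "g \<in> kl_maps Y Z"
  shows "kl_comp X Y Z g f \<in> kl_maps X Z"
  unfolding kl_comp_eq[OF f] using ch_maps_compose[OF kl_mapsD(1)[OF f] comparison_map_ch(2)[OF Y Z g]]
  by (simp add: kl_maps_def)

lemma kl_dual_comp:
  assumes Y: "ch_space Y" and Z: "ch_space Z" and f: "f \<in> kl_maps X Y" and g: "g \<in> kl_maps Y Z"
  shows "kl_dual X Z (kl_comp X Y Z g f) = compose (carrier (cfun Z)) (kl_dual X Y f) (kl_dual Y Z g)"
  unfolding kl_dual_def[of X Z] compose_def[of "ch_maps Z euclidean"] cfun_simps(1)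
proof (rule restrict_ext)
  fix v assume v: "v \<in> ch_maps Z (euclidean :: complex topology)"
  have gv: "kl_dual Y Z g v \<in> ch_maps Y euclidean"
    using pu_mapsD(1)[OF kl_dual_pu[OF Z kl_mapsD(1)[OF g]], of v] v by simp
  have "kl_comp X Y Z g f x v = f x (kl_dual Y Z g v)" if x: "x \<in> topspace X" for x
    using x v kl_mapsD(2)[OF f x] by (simp add: kl_comp_eq[OF f] compose_eq comparison_map_eq[OF Z g] stat_map_def)
  then show "(\<lambda>x\<in>topspace X. kl_comp X Y Z g f x v) = kl_dual X Y f (kl_dual Y Z g v)"
    using gv by (auto simp: kl_dual_def[of X Y] intro!: restrict_ext)
qed

lemma comparison_map_compose:
  assumes X: "ch_space X" and Y: "ch_space Y" and Z: "ch_space Z" and f: "f \<in> kl_maps X Y" and g: "g \<in> kl_maps Y Z"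
  shows "comparison_map X Z (kl_comp X Y Z g f)
    = compose (points (comparison X)) (comparison_map Y Z g) (comparison_map X Y f)"
  unfolding comparison_map_eq[OF Z kl_comp_closed[OF Y Z f g]] comparison_map_eq[OF Z g] comparison_map_eq[OF Y f]
    kl_dual_comp[OF Y Z f g]
  using stat_map_compose[OF cfun_cstar[OF Z] cfun_cstar[OF Y] kl_dual_pu[OF Z kl_mapsD(1)[OF g]] kl_dual_pu[OF Y kl_mapsD(1)[OF f]]]
  by (simp add: comparison_eq)

text \<open>The inner integral comes from the multiplication (\<open>mean_radon_mu\<close>), the
  substitution of \<open>f\<close> from the image functional
  (\<open>mean_radon_map\<close>).\<close>

lemma mean_comparison_map:
  assumes Y: "ch_space Y" and f: "f \<in> kl_maps X Y" and h: "h \<in> pu_maps (cfun X) complex_cstar"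
    and p: "continuous_map Y euclideanreal p"
  shows "mean Y (comparison_map X Y f h) p = mean X h (\<lambda>x. mean Y (f x) p)"
proof -
  note fch = kl_mapsD(1)[OF f]
  have rm: "radon_map X (radon Y) f h \<in> pu_maps (cfun (radon Y)) complex_cstar"
    using ch_space_radon[OF Y] fch h by (rule radon_map_closed)
  have "comparison_map X Y f h = radon_mu Y (radon_map X (radon Y) f h)"
    using h by (simp add: comparison_map_def compose_eq)
  then show ?thesis using mean_radon_mu[OF Y rm p] mean_radon_map[OF h fch continuous_mean[OF p]] by simp
qed

lemma cont_pred_map_compose:
  assumes Y: "ch_space Y" and Z: "ch_space Z" and f: "f \<in> kl_maps X Y" and g: "g \<in> kl_maps Y Z"
  shows "cont_pred_map X Z (kl_comp X Y Z g f)
    = compose (carrier (cont_pred Z)) (cont_pred_map X Y f) (cont_pred_map Y Z g)"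
  unfolding cont_pred_map_eq[of X Z] compose_def[of "ch_maps Z (top_of_set {0..1})"] carrier_cont_pred
proof (rule restrict_ext)
  fix p assume p: "p \<in> ch_maps Z (top_of_set {0..1::real})"
  have "mean Z (kl_comp X Y Z g f x) p = mean Y (f x) (\<lambda>y\<in>topspace Y. mean Z (g y) p)" if x: "x \<in> topspace X" for x
  proof -
    have "mean Z (kl_comp X Y Z g f x) p = mean Z (comparison_map Y Z g (f x)) p"
      using x by (simp add: kl_comp_eq[OF f] compose_eq)
    also have "\<dots> = mean Y (f x) (\<lambda>y. mean Z (g y) p)"
      using Z g kl_mapsD(2)[OF f x] unit_mapD(1)[OF p] by (rule mean_comparison_map)
    also have "\<dots> = mean Y (f x) (\<lambda>y\<in>topspace Y. mean Z (g y) p)" by (rule mean_cong) simp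
    finally show ?thesis .
  qed
  then show "(\<lambda>x\<in>topspace X. mean Z (kl_comp X Y Z g f x) p) = cont_pred_map X Y f (cont_pred_map Y Z g p)"
    using p cont_pred_map_closed[OF Z g p] by (auto simp: cont_pred_map_eq intro!: restrict_ext)
qed

text \<open>Identifies \<open>cont_pred X\<close> with the effects of C(X); the isomorphisms of the
  C*-triangle are transported along it.\<close>

definition cplx_emod :: "'x topology \<Rightarrow> ('x \<Rightarrow> real) \<Rightarrow> 'x \<Rightarrow> complex" where
  "cplx_emod X = (\<lambda>p\<in>carrier (cont_pred X). cplx (topspace X) p)"

lemma effects_cfun_iff:
  assumes X: "ch_space X"
  shows "v \<in> carrier (effects (cfun X)) \<longleftrightarrow>
    v \<in> ch_maps X euclidean \<and> (\<forall>x\<in>topspace X. Im (v x) = 0 \<and> 0 \<le> Re (v x) \<and> Re (v x) \<le> 1)"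
proof -
  interpret C: cstar_algebra "cfun X" using X by (rule cfun_cstar)
  have "\<one>\<^bsub>cfun X\<^esub> \<ominus>\<^bsub>cfun X\<^esub> v = (\<lambda>x\<in>topspace X. (\<lambda>x\<in>topspace X. 1) x - v x)" if "v \<in> ch_maps X euclidean"
    using cfun_minus[OF X _ that, of "\<one>\<^bsub>cfun X\<^esub>"] by (simp only: cfun_simps) simp
  moreover have "\<one>\<^bsub>cfun X\<^esub> \<ominus>\<^bsub>cfun X\<^esub> v \<in> ch_maps X euclidean" if "v \<in> ch_maps X euclidean"
    using C.minus_closed[OF C.one_closed, of v] that unfolding cfun_simps(1) by blast
  ultimately show ?thesis unfolding C.effects_iff C.positive_iff[symmetric] positive_cfun by auto
qed

lemma cplx_emod_iso:
  assumes X: "ch_space X"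
  shows "emod_iso (cont_pred X) (effects (cfun X)) (cplx_emod X)"
    "bij_betw (cplx_emod X) (ch_maps X (top_of_set {0..1})) (carrier (effects (cfun X)))"
proof -
  interpret C: cstar_algebra "cfun X" using X by (rule cfun_cstar)
  interpret P: effect_module "cont_pred X" by (rule effect_module_cont_pred)
  interpret F: effect_module "effects (cfun X)" by (rule C.effect_module_effects)
  have cl: "cplx (topspace X) p \<in> C.E" if "p \<in> ch_maps X (top_of_set {0..1})" for p
    using unit_mapD[OF that] cplx_closed[OF unit_mapD(1)[OF that]] by (simp add: effects_cfun_iff[OF X]) (simp add: cplx_def)
  have plus_iff: "cle (cfun X) (cplx (topspace X) p \<oplus>\<^bsub>cfun X\<^esub> cplx (topspace X) q) \<one>\<^bsub>cfun X\<^esub> \<longleftrightarrow> (\<forall>x\<in>topspace X. p x + q x \<le> 1)"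
    and plus_eq: "cplx (topspace X) p \<oplus>\<^bsub>cfun X\<^esub> cplx (topspace X) q = cplx (topspace X) (\<lambda>x\<in>topspace X. p x + q x)"
    if p: "p \<in> ch_maps X (top_of_set {0..1})" and q: "q \<in> ch_maps X (top_of_set {0..1})" for p q
  proof -
    show eq: "cplx (topspace X) p \<oplus>\<^bsub>cfun X\<^esub> cplx (topspace X) q = cplx (topspace X) (\<lambda>x\<in>topspace X. p x + q x)"
      by (auto simp: cplx_def intro!: restrict_ext)
    \<comment> \<open>As the sum is in the cone, being below the unit is the same as being an
      effect, and \<open>effects_cfun_iff\<close> makes this pointwise.\<close>
    have "C.nonneg (cplx (topspace X) p \<oplus>\<^bsub>cfun X\<^esub> cplx (topspace X) q)"
      using C.effectD(1)[OF cl[OF p]] C.effectD(1)[OF cl[OF q]] by (rule C.nonneg_add)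
    then have "cle (cfun X) (cplx (topspace X) p \<oplus>\<^bsub>cfun X\<^esub> cplx (topspace X) q) \<one>\<^bsub>cfun X\<^esub> \<longleftrightarrow>
        cplx (topspace X) p \<oplus>\<^bsub>cfun X\<^esub> cplx (topspace X) q \<in> C.E"
      by (simp only: C.effects_iff C.cle_one simp_thms)
    also have "\<dots> \<longleftrightarrow> (\<forall>x\<in>topspace X. p x + q x \<le> 1)"
      unfolding eq effects_cfun_iff[OF X]
      using unit_mapD[OF p] unit_mapD[OF q] cplx_closed[of X "\<lambda>x\<in>topspace X. p x + q x"]
        continuous_map_restrict[OF continuous_map_add[OF unit_mapD(1)[OF p] unit_mapD(1)[OF q]]]
      by (simp add: cplx_def)
    finally show "cle (cfun X) (cplx (topspace X) p \<oplus>\<^bsub>cfun X\<^esub> cplx (topspace X) q) \<one>\<^bsub>cfun X\<^esub> \<longleftrightarrow> (\<forall>x\<in>topspace X. p x + q x \<le> 1)" .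
  qed
  have emod: "cplx_emod X \<in> emod_maps (cont_pred X) (effects (cfun X))"
    unfolding emod_maps_def
  proof (clarify, intro conjI ballI allI impI)
    show "cplx_emod X \<in> carrier (cont_pred X) \<rightarrow>\<^sub>E C.E" using cl by (auto simp: cplx_emod_def)
    show "cplx_emod X (eone (cont_pred X)) = eone (effects (cfun X))"
      using P.eone_closed by (auto simp: cplx_emod_def cplx_def intro!: restrict_ext)
  next
    fix p q z assume p: "p \<in> carrier (cont_pred X)" and q: "q \<in> carrier (cont_pred X)" and z: "eplus (cont_pred X) p q = Some z"
    have zc: "z \<in> carrier (cont_pred X)" using P.eplus_closed[OF p q z] .
    have zeq: "z = (\<lambda>y\<in>topspace X. p y + q y)" and le: "\<forall>x\<in>topspace X. p x + q x \<le> 1" using z by (auto split: if_splits)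
    show "eplus (effects (cfun X)) (cplx_emod X p) (cplx_emod X q) = Some (cplx_emod X z)"
      using p q zc zeq le plus_iff[of p q] plus_eq[of p q] unfolding effects_simps by (simp add: cplx_emod_def del: cfun_simps(2-))
  next
    fix r :: real and p assume r: "r \<in> {0..1}" and p: "p \<in> carrier (cont_pred X)"
    show "cplx_emod X (escale (cont_pred X) r p) = escale (effects (cfun X)) r (cplx_emod X p)"
      using p P.escale_closed[OF r p] by (auto simp: cplx_emod_def cplx_def intro!: restrict_ext)
  qed
  show bij: "bij_betw (cplx_emod X) (ch_maps X (top_of_set {0..1})) C.E"
  proof (rule bij_betwI[where g = "\<lambda>v. \<lambda>x\<in>topspace X. Re (v x)"])
    show "cplx_emod X \<in> ch_maps X (top_of_set {0..1}) \<rightarrow> C.E" using cl by (auto simp: cplx_emod_def)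
    have re_cl: "(\<lambda>x\<in>topspace X. Re (v x)) \<in> ch_maps X (top_of_set {0..1})" if "v \<in> C.E" for v
    proof -
      have "v \<in> ch_maps X euclidean" using that by (simp add: effects_cfun_iff[OF X])
      then have "continuous_map X euclideanreal (\<lambda>x. Re (v x))"
        by (intro continuous_map_euclidean_compose[where g = Re]) (auto intro: continuous_intros dest: ch_mapsD)
      then show ?thesis using that by (auto simp: unit_map_iff effects_cfun_iff[OF X] intro: continuous_map_restrict)
    qed
    then show "(\<lambda>v. \<lambda>x\<in>topspace X. Re (v x)) \<in> C.E \<rightarrow> ch_maps X (top_of_set {0..1})" by blast
    show "(\<lambda>x\<in>topspace X. Re (cplx_emod X p x)) = p" if "p \<in> ch_maps X (top_of_set {0..1})" for p
      by (rule extensionalityI[of _ "topspace X"]) (use that unit_mapD(4)[OF that] in \<open>simp_all add: cplx_emod_def cplx_def\<close>)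
    show "cplx_emod X (\<lambda>x\<in>topspace X. Re (v x)) = v" if v: "v \<in> C.E" for v
    proof -
      have "v \<in> ch_maps X euclidean" using v by (simp add: effects_cfun_iff[OF X])
      then have "v = (\<lambda>x\<in>topspace X. complex_of_real (Re (v x)))"
        by (rule cfun_eqI) (use v in \<open>simp add: effects_cfun_iff[OF X] complex_eq_iff\<close>)
      then show ?thesis using re_cl[OF v] by (simp add: cplx_emod_def cplx_def cong: restrict_cong)
    qed
  qed
  show "emod_iso (cont_pred X) (effects (cfun X)) (cplx_emod X)"
  proof (rule emod_isoI[OF effect_module_cont_pred emod])
    fix p q assume p: "p \<in> carrier (cont_pred X)" and q: "q \<in> carrier (cont_pred X)"
      and "eplus (effects (cfun X)) (cplx_emod X p) (cplx_emod X q) \<noteq> None"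
    then have "cle (cfun X) (cplx (topspace X) p \<oplus>\<^bsub>cfun X\<^esub> cplx (topspace X) q) \<one>\<^bsub>cfun X\<^esub>"
      unfolding effects_simps by (simp add: cplx_emod_def del: cfun_simps(2-) split: if_splits)
    then show "eplus (cont_pred X) p q \<noteq> None" using plus_iff p q by simp
  qed (use bij in simp)
qed

lemma emod_dual_map_id: "emod_dual_map M M (\<lambda>x\<in>carrier M. x) = (\<lambda>v\<in>points (emod_dual M). v)"
  unfolding emod_dual_map_def
  by (rule restrict_ext) (simp add: compose_id emod_unitD(2))

lemma emod_dual_map_bij:
  assumes M: "effect_module M" and N: "effect_module N" and iso: "emod_iso M N f"
  shows "bij_betw (emod_dual_map M N f) (points (emod_dual N)) (points (emod_dual M))"
proof -
  obtain g where f: "f \<in> emod_maps M N" and g: "g \<in> emod_maps N M"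
    and gf: "compose (carrier M) g f = (\<lambda>x\<in>carrier M. x)" and fg: "compose (carrier N) f g = (\<lambda>y\<in>carrier N. y)"
    using iso by (auto simp: emod_iso_def)
  have 1: "emod_dual_map N M g (emod_dual_map M N f v) = v" if "v \<in> points (emod_dual N)" for v
    using emod_dual_map_compose[OF N M g f] fg emod_dual_map_id[of N] that
    by (metis compose_eq restrict_apply')
  have 2: "emod_dual_map M N f (emod_dual_map N M g v) = v" if "v \<in> points (emod_dual M)" for v
    using emod_dual_map_compose[OF M N f g] gf emod_dual_map_id[of M] that
    by (metis compose_eq restrict_apply')
  show ?thesis
    using 1 2 em_mapsD(2)[OF emod_dual_map_em[OF M N f]] em_mapsD(2)[OF emod_dual_map_em[OF N M g]]
    by (intro bij_betwI[where g = "emod_dual_map N M g"]) blast+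
qed

text \<open>The state isomorphism of C(X) followed by the dual of \<open>cplx_emod\<close>, so it
  inherits bijectivity and compatibility with the algebra structures.\<close>

lemma kl_state_iso_eq:
  assumes X: "ch_space X"
  shows "kl_state_iso X = compose (points (stat_alg (cfun X)))
    (emod_dual_map (cont_pred X) (effects (cfun X)) (cplx_emod X)) (cstar_state_iso (cfun X))"
  unfolding kl_state_iso_def compose_def[of "topspace (stat (cfun X))"] radon_def space_stat_alg
proof (rule restrict_ext)
  interpret C: cstar_algebra "cfun X" using X by (rule cfun_cstar)
  fix h assume "h \<in> topspace (stat (cfun X))"
  then have h: "h \<in> pu_maps (cfun X) complex_cstar" by simp
  have "cplx (topspace X) p \<in> C.E" if "p \<in> ch_maps X (top_of_set {0..1})" for p
    using bij_betwE[OF cplx_emod_iso(2)[OF X]] that by (force simp: cplx_emod_def)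
  then show "(\<lambda>p\<in>carrier (cont_pred X). Re (h (cplx (topspace X) p))) =
     emod_dual_map (cont_pred X) (effects (cfun X)) (cplx_emod X) (cstar_state_iso (cfun X) h)"
    using h C.state_restrict_emod[OF h]
    by (auto simp: emod_dual_map_def cstar_state_iso_def compose_def cplx_emod_def intro!: restrict_ext)
qed

lemma kl_state_em_iso:
  assumes X: "ch_space X"
  shows "em_iso (comparison X) (emod_dual (cont_pred X)) (kl_state_iso X)"
  unfolding comparison_eq
proof (rule em_isoI)
  interpret C: cstar_algebra "cfun X" using X by (rule cfun_cstar)
  note M = effect_module_cont_pred[of X] and N = C.effect_module_effects and iso = cplx_emod_iso(1)[OF X]
  show R: "radon_algebra (stat_alg (cfun X))" by (intro radon_algebra_stat C.cstar_algebra_axioms)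
  show "radon_algebra (emod_dual (cont_pred X))" by (intro radon_algebra_emod_dual M)
  have J: "cplx_emod X \<in> emod_maps (cont_pred X) (effects (cfun X))" using iso by (simp add: emod_iso_def)
  show "kl_state_iso X \<in> em_maps (stat_alg (cfun X)) (emod_dual (cont_pred X))"
    unfolding kl_state_iso_eq[OF X]
    by (rule em_maps_compose[OF R ch_space_emod_dual[OF N] C.cstar_state_iso_em emod_dual_map_em[OF M N J]])
  have "bij_betw (cstar_state_iso (cfun X)) (points (stat_alg (cfun X))) (points (emod_dual (effects (cfun X))))"
    using C.cstar_state_iso_bij by simp
  then show "bij_betw (kl_state_iso X) (points (stat_alg (cfun X))) (points (emod_dual (cont_pred X)))"
    unfolding kl_state_iso_eq[OF X] using emod_dual_map_bij[OF M N iso] by (rule bij_betw_compose)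
qed

lemma kl_pred_iso_eq:
  "kl_pred_iso X = (\<lambda>p\<in>ch_maps X (top_of_set {0..1}). \<lambda>h\<in>pu_maps (cfun X) complex_cstar. mean X h p)"
  by (simp add: kl_pred_iso_def mean_def)

text \<open>The morphism property comes from transposing the state isomorphism, bijectivity from
  factoring through the effects of C(X).\<close>

lemma kl_pred_emod_iso:
  assumes X: "ch_space X"
  shows "emod_iso (cont_pred X) (alg_dual (comparison X)) (kl_pred_iso X)"
proof (rule emod_isoI[OF effect_module_cont_pred])
  interpret C: cstar_algebra "cfun X" using X by (rule cfun_cstar)
  have R: "radon_algebra (comparison X)" unfolding comparison_eq by (intro radon_algebra_stat C.cstar_algebra_axioms)
  have "kl_pred_iso X = transpose_map (comparison X) (cont_pred X) (kl_state_iso X)"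
    by (auto simp: kl_pred_iso_def transpose_map_def kl_state_iso_def intro!: restrict_ext)
  then show "kl_pred_iso X \<in> emod_maps (cont_pred X) (alg_dual (comparison X))"
    using transpose_bij[OF R effect_module_cont_pred] kl_state_em_iso[OF X]
    by (auto simp: em_iso_def dest!: bij_betwE)
  have cl: "cplx (topspace X) p \<in> C.E" if "p \<in> ch_maps X (top_of_set {0..1})" for p
    using bij_betwE[OF cplx_emod_iso(2)[OF X]] that by (force simp: cplx_emod_def)
  have "kl_pred_iso X = compose (ch_maps X (top_of_set {0..1})) (cstar_pred_iso (cfun X)) (cplx_emod X)"
    unfolding kl_pred_iso_eq compose_def
    by (rule restrict_ext) (use cl in \<open>auto simp: cstar_pred_iso_def cplx_emod_def mean_def\<close>)
  then show "bij_betw (kl_pred_iso X) (carrier (cont_pred X)) (carrier (alg_dual (comparison X)))"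
    using bij_betw_compose[OF cplx_emod_iso(2)[OF X] C.cstar_pred_iso_bij] by (simp add: comparison_eq)
  fix p q assume p: "p \<in> carrier (cont_pred X)" and q: "q \<in> carrier (cont_pred X)"
    and "eplus (alg_dual (comparison X)) (kl_pred_iso X p) (kl_pred_iso X q) \<noteq> None"
  then have le: "\<forall>h\<in>pu_maps (cfun X) complex_cstar. mean X h p + mean X h q \<le> 1"
    by (auto simp: kl_pred_iso_eq split: if_splits)
  \<comment> \<open>Point masses turn the bound on means back into a bound on values.\<close>
  have "p x + q x \<le> 1" if x: "x \<in> topspace X" for x
    using bspec[OF le radon_eta_closed[OF X x]] p q
      mean_eta[OF x unit_mapD(1), of p] mean_eta[OF x unit_mapD(1), of q] by simp
  then show "eplus (cont_pred X) p q \<noteq> None" by simp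
qed

text \<open>Both composites send \<open>h\<close> and \<open>p\<close> to the iterated integral
  \<open>mean X h (\<lambda>x. mean Y (f x) p)\<close>.\<close>

lemma kl_state_natural:
  assumes X: "ch_space X" and Y: "ch_space Y" and f: "f \<in> kl_maps X Y"
  shows "compose (points (comparison X))
      (emod_dual_map (cont_pred Y) (cont_pred X) (cont_pred_map X Y f)) (kl_state_iso X)
    = compose (points (comparison X)) (kl_state_iso Y) (comparison_map X Y f)"
  unfolding compose_def[of "points (comparison X)"]
proof (rule restrict_ext)
  fix h assume hp: "h \<in> points (comparison X)"
  then have h: "h \<in> pu_maps (cfun X) complex_cstar" by simp
  have kX: "kl_state_iso X h = (\<lambda>p\<in>ch_maps X (top_of_set {0..1}). mean X h p)"
    using h by (simp add: kl_state_iso_def mean_def)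
  have ch: "comparison_map X Y f h \<in> pu_maps (cfun Y) complex_cstar"
    using ch_maps_closed[OF comparison_map_ch(2)[OF X Y f], of h] h by simp
  have kY: "kl_state_iso Y (comparison_map X Y f h) = (\<lambda>p\<in>ch_maps Y (top_of_set {0..1}). mean Y (comparison_map X Y f h) p)"
    using ch by (simp add: kl_state_iso_def mean_def)
  have "kl_state_iso X \<in> em_maps (comparison X) (emod_dual (cont_pred X))"
    using kl_state_em_iso[OF X] by (simp add: em_iso_def)
  then have pt: "kl_state_iso X h \<in> points (emod_dual (cont_pred X))" using hp by (rule em_mapsD(2))
  have "emod_dual_map (cont_pred Y) (cont_pred X) (cont_pred_map X Y f) (kl_state_iso X h) =
      compose (carrier (cont_pred Y)) (kl_state_iso X h) (cont_pred_map X Y f)"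
    using pt by (simp add: emod_dual_map_def)
  also have "\<dots> = kl_state_iso Y (comparison_map X Y f h)"
    unfolding kY compose_def carrier_cont_pred
  proof (rule restrict_ext)
    fix p assume p: "p \<in> ch_maps Y (top_of_set {0..1::real})"
    have "kl_state_iso X h (cont_pred_map X Y f p) = mean X h (\<lambda>x\<in>topspace X. mean Y (f x) p)"
      using p cont_pred_map_closed[OF Y f p] by (simp add: kX cont_pred_map_eq)
    also have "\<dots> = mean X h (\<lambda>x. mean Y (f x) p)" by (rule mean_cong) simp
    also have "\<dots> = mean Y (comparison_map X Y f h) p"
      using mean_comparison_map[OF Y f h unit_mapD(1)[OF p]] by simp
    finally show "kl_state_iso X h (cont_pred_map X Y f p) = mean Y (comparison_map X Y f h) p" .
  qed
  finally show "emod_dual_map (cont_pred Y) (cont_pred X) (cont_pred_map X Y f) (kl_state_iso X h) =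
      kl_state_iso Y (comparison_map X Y f h)" .
qed

lemma kl_pred_natural:
  assumes X: "ch_space X" and Y: "ch_space Y" and f: "f \<in> kl_maps X Y"
  shows "compose (carrier (cont_pred Y))
      (alg_dual_map (comparison X) (comparison Y) (comparison_map X Y f)) (kl_pred_iso Y)
    = compose (carrier (cont_pred Y)) (kl_pred_iso X) (cont_pred_map X Y f)"
  unfolding compose_def[of "carrier (cont_pred Y)"]
proof (rule restrict_ext)
  fix p assume pc: "p \<in> carrier (cont_pred Y)"
  then have p: "p \<in> ch_maps Y (top_of_set {0..1})" by simp
  have "kl_pred_iso Y \<in> emod_maps (cont_pred Y) (alg_dual (comparison Y))"
    using kl_pred_emod_iso[OF Y] by (simp add: emod_iso_def)
  from emod_mapsD(1)[OF this pc] have em: "kl_pred_iso Y p \<in> em_maps (comparison Y) unit_alg" by simp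
  have "alg_dual_map (comparison X) (comparison Y) (comparison_map X Y f) (kl_pred_iso Y p) =
      compose (points (comparison X)) (kl_pred_iso Y p) (comparison_map X Y f)"
    using em by (simp add: alg_dual_map_def)
  also have "\<dots> = (\<lambda>h\<in>pu_maps (cfun X) complex_cstar. mean X h (\<lambda>x\<in>topspace X. mean Y (f x) p))"
    unfolding compose_def points_comparison
  proof (rule restrict_ext)
    fix h assume h: "h \<in> pu_maps (cfun X) complex_cstar"
    have ch: "comparison_map X Y f h \<in> pu_maps (cfun Y) complex_cstar"
      using ch_maps_closed[OF comparison_map_ch(2)[OF X Y f], of h] h by simp
    have "kl_pred_iso Y p (comparison_map X Y f h) = mean X h (\<lambda>x. mean Y (f x) p)"
      using ch p mean_comparison_map[OF Y f h unit_mapD(1)[OF p]] by (simp add: kl_pred_iso_eq)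
    also have "\<dots> = mean X h (\<lambda>x\<in>topspace X. mean Y (f x) p)" by (rule mean_cong) simp
    finally show "kl_pred_iso Y p (comparison_map X Y f h) = mean X h (\<lambda>x\<in>topspace X. mean Y (f x) p)" .
  qed
  also have "\<dots> = kl_pred_iso X (cont_pred_map X Y f p)"
    using p cont_pred_map_closed[OF Y f p] by (simp add: kl_pred_iso_eq cont_pred_map_eq)
  finally show "alg_dual_map (comparison X) (comparison Y) (comparison_map X Y f) (kl_pred_iso Y p) =
      kl_pred_iso X (cont_pred_map X Y f p)" .
qed

lemma alg_dual_map_id: "alg_dual_map P P (\<lambda>x\<in>points P. x) = (\<lambda>q\<in>carrier (alg_dual P). q)"
  unfolding alg_dual_map_def
  by (rule restrict_ext) (simp add: compose_id em_unitD(3))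

theorem theorem6p2:
  fixes L :: "'l effect_mod" and M :: "'m effect_mod" and N :: "'n effect_mod"
    and P :: "'p radon_alg" and Q :: "'q radon_alg" and S :: "'s radon_alg"
    and X :: "'x topology" and Y :: "'y topology" and Z :: "'z topology"
    and A :: "'a cstar" and B :: "'b cstar" and C :: "'c cstar"
  assumes effect_modules: "effect_module L" "effect_module M" "effect_module N"
    and radon_algebras: "radon_algebra P" "radon_algebra Q" "radon_algebra S"
    and ch_spaces: "ch_space X" "ch_space Y" "ch_space Z"
    and cstar_algebras: "cstar_algebra A" "cstar_algebra B" "cstar_algebra C"
  shows
    "\<comment> \<open>EMod(-,[0,1]) is a functor from EMod^op to EM(R)\<close>
     radon_algebra (emod_dual M) \<and>
     (\<forall>f\<in>emod_maps M N. emod_dual_map M N f \<in> em_maps (emod_dual N) (emod_dual M)) \<and>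
     emod_dual_map M M (\<lambda>x\<in>carrier M. x) = (\<lambda>v\<in>points (emod_dual M). v) \<and>
     (\<forall>f\<in>emod_maps L M. \<forall>g\<in>emod_maps M N.
        emod_dual_map L N (compose (carrier L) g f)
        = compose (points (emod_dual N)) (emod_dual_map L M f) (emod_dual_map M N g)) \<and>

     \<comment> \<open>A(-,[0,1]) is a functor from EM(R) to EMod^op\<close>
     effect_module (alg_dual P) \<and>
     (\<forall>f\<in>em_maps P Q. alg_dual_map P Q f \<in> emod_maps (alg_dual Q) (alg_dual P)) \<and>
     alg_dual_map P P (\<lambda>x\<in>points P. x) = (\<lambda>q\<in>carrier (alg_dual P). q) \<and>
     (\<forall>f\<in>em_maps P Q. \<forall>g\<in>em_maps Q S.
        alg_dual_map P S (compose (points P) g f)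
        = compose (carrier (alg_dual S)) (alg_dual_map P Q f) (alg_dual_map Q S g)) \<and>

     \<comment> \<open>EMod^op(A(P,[0,1]), M) = EM(R)(P, EMod(M,[0,1])), naturally in P and M\<close>
     bij_betw (transpose_map P M) (em_maps P (emod_dual M)) (emod_maps M (alg_dual P)) \<and>
     (\<forall>f\<in>em_maps Q (emod_dual N). \<forall>h\<in>em_maps P Q. \<forall>k\<in>emod_maps M N.
        transpose_map P M
          (compose (points P) (emod_dual_map M N k) (compose (points P) f h))
        = compose (carrier M) (alg_dual_map P Q h)
            (compose (carrier M) (transpose_map Q N f) k)) \<and>

     \<comment> \<open>Cont(-,[0,1]) is a functor from Kl(R) to EMod^op\<close>
     effect_module (cont_pred X) \<and>
     (\<forall>f\<in>kl_maps X Y. cont_pred_map X Y f \<in> emod_maps (cont_pred Y) (cont_pred X)) \<and>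
     cont_pred_map X X (radon_eta X) = (\<lambda>p\<in>carrier (cont_pred X). p) \<and>
     (\<forall>f\<in>kl_maps X Y. \<forall>g\<in>kl_maps Y Z.
        cont_pred_map X Z (kl_comp X Y Z g f)
        = compose (carrier (cont_pred Z)) (cont_pred_map X Y f) (cont_pred_map Y Z g)) \<and>

     \<comment> \<open>K is a functor from Kl(R) to EM(R)\<close>
     radon_algebra (comparison X) \<and>
     (\<forall>f\<in>kl_maps X Y. comparison_map X Y f \<in> em_maps (comparison X) (comparison Y)) \<and>
     comparison_map X X (radon_eta X) = (\<lambda>h\<in>points (comparison X). h) \<and>
     (\<forall>f\<in>kl_maps X Y. \<forall>g\<in>kl_maps Y Z.
        comparison_map X Z (kl_comp X Y Z g f)
        = compose (points (comparison X)) (comparison_map Y Z g) (comparison_map X Y f)) \<and>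

     \<comment> \<open>EMod(Cont(-,[0,1]),[0,1]) is naturally isomorphic to K\<close>
     em_iso (comparison X) (emod_dual (cont_pred X)) (kl_state_iso X) \<and>
     (\<forall>f\<in>kl_maps X Y.
        compose (points (comparison X))
          (emod_dual_map (cont_pred Y) (cont_pred X) (cont_pred_map X Y f)) (kl_state_iso X)
        = compose (points (comparison X)) (kl_state_iso Y) (comparison_map X Y f)) \<and>

     \<comment> \<open>A(K(-),[0,1]) is naturally isomorphic to Cont(-,[0,1])\<close>
     emod_iso (cont_pred X) (alg_dual (comparison X)) (kl_pred_iso X) \<and>
     (\<forall>f\<in>kl_maps X Y.
        compose (carrier (cont_pred Y))
          (alg_dual_map (comparison X) (comparison Y) (comparison_map X Y f)) (kl_pred_iso Y)
        = compose (carrier (cont_pred Y)) (kl_pred_iso X) (cont_pred_map X Y f)) \<and>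

     \<comment> \<open>[0,1]_(-) is a functor from (Cstar_PU)^op to EMod^op\<close>
     effect_module (effects A) \<and>
     (\<forall>f\<in>pu_maps A B. effects_map A f \<in> emod_maps (effects A) (effects B)) \<and>
     effects_map A (\<lambda>a\<in>carrier A. a) = (\<lambda>a\<in>carrier (effects A). a) \<and>
     (\<forall>f\<in>pu_maps A B. \<forall>g\<in>pu_maps B C.
        effects_map A (compose (carrier A) g f)
        = compose (carrier (effects A)) (effects_map B g) (effects_map A f)) \<and>

     \<comment> \<open>Stat is a functor from (Cstar_PU)^op to EM(R)\<close>
     radon_algebra (stat_alg A) \<and>
     (\<forall>f\<in>pu_maps A B. stat_map A B f \<in> em_maps (stat_alg B) (stat_alg A)) \<and>
     stat_map A A (\<lambda>a\<in>carrier A. a) = (\<lambda>\<phi>\<in>points (stat_alg A). \<phi>) \<and>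
     (\<forall>f\<in>pu_maps A B. \<forall>g\<in>pu_maps B C.
        stat_map A C (compose (carrier A) g f)
        = compose (points (stat_alg C)) (stat_map A B f) (stat_map B C g)) \<and>

     \<comment> \<open>EMod([0,1]_(-),[0,1]) is naturally isomorphic to Stat\<close>
     em_iso (stat_alg A) (emod_dual (effects A)) (cstar_state_iso A) \<and>
     (\<forall>f\<in>pu_maps A B.
        compose (points (stat_alg B))
          (emod_dual_map (effects A) (effects B) (effects_map A f)) (cstar_state_iso B)
        = compose (points (stat_alg B)) (cstar_state_iso A) (stat_map A B f)) \<and>

     \<comment> \<open>A(Stat(-),[0,1]) is naturally isomorphic to [0,1]_(-)\<close>
     emod_iso (effects A) (alg_dual (stat_alg A)) (cstar_pred_iso A) \<and>
     (\<forall>f\<in>pu_maps A B.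
        compose (carrier (effects A))
          (alg_dual_map (stat_alg B) (stat_alg A) (stat_map A B f)) (cstar_pred_iso A)
        = compose (carrier (effects A)) (cstar_pred_iso B) (effects_map A f))"
proof -
  note M = effect_modules and P = radon_algebras and X = ch_spaces and A = cstar_algebras
  interpret A: cstar_algebra A by (rule A)
  have RA: "radon_algebra (comparison X)"
    unfolding comparison_eq by (intro radon_algebra_stat cfun_cstar X)
  have kl: "cont_pred_map X Y f \<in> emod_maps (cont_pred Y) (cont_pred X)"
    "comparison_map X Y f \<in> em_maps (comparison X) (comparison Y)" if "f \<in> kl_maps X Y" for f
    using cont_pred_map_emod[OF X(2) that] comparison_map_ch(1)[OF X(1,2) that] .
  have pu: "effects_map A f \<in> emod_maps (effects A) (effects B)"
    "stat_map A B f \<in> em_maps (stat_alg B) (stat_alg A)" if "f \<in> pu_maps A B" for f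
    using effects_map_emod[OF A(1,2) that] stat_map_em[OF A(1,2) that] .
  have effects_id: "effects_map A (\<lambda>a\<in>carrier A. a) = (\<lambda>a\<in>carrier (effects A). a)"
    unfolding effects_map_def by (rule restrict_ext) (simp add: A.effectD(4))
  have stat_id: "stat_map A A (\<lambda>a\<in>carrier A. a) = (\<lambda>\<phi>\<in>points (stat_alg A). \<phi>)"
    by (simp add: stat_map_id)
  show ?thesis
    by (intro conjI ballI radon_algebra_emod_dual emod_dual_map_em emod_dual_map_id emod_dual_map_compose
      effect_module_alg_dual alg_dual_map_emod alg_dual_map_id alg_dual_map_compose transpose_bij transpose_natural
      effect_module_cont_pred cont_pred_map_id cont_pred_map_compose RA comparison_map_id comparison_map_compose
      kl_state_em_iso kl_state_natural kl_pred_emod_iso kl_pred_natural kl pu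
      A.effect_module_effects effects_id effects_map_compose radon_algebra_stat stat_id stat_map_compose
      A.cstar_state_em_iso cstar_state_natural A.cstar_pred_emod_iso cstar_pred_natural M P X A)
qed

end
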